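(* Let $0 < \alpha \le 1$ and $0 < \varepsilon \le 1$. There is an algorithm that, given a graph $G = (V, E)$ on $n$ vertices and an integer $k$, runs in time $\left(\frac{k}{\varepsilon \alpha}\right)^{\mathcal{O}(k)} \cdot n^{\mathcal{O}(1)}$ and finds a set $S \subseteq V$ of size $k$ such that $\mathrm{cov}_{\alpha}(S) \ge (1-\varepsilon) \cdot \mathrm{cov}_{\alpha}(O)$, where $O$ is an optimal solution for Max $\alpha$-FCGP. Likewise, there is an algorithm with the same running time that finds a set $S \subseteq V$ of size $k$ such that $\mathrm{cov}_{\alpha}(S) \le (1+\varepsilon) \cdot \mathrm{cov}_{\alpha}(O)$, where $O$ is an optimal solution for Min $\alpha$-FCGP. In particular, both Max $\alpha$-FCGP and Min $\alpha$-FCGP admit FPT approximation schemes parameterized by $k$, $\varepsilon$ and $\alpha$.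
   Context: Graphs are finite, simple and undirected. For a graph $G=(V,E)$ and vertex sets $X, Y$, let $m(X)$ be the number of edges with both endpoints in $X$, and $m(X,Y)$ the number of edges with one endpoint in $X$ and the other in $Y$. For $0 \le \alpha \le 1$ and $S \subseteq V$ define $\mathrm{cov}_{\alpha}(S) = (1-\alpha)\cdot m(S) + \alpha \cdot m(S, V \setminus S)$. In Max $\alpha$-FCGP (resp. Min $\alpha$-FCGP), given $G$ and an integer $k$, one seeks a set of exactly $k$ vertices maximizing (resp. minimizing) $\mathrm{cov}_\alpha$; an optimal solution is a $k$-vertex set $O$ with $\mathrm{cov}_\alpha(O) \ge \mathrm{cov}_\alpha(S')$ (resp. $\le$) for every $k$-vertex set $S'$. *)

theory Defs
  imports Complex_Main
begin

section \<open>Fixed-cardinality graph partitioning\<close>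

definition simple_graph :: "'a set \<Rightarrow> 'a set set \<Rightarrow> bool" where
  "simple_graph V E \<longleftrightarrow> finite V \<and> (\<forall>e\<in>E. e \<subseteq> V \<and> card e = 2)"

definition edges_in :: "'a set set \<Rightarrow> 'a set \<Rightarrow> nat" where
  "edges_in E X = card {e \<in> E. e \<subseteq> X}"

definition edges_between :: "'a set set \<Rightarrow> 'a set \<Rightarrow> 'a set \<Rightarrow> nat" where
  "edges_between E X Y = card {e \<in> E. \<exists>x\<in>X. \<exists>y\<in>Y. e = {x, y}}"

definition cov :: "real \<Rightarrow> 'a set \<Rightarrow> 'a set set \<Rightarrow> 'a set \<Rightarrow> real" where
  "cov \<alpha> V E S = (1 - \<alpha>) * real (edges_in E S) + \<alpha> * real (edges_between E S (V - S))"

definition max_fcgp_optimal :: "real \<Rightarrow> 'a set \<Rightarrow> 'a set set \<Rightarrow> nat \<Rightarrow> 'a set \<Rightarrow> bool" where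
  "max_fcgp_optimal \<alpha> V E k Opt \<longleftrightarrow>
     Opt \<subseteq> V \<and> card Opt = k \<and> (\<forall>S'. S' \<subseteq> V \<and> card S' = k \<longrightarrow> cov \<alpha> V E Opt \<ge> cov \<alpha> V E S')"

definition min_fcgp_optimal :: "real \<Rightarrow> 'a set \<Rightarrow> 'a set set \<Rightarrow> nat \<Rightarrow> 'a set \<Rightarrow> bool" where
  "min_fcgp_optimal \<alpha> V E k Opt \<longleftrightarrow>
     Opt \<subseteq> V \<and> card Opt = k \<and> (\<forall>S'. S' \<subseteq> V \<and> card S' = k \<longrightarrow> cov \<alpha> V E Opt \<le> cov \<alpha> V E S')"

definition max_fcgp_approx :: "real \<Rightarrow> real \<Rightarrow> 'a set \<Rightarrow> 'a set set \<Rightarrow> nat \<Rightarrow> 'a set \<Rightarrow> bool" where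
  "max_fcgp_approx \<alpha> \<epsilon> V E k S \<longleftrightarrow>
     S \<subseteq> V \<and> card S = k \<and>
     (\<forall>Opt. max_fcgp_optimal \<alpha> V E k Opt \<longrightarrow> cov \<alpha> V E S \<ge> (1 - \<epsilon>) * cov \<alpha> V E Opt)"

definition min_fcgp_approx :: "real \<Rightarrow> real \<Rightarrow> 'a set \<Rightarrow> 'a set set \<Rightarrow> nat \<Rightarrow> 'a set \<Rightarrow> bool" where
  "min_fcgp_approx \<alpha> \<epsilon> V E k S \<longleftrightarrow>
     S \<subseteq> V \<and> card S = k \<and>
     (\<forall>Opt. min_fcgp_optimal \<alpha> V E k Opt \<longrightarrow> cov \<alpha> V E S \<le> (1 + \<epsilon>) * cov \<alpha> V E Opt)"


section \<open>Machine model\<close>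

text \<open>
  Algorithms are programs of a small imperative language, i.e. a structured random access machine
  with natural-number variables, natural-number arrays, and real-number variables. Every operation
  costs one time unit. The only arithmetic is addition and subtraction, and programs contain no
  constants other than natural numbers: in \<open>t\<close> steps the natural numbers grow by at most
  \<open>O(t)\<close> bits, so that unit cost is polynomially related to bit cost, and no
  information can be hidden in a program constant. Reals are needed because \<open>\<alpha>\<close> and
  \<open>\<epsilon>\<close> are arbitrary real inputs; they can be added, subtracted and compared only.
\<close>

type_synonym vname = string

datatype nexp = Const nat | Var vname | Arr vname nexp | Add nexp nexp | Sub nexp nexp

datatype rexp = RNat nexp | RVar vname | RAdd rexp rexp | RSub rexp rexp

datatype bexp = NLess nexp nexp | RLess rexp rexp | Neg bexp | Conj bexp bexp

datatype com =
    Skip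
  | Assign vname nexp
  | ArrAssign vname nexp nexp
  | RAssign vname rexp
  | Seq com com
  | If bexp com com
  | While bexp com

record state =
  nvar :: "vname \<Rightarrow> nat"
  narr :: "vname \<Rightarrow> nat \<Rightarrow> nat"
  rvar :: "vname \<Rightarrow> real"

fun nval :: "nexp \<Rightarrow> state \<Rightarrow> nat" where
  "nval (Const c) s = c"
| "nval (Var x) s = nvar s x"
| "nval (Arr x a) s = narr s x (nval a s)"
| "nval (Add a b) s = nval a s + nval b s"
| "nval (Sub a b) s = nval a s - nval b s"

fun rval :: "rexp \<Rightarrow> state \<Rightarrow> real" where
  "rval (RNat a) s = real (nval a s)"
| "rval (RVar x) s = rvar s x"
| "rval (RAdd a b) s = rval a s + rval b s"
| "rval (RSub a b) s = rval a s - rval b s"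

fun bval :: "bexp \<Rightarrow> state \<Rightarrow> bool" where
  "bval (NLess a b) s \<longleftrightarrow> nval a s < nval b s"
| "bval (RLess a b) s \<longleftrightarrow> rval a s < rval b s"
| "bval (Neg b) s \<longleftrightarrow> \<not> bval b s"
| "bval (Conj b c) s \<longleftrightarrow> bval b s \<and> bval c s"

fun ncost :: "nexp \<Rightarrow> nat" where
  "ncost (Const c) = 1"
| "ncost (Var x) = 1"
| "ncost (Arr x a) = 1 + ncost a"
| "ncost (Add a b) = 1 + ncost a + ncost b"
| "ncost (Sub a b) = 1 + ncost a + ncost b"

fun rcost :: "rexp \<Rightarrow> nat" where
  "rcost (RNat a) = 1 + ncost a"
| "rcost (RVar x) = 1"
| "rcost (RAdd a b) = 1 + rcost a + rcost b"
| "rcost (RSub a b) = 1 + rcost a + rcost b"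

fun bcost :: "bexp \<Rightarrow> nat" where
  "bcost (NLess a b) = 1 + ncost a + ncost b"
| "bcost (RLess a b) = 1 + rcost a + rcost b"
| "bcost (Neg b) = 1 + bcost b"
| "bcost (Conj b c) = 1 + bcost b + bcost c"

text \<open>\<open>exec c s t s'\<close>: started in \<open>s\<close>, the program \<open>c\<close> halts after exactly
  \<open>t\<close> time units in \<open>s'\<close>.\<close>

inductive exec :: "com \<Rightarrow> state \<Rightarrow> nat \<Rightarrow> state \<Rightarrow> bool" where
  Skip: "exec Skip s 1 s"
| Assign: "exec (Assign x a) s (1 + ncost a) (s\<lparr>nvar := (nvar s)(x := nval a s)\<rparr>)"
| ArrAssign: "exec (ArrAssign x i a) s (1 + ncost i + ncost a)
    (s\<lparr>narr := (narr s)(x := (narr s x)(nval i s := nval a s))\<rparr>)"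
| RAssign: "exec (RAssign x r) s (1 + rcost r) (s\<lparr>rvar := (rvar s)(x := rval r s)\<rparr>)"
| Seq: "exec c1 s t1 s1 \<Longrightarrow> exec c2 s1 t2 s2 \<Longrightarrow> exec (Seq c1 c2) s (t1 + t2) s2"
| IfTrue: "bval b s \<Longrightarrow> exec c1 s t s' \<Longrightarrow> exec (If b c1 c2) s (1 + bcost b + t) s'"
| IfFalse: "\<not> bval b s \<Longrightarrow> exec c2 s t s' \<Longrightarrow> exec (If b c1 c2) s (1 + bcost b + t) s'"
| WhileFalse: "\<not> bval b s \<Longrightarrow> exec (While b c) s (1 + bcost b) s"
| WhileTrue: "bval b s \<Longrightarrow> exec c s t1 s1 \<Longrightarrow> exec (While b c) s1 t2 s2 \<Longrightarrow>
    exec (While b c) s (1 + bcost b + t1 + t2) s2"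

inductive_cases exec_SkipE: "exec Skip s t s'"
inductive_cases exec_AssignE: "exec (Assign x a) s t s'"
inductive_cases exec_ArrAssignE: "exec (ArrAssign x i a) s t s'"
inductive_cases exec_RAssignE: "exec (RAssign x r) s t s'"
inductive_cases exec_SeqE: "exec (Seq c1 c2) s t s'"
inductive_cases exec_IfE: "exec (If b c1 c2) s t s'"
inductive_cases exec_WhileE: "exec (While b c) s t s'"

lemma exec_deterministic: "exec c s t s' \<Longrightarrow> exec c s u s'' \<Longrightarrow> u = t \<and> s'' = s'"
proof (induction arbitrary: u s'' rule: exec.induct)
  case (Skip s)
  then show ?case by (rule exec_SkipE) simp
next
  case (Assign x a s)
  then show ?case by (rule exec_AssignE) simp
next
  case (ArrAssign x i a s)
  then show ?case by (rule exec_ArrAssignE) simp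
next
  case (RAssign x r s)
  then show ?case by (rule exec_RAssignE) simp
next
  case (Seq c1 s t1 s1 c2 t2 s2)
  from Seq.prems show ?case by (rule exec_SeqE) (metis Seq.IH)
next
  case (IfTrue b s c1 t s' c2)
  from IfTrue.prems show ?case by (rule exec_IfE) (use IfTrue.hyps(1) in \<open>auto dest: IfTrue.IH\<close>)+
next
  case (IfFalse b s c2 t s' c1)
  from IfFalse.prems show ?case by (rule exec_IfE) (use IfFalse.hyps(1) in \<open>auto dest: IfFalse.IH\<close>)+
next
  case (WhileFalse b s c)
  from WhileFalse.prems show ?case by (rule exec_WhileE) (use WhileFalse.hyps in auto)+
next
  case (WhileTrue b s c t1 s1 t2 s2)
  from WhileTrue.prems show ?case
    by (rule exec_WhileE) (use WhileTrue.hyps(1) in \<open>auto dest: WhileTrue.IH\<close>)+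
qed

text \<open>A ternary function on the natural numbers is computable if a program computes it. The
  language is Turing complete on natural numbers, and the real variables start as zero here,
  hence they never hold anything but integers.\<close>

definition computable3 :: "(nat \<Rightarrow> nat \<Rightarrow> nat \<Rightarrow> nat) \<Rightarrow> bool" where
  "computable3 f \<longleftrightarrow>
     (\<exists>P. \<forall>x y z. \<exists>t s'.
        exec P \<lparr>nvar = (\<lambda>_. 0)(''x'' := x, ''y'' := y, ''z'' := z), narr = (\<lambda>_ _. 0), rvar = (\<lambda>_. 0)\<rparr> t s'
        \<and> nvar s' ''result'' = f x y z)"


section \<open>Algorithms for fixed-cardinality graph partitioning\<close>

text \<open>The input graph has the vertices \<open>0, \<dots>, n - 1\<close>; it is given by its adjacency matrix,
  stored row by row. The output is given by its characteristic vector.\<close>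

definition fcgp_input :: "nat \<Rightarrow> nat set set \<Rightarrow> nat \<Rightarrow> real \<Rightarrow> real \<Rightarrow> state" where
  "fcgp_input n E k \<alpha> \<epsilon> =
     \<lparr>nvar = (\<lambda>_. 0)(''n'' := n, ''k'' := k),
      narr = (\<lambda>_ _. 0)(''adj'' := (\<lambda>p. if p < n * n \<and> {p div n, p mod n} \<in> E then 1 else 0)),
      rvar = (\<lambda>_. 0)(''alpha'' := \<alpha>, ''eps'' := \<epsilon>)\<rparr>"

definition fcgp_output :: "nat \<Rightarrow> state \<Rightarrow> nat set" where
  "fcgp_output n s = {v. v < n \<and> narr s ''S'' v \<noteq> 0}"

text \<open>\<open>solves_within P T good\<close>: on every instance (\<open>k \<le> n\<close>, as otherwise there is no
  \<open>k\<close>-vertex set), \<open>P\<close> halts within time \<open>T n k \<alpha> \<epsilon>\<close> and its output satisfies \<open>good\<close>. The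
  parameters \<open>\<alpha>\<close> and \<open>\<epsilon>\<close> are inputs, so that one program serves all of them.\<close>

definition solves_within ::
  "com \<Rightarrow> (nat \<Rightarrow> nat \<Rightarrow> real \<Rightarrow> real \<Rightarrow> real) \<Rightarrow>
   (real \<Rightarrow> real \<Rightarrow> nat set \<Rightarrow> nat set set \<Rightarrow> nat \<Rightarrow> nat set \<Rightarrow> bool) \<Rightarrow> bool" where
  "solves_within P T good \<longleftrightarrow>
     (\<forall>\<alpha> \<epsilon> n E k.
        0 < \<alpha> \<and> \<alpha> \<le> 1 \<and> 0 < \<epsilon> \<and> \<epsilon> \<le> 1 \<and> simple_graph {..<n} E \<and> k \<le> n \<longrightarrow>
        (\<exists>t s'. exec P (fcgp_input n E k \<alpha> \<epsilon>) t s' \<and> real t \<le> T n k \<alpha> \<epsilon> \<and>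
                good \<alpha> \<epsilon> {..<n} E k (fcgp_output n s')))"

text \<open>FPT approximation scheme parameterized by \<open>k\<close>, \<open>\<epsilon>\<close> and \<open>\<alpha>\<close>: running time
  \<open>f(k, 1/\<epsilon>, 1/\<alpha>) * n^O(1)\<close> for a computable \<open>f\<close>, where the real arguments are
  rounded up for computability to make sense. The base \<open>n + 1\<close> (here and below) only serves to
  include the empty graph.\<close>

definition fpt_approx_scheme ::
  "(real \<Rightarrow> real \<Rightarrow> nat set \<Rightarrow> nat set set \<Rightarrow> nat \<Rightarrow> nat set \<Rightarrow> bool) \<Rightarrow> bool" where
  "fpt_approx_scheme good \<longleftrightarrow>
     (\<exists>P f c. computable3 f \<and>
        solves_within P
          (\<lambda>n k \<alpha> \<epsilon>. real (f k (nat \<lceil>1 / \<epsilon>\<rceil>) (nat \<lceil>1 / \<alpha>\<rceil>)) * (real n + 1) ^ c) good)"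

end

theory Submission
  imports Defs
begin

text \<open>
  Up to an error of \<open>k\<^sup>2\<close>, the value of a \<open>k\<close>-set is \<open>\<alpha>\<close> times its degree sum. Let
  \<open>T = 3 k\<^sup>2 \<lceil>1/\<epsilon>\<rceil> \<lceil>1/\<alpha>\<rceil>\<close>. If some optimal solution contains a vertex of degree
  above \<open>T\<close>, then that error is negligible against the optimum, and \<open>k\<close> vertices of extreme degree
  are good enough. Otherwise every optimal solution lives among vertices of degree at most \<open>T\<close>, where
  the value is additive over connected components.

  For every \<open>s \<le> k\<close>, pick \<open>N = k (T + 1)\<close> times a best connected \<open>s\<close>-set disjoint from all
  earlier picks, and let \<open>U\<close> be the union of all picks. If a component \<open>C\<close> of an optimal solution
  misses \<open>U\<close>, then one of the \<open>N\<close> disjoint picks of size \<open>|C|\<close> is neither met nor adjacent to the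
  rest of the solution, so \<open>C\<close> can be exchanged for it without loss. Hence some optimal solution has
  all its components meeting \<open>U\<close>, and it is found by growing sets from \<open>U\<close>: each step adds a
  vertex of \<open>U\<close> or a neighbour of a low-degree vertex of the set, so there are only
  \<open>(|U| + k T)\<^sup>k\<close> sets to try. The same search started in a single vertex finds the picks,
  and the picks of size 1 already contain \<open>k\<close> vertices of extreme degree. Maximization and
  minimization differ only in the sign \<open>\<sigma>\<close> of the value.
\<close>

section \<open>Exchange arguments\<close>

text \<open>The obstacle is the interaction inside a solution: relative to the degree count, an
  inner edge shifts the value by an amount whose sign depends on whether \<alpha> lies below or
  above 1/3, so neither sub- nor supermodularity is available for all \<alpha>. The proof never
  distinguishes these cases. It uses that at most \<open>k ^ 2\<close> ordered pairs interact, which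
  only hurts when the optimum is small, and that interaction stays inside components. Bounded degree
  alone does not suffice, because the components may lie anywhere among \<open>n\<close> vertices
  and guessing one start for each would cost \<open>n ^ k\<close>; the set \<open>U\<close>, whose
  size is bounded in terms of \<open>k\<close> and \<open>T\<close> only, replaces these guesses.
  The exchange needs picks that are mutually disjoint: then each pick blocked by the rest of the
  solution uses up its own vertex in the closed neighbourhood of that rest, and a count shows that
  some pick stays free.\<close>

locale fcgp =
  fixes n :: nat and E :: "nat set set" and \<alpha> \<sigma> :: real and T :: nat
  assumes sg: "simple_graph {..<n} E"
begin

section \<open>The value of a set as a sum over ordered pairs\<close>

definition nbrs :: "nat \<Rightarrow> nat set" where
  "nbrs u = {v. {u, v} \<in> E}"

lemma edgeD: "{u, v} \<in> E \<Longrightarrow> u < n \<and> v < n \<and> u \<noteq> v"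
proof -
  assume "{u, v} \<in> E"
  then have "{u, v} \<subseteq> {..<n}" "card {u, v} = 2" using sg unfolding simple_graph_def by auto
  then show ?thesis by (cases "u = v") auto
qed

lemma nbrs_subset: "nbrs u \<subseteq> {..<n}"
  using edgeD by (auto simp: nbrs_def)

lemma finite_nbrs [simp]: "finite (nbrs u)"
  using nbrs_subset finite_subset by blast

text \<open>Summing over ordered pairs counts edges inside \<open>A\<close> twice, hence the doubled weight of
  boundary edges: \<open>val\<close> is \<open>2 \<sigma>\<close> times \<open>cov\<close>.\<close>

definition wt :: "nat set \<Rightarrow> nat \<Rightarrow> nat \<Rightarrow> real" where
  "wt A u v = (if u \<in> A \<and> {u, v} \<in> E then (if v \<in> A then 1 - \<alpha> else 2 * \<alpha>) else 0)"

definition val :: "nat set \<Rightarrow> real" where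
  "val A = \<sigma> * (\<Sum>u<n. \<Sum>v<n. wt A u v)"

text \<open>The order on vertices splits the pairs into two mirror images. The half with
  \<open>u < v\<close> is in bijection with the edges, and \<open>min\<close> and \<open>max\<close>
  recover the pair from the edge.\<close>

lemma card_ordered_edges:
  "card {(u, v). u \<in> A \<and> v \<in> A \<and> {u, v} \<in> E} = 2 * edges_in E A"
proof -
  let ?P = "{(u, v). u \<in> A \<and> v \<in> A \<and> {u, v} \<in> E}"
  let ?L = "{(u, v). u \<in> A \<and> v \<in> A \<and> {u, v} \<in> E \<and> u < v}"
  let ?R = "{(u, v). u \<in> A \<and> v \<in> A \<and> {u, v} \<in> E \<and> v < u}"
  have fin: "finite ?P"
    by (rule finite_subset[of _ "{..<n} \<times> {..<n}"]) (auto dest: edgeD)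
  have P: "?P = ?L \<union> ?R"
    using edgeD by (auto simp: nat_neq_iff)
  have fL: "finite ?L" "finite ?R" using fin by (auto intro: finite_subset[OF _ fin])
  have "card ?P = card ?L + card ?R"
    unfolding P by (rule card_Un_disjoint) (use fL in auto)
  moreover have "card ?R = card ?L"
    by (rule bij_betw_same_card[of "\<lambda>(u, v). (v, u)"])
       (auto simp: bij_betw_def inj_on_def image_def insert_commute)
  moreover have "card ?L = card {e \<in> E. e \<subseteq> A}"
  proof (rule bij_betw_same_card[of "\<lambda>(u, v). {u, v}"], unfold bij_betw_def, intro conjI)
    show "inj_on (\<lambda>(u, v). {u, v}) ?L"
      by (auto simp: inj_on_def doubleton_eq_iff)
    show "(\<lambda>(u, v). {u, v}) ` ?L = {e \<in> E. e \<subseteq> A}"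
    proof (intro equalityI subsetI)
      fix e assume e: "e \<in> {e \<in> E. e \<subseteq> A}"
      then have "card e = 2" using sg unfolding simple_graph_def by auto
      then obtain x y where xy: "e = {x, y}" "x \<noteq> y" by (auto simp: card_2_iff)
      have "e = {min x y, max x y}" "min x y < max x y" using xy by (auto simp: min_def max_def)
      then show "e \<in> (\<lambda>(u, v). {u, v}) ` ?L" using e
        by (intro image_eqI[of _ _ "(min x y, max x y)"]) auto
    qed auto
  qed
  ultimately show ?thesis by (simp add: edges_in_def)
qed

text \<open>No doubling occurs: exactly one endpoint lies in \<open>A\<close>, so membership fixes
  the orientation and passing to unordered edges is injective.\<close>

lemma card_boundary_edges:
  assumes "A \<subseteq> {..<n}"
  shows "card {(u, v). u \<in> A \<and> v \<notin> A \<and> {u, v} \<in> E} = edges_between E A ({..<n} - A)"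
  unfolding edges_between_def
proof (rule bij_betw_same_card[of "\<lambda>(u, v). {u, v}"], unfold bij_betw_def, intro conjI)
  show "inj_on (\<lambda>(u, v). {u, v}) {(u, v). u \<in> A \<and> v \<notin> A \<and> {u, v} \<in> E}"
    by (auto simp: inj_on_def doubleton_eq_iff)
  show "(\<lambda>(u, v). {u, v}) ` {(u, v). u \<in> A \<and> v \<notin> A \<and> {u, v} \<in> E} =
      {e \<in> E. \<exists>x\<in>A. \<exists>y\<in>{..<n} - A. e = {x, y}}"
    by (auto dest: edgeD simp: image_def)
qed

lemma val_eq_cov:
  assumes "A \<subseteq> {..<n}"
  shows "val A = 2 * \<sigma> * cov \<alpha> {..<n} E A"
proof -
  let ?P = "{(u, v). u \<in> A \<and> v \<in> A \<and> {u, v} \<in> E}"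
  let ?B = "{(u, v). u \<in> A \<and> v \<notin> A \<and> {u, v} \<in> E}"
  have sub: "?P \<subseteq> {..<n} \<times> {..<n}" "?B \<subseteq> {..<n} \<times> {..<n}" by (auto dest: edgeD)
  have "(\<Sum>u<n. \<Sum>v<n. wt A u v) = (\<Sum>(u, v)\<in>{..<n} \<times> {..<n}. wt A u v)"
    by (simp add: sum.cartesian_product)
  also have "\<dots> = (\<Sum>p\<in>{..<n} \<times> {..<n}. (if p \<in> ?P then 1 - \<alpha> else 0) + (if p \<in> ?B then 2 * \<alpha> else 0))"
    by (rule sum.cong) (auto simp: wt_def split: if_splits)
  also have "\<dots> = (\<Sum>p\<in>{..<n} \<times> {..<n}. if p \<in> ?P then 1 - \<alpha> else 0) +
      (\<Sum>p\<in>{..<n} \<times> {..<n}. if p \<in> ?B then 2 * \<alpha> else 0)"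
    by (rule sum.distrib)
  also have "\<dots> = real (card ?P) * (1 - \<alpha>) + real (card ?B) * (2 * \<alpha>)"
    using sub by (simp add: sum.If_cases Int_absorb1)
  finally have "(\<Sum>u<n. \<Sum>v<n. wt A u v) = 2 * cov \<alpha> {..<n} E A"
    unfolding card_ordered_edges card_boundary_edges[OF assms]
    by (simp add: cov_def algebra_simps)
  then show ?thesis by (simp add: val_def)
qed

lemma val_nbrs:
  assumes "A \<subseteq> {..<n}"
  shows "val A = \<sigma> * (\<Sum>u\<in>A. \<Sum>v\<in>nbrs u. if v \<in> A then 1 - \<alpha> else 2 * \<alpha>)"
proof -
  have "(\<Sum>u<n. \<Sum>v<n. wt A u v) = (\<Sum>u\<in>A. \<Sum>v<n. wt A u v)"
    by (rule sum.mono_neutral_right) (use assms in \<open>auto simp: wt_def\<close>)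
  also have "\<dots> = (\<Sum>u\<in>A. \<Sum>v\<in>nbrs u. if v \<in> A then 1 - \<alpha> else 2 * \<alpha>)"
  proof (rule sum.cong)
    fix u assume "u \<in> A"
    have "(\<Sum>v<n. wt A u v) = (\<Sum>v\<in>nbrs u. wt A u v)"
      by (rule sum.mono_neutral_right) (use nbrs_subset in \<open>auto simp: wt_def nbrs_def\<close>)
    also have "\<dots> = (\<Sum>v\<in>nbrs u. if v \<in> A then 1 - \<alpha> else 2 * \<alpha>)"
      by (rule sum.cong) (use \<open>u \<in> A\<close> in \<open>auto simp: wt_def nbrs_def\<close>)
    finally show "(\<Sum>v<n. wt A u v) = (\<Sum>v\<in>nbrs u. if v \<in> A then 1 - \<alpha> else 2 * \<alpha>)" .
  qed simp
  finally show ?thesis by (simp add: val_def)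
qed

text \<open>The contribution of a vertex depends only on which of its neighbours are selected.
  Without edges between \<open>A\<close> and \<open>B\<close>, adding one part changes no term of
  the other.\<close>

lemma val_union:
  assumes "A \<subseteq> {..<n}" "B \<subseteq> {..<n}" "A \<inter> B = {}"
    and nonadj: "\<And>u v. u \<in> A \<Longrightarrow> v \<in> B \<Longrightarrow> {u, v} \<notin> E"
  shows "val (A \<union> B) = val A + val B"
proof -
  have fin: "finite A" "finite B" using assms finite_subset by blast+
  have 1: "(\<Sum>u\<in>A. \<Sum>v\<in>nbrs u. if v \<in> A \<union> B then 1 - \<alpha> else 2 * \<alpha>) =
      (\<Sum>u\<in>A. \<Sum>v\<in>nbrs u. if v \<in> A then 1 - \<alpha> else 2 * \<alpha>)"
    by (intro sum.cong refl) (use nonadj in \<open>auto simp: nbrs_def\<close>)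
  have 2: "(\<Sum>u\<in>B. \<Sum>v\<in>nbrs u. if v \<in> A \<union> B then 1 - \<alpha> else 2 * \<alpha>) =
      (\<Sum>u\<in>B. \<Sum>v\<in>nbrs u. if v \<in> B then 1 - \<alpha> else 2 * \<alpha>)"
    by (intro sum.cong refl) (use nonadj in \<open>auto simp: nbrs_def insert_commute dest: nonadj\<close>)
  show ?thesis
    using assms(1,2) 
    by (simp only: val_nbrs Un_least sum.union_disjoint[OF fin assms(3)] 1 2 distrib_left)
qed

text \<open>A neighbour outside \<open>A\<close> contributes 2\<alpha>, one inside contributes 1 -
  3\<alpha> more. This correction has absolute value at most 2, and each of the
  \<open>card A\<close> vertices has at most \<open>card A\<close> neighbours inside.\<close>

lemma val_degree_bound:
  assumes A: "A \<subseteq> {..<n}" and \<alpha>: "0 < \<alpha>" "\<alpha> \<le> 1" and \<sigma>: "\<bar>\<sigma>\<bar> = 1"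
  shows "\<bar>val A - \<sigma> * (2 * \<alpha> * (\<Sum>u\<in>A. real (card (nbrs u))))\<bar> \<le> 2 * real (card A) ^ 2"
proof -
  have fin: "finite A" using A finite_subset by blast
  have eq: "(\<Sum>v\<in>nbrs u. if v \<in> A then 1 - \<alpha> else 2 * \<alpha>) =
      2 * \<alpha> * real (card (nbrs u)) + (1 - 3 * \<alpha>) * real (card (nbrs u \<inter> A))" for u
  proof -
    have "(\<Sum>v\<in>nbrs u. if v \<in> A then 1 - \<alpha> else 2 * \<alpha>) =
        (\<Sum>v\<in>nbrs u. 2 * \<alpha> + (if v \<in> A then 1 - 3 * \<alpha> else 0))"
      by (rule sum.cong) auto
    then show ?thesis by (simp add: sum.distrib sum.If_cases Int_def)
  qed
  have "\<bar>val A - \<sigma> * (2 * \<alpha> * (\<Sum>u\<in>A. real (card (nbrs u))))\<bar> =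
      \<bar>\<sigma> * (\<Sum>u\<in>A. (1 - 3 * \<alpha>) * real (card (nbrs u \<inter> A)))\<bar>"
    unfolding val_nbrs[OF A] eq
    by (simp add: sum.distrib sum_distrib_left[symmetric] right_diff_distrib[symmetric])
  also have "\<dots> = \<bar>\<Sum>u\<in>A. (1 - 3 * \<alpha>) * real (card (nbrs u \<inter> A))\<bar>"
    using \<sigma> by (simp add: abs_mult)
  also have "\<dots> \<le> (\<Sum>u\<in>A. \<bar>(1 - 3 * \<alpha>) * real (card (nbrs u \<inter> A))\<bar>)"
    by (rule sum_abs)
  also have "\<dots> \<le> (\<Sum>u\<in>A. 2 * real (card A))"
  proof (rule sum_mono)
    fix u
    have "card (nbrs u \<inter> A) \<le> card A" using fin by (simp add: card_mono)
    then show "\<bar>(1 - 3 * \<alpha>) * real (card (nbrs u \<inter> A))\<bar> \<le> 2 * real (card A)"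
      unfolding abs_mult using \<alpha> by (intro mult_mono) auto
  qed
  finally show ?thesis by (simp add: power2_eq_square)
qed

lemma val_singleton: "v < n \<Longrightarrow> val {v} = \<sigma> * (2 * \<alpha> * real (card (nbrs v)))"
proof -
  assume "v < n"
  have "(\<Sum>u\<in>nbrs v. if u \<in> {v} then 1 - \<alpha> else 2 * \<alpha>) = (\<Sum>u\<in>nbrs v. 2 * \<alpha>)"
    by (rule sum.cong) (auto simp: nbrs_def dest: edgeD)
  with \<open>v < n\<close> show ?thesis by (simp add: val_nbrs)
qed

section \<open>Sets grown from seeds\<close>

text \<open>The low-degree restriction in \<open>touch\<close> bounds the number of extensions
  of a set without excluding high-degree vertices from the sets themselves.\<close>

definition touch :: "nat set \<Rightarrow> nat \<Rightarrow> bool" where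
  "touch A v \<longleftrightarrow> (\<exists>u\<in>A. card (nbrs u) \<le> T \<and> {u, v} \<in> E)"

text \<open>\<open>X\<close> holds the seeds, which may join at any time, and \<open>Z\<close> the
  forbidden vertices. With \<open>X = {x}\<close> only connected sets arise; with
  \<open>X = U\<close> every component of a grown set meets \<open>U\<close>.\<close>

definition ext :: "nat set \<Rightarrow> nat set \<Rightarrow> nat set \<Rightarrow> nat set" where
  "ext X Z A = {v. v < n \<and> v \<notin> A \<and> v \<notin> Z \<and> (v \<in> X \<or> touch A v)}"

inductive_set grow :: "nat set \<Rightarrow> nat set \<Rightarrow> nat set set" for X Z where
  empty: "{} \<in> grow X Z"
| insert: "A \<in> grow X Z \<Longrightarrow> v \<in> ext X Z A \<Longrightarrow> insert v A \<in> grow X Z"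

lemma growD: "A \<in> grow X Z \<Longrightarrow> A \<subseteq> {..<n} \<and> A \<inter> Z = {} \<and> finite A"
  by (induction rule: grow.induct) (auto simp: ext_def)

text \<open>This bounds the branching of the search: besides the seeds, only members of degree at
  most \<open>T\<close> propose vertices.\<close>

lemma card_ext:
  assumes "finite A" "finite X"
  shows "card (ext X Z A) \<le> card X + card A * T"
proof -
  let ?L = "{u \<in> A. card (nbrs u) \<le> T}"
  have "ext X Z A \<subseteq> X \<union> (\<Union>u\<in>?L. nbrs u)"
    by (auto simp: ext_def touch_def nbrs_def)
  then have "card (ext X Z A) \<le> card (X \<union> (\<Union>u\<in>?L. nbrs u))"
    using assms by (intro card_mono) auto
  also have "\<dots> \<le> card X + card (\<Union>u\<in>?L. nbrs u)" by (rule card_Un_le)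
  also have "card (\<Union>u\<in>?L. nbrs u) \<le> (\<Sum>u\<in>?L. card (nbrs u))"
    using assms by (intro card_UN_le) auto
  also have "\<dots> \<le> (\<Sum>u\<in>?L. T)" by (rule sum_mono) auto
  also have "\<dots> \<le> card A * T" using assms by (simp add: card_mono)
  finally show ?thesis by simp
qed

text \<open>Growing never removes vertices, so all intermediate sets are subsets of \<open>A\<close>
  and avoid \<open>Z'\<close> too. Thus a set grown freely is a candidate for any search whose
  forbidden set it avoids.\<close>

lemma grow_mono: "A \<in> grow X Z \<Longrightarrow> A \<inter> Z' = {} \<Longrightarrow> A \<in> grow X Z'"
  by (induction rule: grow.induct) (auto simp: ext_def intro: grow.empty intro!: grow.insert)

lemma grow_subset: "finite A \<Longrightarrow> A \<subseteq> X \<Longrightarrow> A \<subseteq> {..<n} \<Longrightarrow> A \<in> grow X {}"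
  by (induction rule: finite_induct) (auto simp: ext_def intro: grow.empty intro!: grow.insert)

text \<open>\<open>A\<close> is a largest grown subset of \<open>W\<close>. If all degrees in
  \<open>W\<close> are at most \<open>T\<close>, this yields the component of \<open>x\<close> for
  \<open>X = {x}\<close> with \<open>x\<close> in \<open>W\<close>, and the union of the components
  meeting \<open>U\<close> for \<open>X = U\<close>.\<close>

lemma grow_maximal:
  assumes "W \<subseteq> {..<n}"
  obtains A where "A \<in> grow X {}" "A \<subseteq> W" "\<And>v. v \<in> W - A \<Longrightarrow> v \<notin> X \<and> \<not> touch A v"
proof -
  let ?F = "{A \<in> grow X {}. A \<subseteq> W}"
  have finW: "finite W" using assms finite_subset by blast
  have "{} \<in> ?F" using grow.empty[of X "{}"] by blast
  moreover have "\<forall>B. B \<in> ?F \<longrightarrow> card B < Suc (card W)"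
    using finW by (auto intro: card_mono simp: less_Suc_eq_le)
  ultimately obtain A where A: "A \<in> ?F" "\<And>B. B \<in> ?F \<Longrightarrow> card B \<le> card A"
    using ex_has_greatest_nat[of "\<lambda>A. A \<in> ?F" "{}" card "Suc (card W)"] by blast
  show ?thesis
  proof (rule that)
    fix v assume v: "v \<in> W - A"
    show "v \<notin> X \<and> \<not> touch A v"
    proof (rule ccontr)
      assume "\<not> ?thesis"
      then have "v \<in> ext X {} A" using v assms by (auto simp: ext_def)
      then have "insert v A \<in> ?F" using A(1) v by (auto intro: grow.insert)
      then have "card (insert v A) \<le> card A" by (rule A(2))
      moreover have "finite A" using A(1) finW finite_subset by blast
      ultimately show False using v by simp
    qed
  qed (use A in auto)
qed

text \<open>The invariant of the greedy phase: any connected \<open>s\<close>-set that avoids \<open>U\<close> was a candidate in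
  each of the \<open>i\<close> rounds, and so lost each time against a set now contained in \<open>U\<close>.\<close>

definition rich :: "nat set \<Rightarrow> nat \<Rightarrow> nat \<Rightarrow> bool" where
  "rich U s i \<longleftrightarrow> (\<forall>x C. C \<in> grow {x} {} \<and> card C = s \<and> C \<inter> U = {} \<longrightarrow>
     (\<exists>\<B>. finite \<B> \<and> card \<B> = i \<and> pairwise disjnt \<B> \<and>
        (\<forall>B\<in>\<B>. B \<subseteq> U \<and> card B = s \<and> val C \<le> val B)))"

lemma rich_0: "rich U s 0"
  unfolding rich_def by (intro allI impI exI[of _ "{}"]) simp

text \<open>A larger \<open>U'\<close> leaves fewer sets \<open>C\<close> to beat and more room for
  the picks.\<close>

lemma rich_mono: "rich U s i \<Longrightarrow> U \<subseteq> U' \<Longrightarrow> rich U' s i"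
  unfolding rich_def
proof (intro allI impI)
  fix x C
  assume R: "\<forall>x C. C \<in> grow {x} {} \<and> card C = s \<and> C \<inter> U = {} \<longrightarrow>
      (\<exists>\<B>. finite \<B> \<and> card \<B> = i \<and> pairwise disjnt \<B> \<and>
        (\<forall>B\<in>\<B>. B \<subseteq> U \<and> card B = s \<and> val C \<le> val B))"
    and "U \<subseteq> U'" and C: "C \<in> grow {x} {} \<and> card C = s \<and> C \<inter> U' = {}"
  then have "C \<inter> U = {}" by auto
  then obtain \<B> where "finite \<B> \<and> card \<B> = i \<and> pairwise disjnt \<B> \<and>
      (\<forall>B\<in>\<B>. B \<subseteq> U \<and> card B = s \<and> val C \<le> val B)"
    using R C by blast
  with \<open>U \<subseteq> U'\<close> show "\<exists>\<B>. finite \<B> \<and> card \<B> = i \<and> pairwise disjnt \<B> \<and>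
      (\<forall>B\<in>\<B>. B \<subseteq> U' \<and> card B = s \<and> val C \<le> val B)" by blast
qed

lemma rich_Suc_best:
  assumes "rich U s i" "0 < s" "card B = s" "B \<inter> U = {}"
    and best: "\<And>x A. A \<in> grow {x} U \<Longrightarrow> card A = s \<Longrightarrow> val A \<le> val B"
  shows "rich (U \<union> B) s (Suc i)"
  unfolding rich_def
proof (intro allI impI)
  fix x C assume C: "C \<in> grow {x} {} \<and> card C = s \<and> C \<inter> (U \<union> B) = {}"
  then have "C \<inter> U = {}" by auto
  then obtain \<B> where \<B>: "finite \<B>" "card \<B> = i" "pairwise disjnt \<B>"
      "\<forall>B\<in>\<B>. B \<subseteq> U \<and> card B = s \<and> val C \<le> val B"
    using assms(1) C unfolding rich_def by blast
  \<comment> \<open>Here \<open>0 < s\<close> matters: a nonempty set disjoint from \<open>U\<close>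
    differs from all earlier picks, which lie in \<open>U\<close>, so the count really
    increases.\<close>
  have "B \<noteq> {}" using assms(2,3) by auto
  then have "B \<notin> \<B>" using \<B>(4) assms(4) by blast
  moreover have "val C \<le> val B"
    using best[OF grow_mono] C \<open>C \<inter> U = {}\<close> by blast
  moreover have "pairwise disjnt (insert B \<B>)"
    using \<B>(3,4) assms(4) by (auto simp: pairwise_insert disjnt_def)
  ultimately show "\<exists>\<B>. finite \<B> \<and> card \<B> = Suc i \<and> pairwise disjnt \<B> \<and>
      (\<forall>B'\<in>\<B>. B' \<subseteq> U \<union> B \<and> card B' = s \<and> val C \<le> val B')"
  proof (intro exI[of _ "insert B \<B>"] conjI ballI)
    fix B' assume "B' \<in> insert B \<B>"
    then show "B' \<subseteq> U \<union> B" "card B' = s" "val C \<le> val B'"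
      using \<B>(4) assms(3) \<open>val C \<le> val B\<close> by auto
  qed (use \<B> \<open>B \<notin> \<B>\<close> in simp_all)
qed

text \<open>By \<open>grow_mono\<close>, a connected \<open>s\<close>-set avoiding \<open>U\<close>
  would contradict the hypothesis, so there is nothing to beat. This covers a round without
  candidates.\<close>

lemma rich_none:
  assumes "\<And>x A. A \<in> grow {x} U \<Longrightarrow> card A \<noteq> s"
  shows "rich U s i"
  unfolding rich_def using assms[OF grow_mono] by blast

section \<open>Exchanging parts of an optimal solution\<close>

lemma disjoint_member_avoids:
  assumes "finite \<B>" "pairwise disjnt \<B>" "finite F" "card F < card \<B>"
  obtains B where "B \<in> \<B>" "B \<inter> F = {}"
proof (rule ccontr)
  assume "\<not> thesis"
  \<comment> \<open>Pigeonhole: if every member met \<open>F\<close>, choosing a common point for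
    each would be injective by disjointness.\<close>
  then have "\<forall>B\<in>\<B>. \<exists>x. x \<in> B \<inter> F" using that by blast
  then obtain f where f: "\<And>B. B \<in> \<B> \<Longrightarrow> f B \<in> B \<inter> F" by metis
  have "inj_on f \<B>"
  proof (rule inj_onI, rule ccontr)
    fix B B' assume B: "B \<in> \<B>" "B' \<in> \<B>" "f B = f B'" "B \<noteq> B'"
    then have "disjnt B B'" using assms(2) by (auto simp: pairwise_def)
    then show False using f[OF B(1)] f[OF B(2)] B(3) by (auto simp: disjnt_def)
  qed
  moreover have "f ` \<B> \<subseteq> F" using f by auto
  ultimately show False using assms card_inj_on_le leD by blast
qed

definition degsum :: "nat set \<Rightarrow> real" where
  "degsum A = \<sigma> * (\<Sum>u\<in>A. real (card (nbrs u)))"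

definition opt :: "nat \<Rightarrow> nat set \<Rightarrow> bool" where
  "opt k A \<longleftrightarrow> A \<subseteq> {..<n} \<and> card A = k \<and> (\<forall>B. B \<subseteq> {..<n} \<and> card B = k \<longrightarrow> val B \<le> val A)"

lemma opt_exists:
  assumes "k \<le> n"
  shows "\<exists>A. opt k A"
proof -
  let ?F = "{A. A \<subseteq> {..<n} \<and> card A = k}"
  have "finite ?F" by (rule finite_subset[of _ "Pow {..<n}"]) auto
  moreover have "?F \<noteq> {}" using obtain_subset_with_card_n[of k "{..<n}"] assms by auto
  ultimately have "Max (val ` ?F) \<in> val ` ?F" by (intro Max_in) simp_all
  then obtain A where A: "A \<in> ?F" "Max (val ` ?F) = val A" by blast
  have "val B \<le> val A" if "B \<in> ?F" for B
    unfolding A(2)[symmetric] by (rule Max_ge) (use \<open>finite ?F\<close> that in simp_all)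
  then show ?thesis using A(1) by (auto simp: opt_def)
qed

text \<open>Vertices outside \<open>U\<close> are replaced one by one. A singleton is a connected
  set of size 1, and its value is its signed degree up to the factor 2\<alpha>. Of the
  \<open>N\<close> disjoint singleton picks that are at least as good, the other
  \<open>k - 1\<close> vertices of \<open>A\<close> occupy fewer than \<open>N\<close>.\<close>

lemma degree_exchange:
  assumes U: "U \<subseteq> {..<n}" and "rich U 1 N" "k \<le> N" "0 < \<alpha>"
    and A: "A \<subseteq> {..<n}" "card A = k"
  shows "\<exists>K\<subseteq>U. card K = k \<and> degsum A \<le> degsum K"
  using A
proof (induction "card (A - U)" arbitrary: A)
  case 0
  have "finite A" using 0 finite_subset by blast
  then have "A \<subseteq> U" using 0 by simp
  then show ?case using 0 by blast
next
  case (Suc m)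
  have fin: "finite A" using Suc finite_subset by blast
  have "A - U \<noteq> {}" using Suc(2) by (metis card.empty nat.distinct(1))
  then obtain x where x: "x \<in> A" "x \<notin> U" by blast
  then have xn: "x < n" using Suc by auto
  have "insert x {} \<in> grow {x} {}" by (rule grow.insert) (auto simp: ext_def xn intro: grow.empty)
  then have "{x} \<in> grow {x} {} \<and> card {x} = 1 \<and> {x} \<inter> U = {}" using x by auto
  then obtain \<B> where \<B>: "finite \<B>" "card \<B> = N" "pairwise disjnt \<B>"
      "\<forall>B\<in>\<B>. B \<subseteq> U \<and> card B = 1 \<and> val {x} \<le> val B"
    using assms(2) unfolding rich_def by blast
  have "card (A - {x}) < card A" using x fin by (meson card_Diff1_less)
  then have "card (A - {x}) < card \<B>" using \<B>(2) assms(3) Suc.prems by simp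
  then obtain B where B: "B \<in> \<B>" "B \<inter> (A - {x}) = {}"
    using disjoint_member_avoids[OF \<B>(1,3), of "A - {x}"] fin by auto
  then obtain y where y: "B = {y}" "y \<in> U" "val {x} \<le> val {y}"
  proof -
    have "card B = 1" "B \<subseteq> U" "val {x} \<le> val B" using \<B>(4) B(1) by auto
    then show ?thesis using that by (auto simp: card_1_singleton_iff)
  qed
  have yA: "y \<notin> A" using y B x by auto
  have yn: "y < n" using y U by auto
  define A' where "A' = insert y (A - {x})"
  have "A' - U = (A - U) - {x}" using y by (auto simp: A'_def)
  then have "card (A' - U) = m" using Suc(2) x fin by simp
  moreover have "A' \<subseteq> {..<n}" using Suc yn by (auto simp: A'_def)
  moreover have "card A' = k" using card_Suc_Diff1[OF fin x(1)] Suc.prems fin yA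
    by (simp add: A'_def del: card_Diff_insert card_Diff_singleton)
  ultimately obtain K where K: "K \<subseteq> U" "card K = k" "degsum A' \<le> degsum K"
    using Suc(1)[of A'] by auto
  have "\<sigma> * card (nbrs x) \<le> \<sigma> * card (nbrs y)"
  proof -
    have "2 * \<alpha> * (\<sigma> * card (nbrs x)) \<le> 2 * \<alpha> * (\<sigma> * card (nbrs y))"
      using y(3) by (simp add: val_singleton[OF xn] val_singleton[OF yn] mult_ac)
    then show ?thesis using \<open>0 < \<alpha>\<close> by simp
  qed
  moreover have "degsum A' = degsum (A - {x}) + \<sigma> * card (nbrs y)"
    using fin yA by (simp add: degsum_def A'_def distrib_left)
  moreover have "degsum A = degsum (A - {x}) + \<sigma> * card (nbrs x)"
    using fin x by (simp add: degsum_def sum.remove[of A x] distrib_left)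
  ultimately show ?case using K by auto
qed

lemma component_exchange:
  assumes U: "U \<subseteq> {..<n}" and rich: "\<And>s. 1 \<le> s \<Longrightarrow> s \<le> k \<Longrightarrow> rich U s (k * (T + 1))"
    and O1: "opt k O1" and low: "\<And>u. u \<in> O1 \<Longrightarrow> card (nbrs u) \<le> T"
    and notgrow: "O1 \<notin> grow U {}"
  shows "\<exists>O2. opt k O2 \<and> card (O1 \<inter> U) < card (O2 \<inter> U)"
proof -
  have On: "O1 \<subseteq> {..<n}" and cO: "card O1 = k" using O1 by (auto simp: opt_def)
  have fin: "finite O1" using On finite_subset by blast
  \<comment> \<open>\<open>R\<close> collects the components of \<open>O1\<close> that meet
    \<open>U\<close>; since \<open>O1\<close> is not grown from \<open>U\<close>, something is left
    over.\<close>
  obtain R where R: "R \<in> grow U {}" "R \<subseteq> O1" "\<And>v. v \<in> O1 - R \<Longrightarrow> v \<notin> U \<and> \<not> touch R v"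
    using grow_maximal[OF On] by blast
  have "R \<noteq> O1" using notgrow R(1) by auto
  then obtain x where x: "x \<in> O1" "x \<notin> R" using R(2) by blast
  have "O1 - R \<subseteq> {..<n}" using On by auto
  \<comment> \<open>\<open>C\<close> is the component of \<open>x\<close>. Growing inside
    \<open>O1 - R\<close> loses nothing, because \<open>R\<close> is not adjacent to the
    remainder.\<close>
  then obtain C where C: "C \<in> grow {x} {}" "C \<subseteq> O1 - R"
      "\<And>v. v \<in> (O1 - R) - C \<Longrightarrow> v \<notin> {x} \<and> \<not> touch C v"
    using grow_maximal by blast
  have xC: "x \<in> C" using C(3) x by blast
  have finC: "finite C" using C(2) fin finite_subset by blast
  have CU: "C \<inter> U = {}" using C(2) R(3) by blast
  define D where "D = O1 - C"
  \<comment> \<open>All degrees in \<open>O1\<close> are at most \<open>T\<close>, so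
    \<open>touch\<close> is plain adjacency here and maximality of \<open>R\<close> and
    \<open>C\<close> excludes edges.\<close>
  have CD: "{u, v} \<notin> E" if "u \<in> D" "v \<in> C" for u v
  proof
    assume e: "{u, v} \<in> E"
    show False
    proof (cases "u \<in> R")
      case True
      then have "touch R v" using e low R(2) by (auto simp: touch_def)
      then show False using R(3) C(2) that by blast
    next
      case False
      have "v \<in> O1" using C(2) that(2) by blast
      then have "touch C u" unfolding touch_def using e low that(2)
        by (intro bexI[of _ v]) (simp_all add: insert_commute)
      then show False using C(3) that False by (auto simp: D_def)
    qed
  qed
  have finD: "finite D" using fin by (simp add: D_def)
  have cC: "1 \<le> card C" "card C \<le> k" using xC finC C(2) cO fin
    by (auto simp: Suc_le_eq card_gt_0_iff intro: card_mono)
  have cCD: "card C + card D = k"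
    using C(2) finC fin cO cC by (simp add: D_def card_Diff_subset subset_eq)
  obtain \<B> where \<B>: "finite \<B>" "card \<B> = k * (T + 1)" "pairwise disjnt \<B>"
      "\<forall>B\<in>\<B>. B \<subseteq> U \<and> card B = card C \<and> val C \<le> val B"
    using rich[OF cC, unfolded rich_def, rule_format, OF conjI[OF C(1) conjI[OF refl CU]]]
    by blast
  \<comment> \<open>A replacement must avoid the closed neighbourhood of \<open>D\<close>. As
    \<open>D\<close> has fewer than \<open>k\<close> vertices, each with at most \<open>T\<close>
    neighbours, \<open>card F < k * (T + 1)\<close>; this explains the number of picks.\<close>
  define F where "F = D \<union> (\<Union>u\<in>D. nbrs u)"
  have finF: "finite F" using finD by (simp add: F_def)
  have "card F \<le> card D + card (\<Union>u\<in>D. nbrs u)" unfolding F_def by (rule card_Un_le)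
  also have "card (\<Union>u\<in>D. nbrs u) \<le> (\<Sum>u\<in>D. card (nbrs u))" using finD by (rule card_UN_le)
  also have "\<dots> \<le> (\<Sum>u\<in>D. T)" by (rule sum_mono) (use low in \<open>auto simp: D_def\<close>)
  finally have "card F \<le> card D * (T + 1)" by simp
  also have "\<dots> < k * (T + 1)" using cCD cC by (intro mult_strict_right_mono) auto
  finally have "card F < card \<B>" using \<B>(2) by simp
  then obtain B where B: "B \<in> \<B>" "B \<inter> F = {}"
    using disjoint_member_avoids[OF \<B>(1,3) finF] by blast
  have BU: "B \<subseteq> U" "card B = card C" "val C \<le> val B" using B \<B>(4) by auto
  have Bn: "B \<subseteq> {..<n}" using BU U by auto
  have finB: "finite B" using Bn finite_subset by blast
  have DB: "D \<inter> B = {}" using B by (auto simp: F_def)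
  have DB2: "\<And>u v. u \<in> D \<Longrightarrow> v \<in> B \<Longrightarrow> {u, v} \<notin> E" using B by (auto simp: F_def nbrs_def)
  have Dn: "D \<subseteq> {..<n}" "C \<subseteq> {..<n}" using On C(2) by (auto simp: D_def)
  have "val (D \<union> B) = val D + val B" by (rule val_union) (use Dn Bn DB DB2 in auto)
  also have "\<dots> \<ge> val D + val C" using BU by simp
  also have "val D + val C = val (D \<union> C)"
    by (rule val_union[symmetric]) (use Dn CD in \<open>auto simp: D_def\<close>)
  also have "D \<union> C = O1" using C(2) by (auto simp: D_def)
  finally have "val O1 \<le> val (D \<union> B)" .
  moreover have "card (D \<union> B) = k" using finD finB DB BU cCD by (simp add: card_Un_disjoint)
  moreover have "val A \<le> val (D \<union> B)" if "A \<subseteq> {..<n} \<and> card A = k" for A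
  proof -
    have "val A \<le> val O1" using O1 that by (simp add: opt_def)
    then show ?thesis using \<open>val O1 \<le> val (D \<union> B)\<close> by linarith
  qed
  ultimately have "opt k (D \<union> B)"
    unfolding opt_def using Dn(1) Bn by (intro conjI allI impI) simp_all
  \<comment> \<open>The intersection with \<open>U\<close> grows strictly: \<open>C\<close> missed
    \<open>U\<close>, whereas its nonempty replacement lies inside \<open>U\<close>.\<close>
  moreover have "card (O1 \<inter> U) < card ((D \<union> B) \<inter> U)"
  proof (rule psubset_card_mono)
    have sub: "O1 \<inter> U \<subseteq> (D \<union> B) \<inter> U" using CU by (auto simp: D_def)
    have "B \<noteq> {}" using BU cC by auto
    then obtain b where "b \<in> B" by blast
    then have "b \<in> (D \<union> B) \<inter> U" "b \<notin> O1 \<inter> U"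
      using BU DB CU by (auto simp: D_def)
    then show "O1 \<inter> U \<subset> (D \<union> B) \<inter> U" using sub by blast
    show "finite ((D \<union> B) \<inter> U)" using finD finB by simp
  qed
  ultimately show ?thesis by blast
qed

text \<open>The second alternative only records a comparison of degree sums together with a
  high-degree vertex of an optimum; converting it into an approximation guarantee needs \<epsilon>
  and is left to \<open>approximation\<close>.\<close>

lemma grow_contains_good:
  assumes U: "U \<subseteq> {..<n}" and rich: "\<And>s. 1 \<le> s \<Longrightarrow> s \<le> k \<Longrightarrow> rich U s (k * (T + 1))"
    and k: "1 \<le> k" "k \<le> n" and "0 < \<alpha>"
  shows "\<exists>K A u. K \<in> grow U {} \<and> card K = k \<and> opt k A \<and>
    (val A \<le> val K \<or> u \<in> A \<and> T < card (nbrs u) \<and> degsum A \<le> degsum K)"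
proof (cases "\<exists>A u. opt k A \<and> u \<in> A \<and> T < card (nbrs u)")
  case True
  then obtain A u where A: "opt k A" "u \<in> A" "T < card (nbrs u)" by blast
  have "k \<le> k * (T + 1)" "A \<subseteq> {..<n}" "card A = k"
    using A(1) by (simp_all add: opt_def)
  from degree_exchange[OF U rich[OF order_refl k(1)] this(1) \<open>0 < \<alpha>\<close> this(2,3)]
  obtain K where K: "K \<subseteq> U" "card K = k" "degsum A \<le> degsum K" by auto
  have "K \<subseteq> {..<n}" using K(1) U by (rule subset_trans)
  then have "K \<in> grow U {}" using K(1) by (intro grow_subset) (simp_all add: finite_subset)
  then show ?thesis using K A by (intro exI[of _ K] exI[of _ A] exI[of _ u] conjI) simp_all
next
  case False
  have bound: "\<forall>A. opt k A \<longrightarrow> card (A \<inter> U) < Suc k"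
  proof (intro allI impI)
    fix A assume "opt k A"
    then have "A \<subseteq> {..<n}" "card A = k" by (simp_all add: opt_def)
    then have "card (A \<inter> U) \<le> k" using card_mono[of A "A \<inter> U"] finite_subset[of A "{..<n}"] by simp
    then show "card (A \<inter> U) < Suc k" by simp
  qed
  obtain A0 where "opt k A0" using opt_exists[OF k(2)] by blast
  \<comment> \<open>An optimum with largest intersection with \<open>U\<close> admits no further
    component exchange, hence is itself grown from \<open>U\<close>. The extremal choice replaces an
    iteration.\<close>
  then obtain A where A: "opt k A" "\<forall>B. opt k B \<longrightarrow> card (B \<inter> U) \<le> card (A \<inter> U)"
    using ex_has_greatest_nat[of "opt k" A0 "\<lambda>A. card (A \<inter> U)" "Suc k"] bound by blast
  have "card (nbrs u) \<le> T" if "u \<in> A" for u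
  proof (rule ccontr)
    assume "\<not> ?thesis"
    then have "T < card (nbrs u)" by simp
    then show False using False A(1) that by blast
  qed
  then have "\<exists>B. opt k B \<and> card (A \<inter> U) < card (B \<inter> U)" if "A \<notin> grow U {}"
    using component_exchange[OF U rich A(1) _ that] by simp
  then have "A \<in> grow U {}" using A(2) by (meson leD)
  moreover have "card A = k" using A(1) by (simp add: opt_def)
  \<comment> \<open>The first alternative holds with \<open>K = A\<close>; the witness 0 for
    \<open>u\<close> is a placeholder.\<close>
  ultimately show ?thesis using A(1) by (intro exI[of _ A] exI[of _ 0] conjI) simp_all
qed

text \<open>Since \<open>\<sigma> * val A\<close> is twice the nonnegative \<open>cov\<close>, a
  single inequality expresses the factor 1 - \<epsilon> for \<sigma> = 1 and, with negated values, 1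
  + \<epsilon> for \<sigma> = -1.\<close>

lemma approximation:
  assumes \<alpha>: "0 < \<alpha>" "\<alpha> \<le> 1" and \<epsilon>: "0 < \<epsilon>" "\<epsilon> \<le> 1" and \<sigma>: "\<bar>\<sigma>\<bar> = 1"
    and T: "3 * real k ^ 2 \<le> \<epsilon> * (\<alpha> * real T)"
    and U: "U \<subseteq> {..<n}" and rich: "\<And>s. 1 \<le> s \<Longrightarrow> s \<le> k \<Longrightarrow> rich U s (k * (T + 1))"
    and k: "1 \<le> k" "k \<le> n"
  shows "\<exists>K\<in>grow U {}. card K = k \<and> (\<forall>A. opt k A \<longrightarrow> val A - \<epsilon> * (\<sigma> * val A) \<le> val K)"
proof -
  obtain K A u where K: "K \<in> grow U {}" "card K = k" "opt k A" and
    or: "val A \<le> val K \<or> u \<in> A \<and> T < card (nbrs u) \<and> degsum A \<le> degsum K"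
    using grow_contains_good[OF U rich k \<alpha>(1)] by blast
  have An: "A \<subseteq> {..<n}" "card A = k" using K(3) by (auto simp: opt_def)
  have Kn: "K \<subseteq> {..<n}" using K(1) growD by blast
  have \<sigma>2: "\<sigma> = 1 \<or> \<sigma> = -1" using \<sigma> by linarith
  have nonneg: "0 \<le> \<sigma> * val A"
    using \<sigma>2 val_eq_cov[OF An(1)] \<alpha> unfolding cov_def by auto
  have "val A - \<epsilon> * (\<sigma> * val A) \<le> val K"
    using or
  proof (elim disjE conjE)
    assume "val A \<le> val K"
    moreover have "0 \<le> \<epsilon> * (\<sigma> * val A)" using nonneg \<epsilon> by simp
    ultimately show ?thesis by linarith
  next
    assume u: "u \<in> A" "T < card (nbrs u)" "degsum A \<le> degsum K"
    let ?D = "\<Sum>u\<in>A. real (card (nbrs u))"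
    have "finite A" using An finite_subset by blast
    then have "real (card (nbrs u)) \<le> ?D" using u(1) by (intro member_le_sum) auto
    then have D: "\<alpha> * real T \<le> \<alpha> * ?D" using u(2) \<alpha> by (intro mult_left_mono) auto
    have bA: "\<bar>val A - 2 * \<alpha> * degsum A\<bar> \<le> 2 * real k ^ 2"
      using val_degree_bound[OF An(1) \<alpha> \<sigma>] An(2) by (simp add: degsum_def algebra_simps)
    have bK: "\<bar>val K - 2 * \<alpha> * degsum K\<bar> \<le> 2 * real k ^ 2"
      using val_degree_bound[OF Kn \<alpha> \<sigma>] K(2) by (simp add: degsum_def algebra_simps)
    have "2 * \<alpha> * degsum A \<le> 2 * \<alpha> * degsum K" using u(3) \<alpha> by (intro mult_left_mono) auto
    \<comment> \<open>Passing to degree sums and back costs \<open>2 * k ^ 2\<close> each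
      way.\<close>
    then have 1: "val A - 4 * real k ^ 2 \<le> val K" using bA bK by linarith
    have "\<sigma> * (2 * \<alpha> * degsum A) = 2 * (\<alpha> * ?D)" using \<sigma>2 by (auto simp: degsum_def)
    then have "2 * (\<alpha> * ?D) - 2 * real k ^ 2 \<le> \<sigma> * val A"
    proof -
      have "\<bar>\<sigma> * (val A - 2 * \<alpha> * degsum A)\<bar> \<le> 2 * real k ^ 2"
        using bA \<sigma> by (simp add: abs_mult)
      then show ?thesis using \<open>\<sigma> * (2 * \<alpha> * degsum A) = 2 * (\<alpha> * ?D)\<close>
        unfolding right_diff_distrib by linarith
    qed
    \<comment> \<open>By the choice of \<open>T\<close> and \<epsilon> \<le> 1, the left side is at
      least \<open>6 * k ^ 2 - 2 * k ^ 2\<close>, which is precisely the loss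
      \<open>4 * k ^ 2\<close>. This is the origin of the factor 3 in \<open>T\<close>.\<close>
    then have "\<epsilon> * (2 * (\<alpha> * real T) - 2 * real k ^ 2) \<le> \<epsilon> * (\<sigma> * val A)"
      using D \<epsilon> by (intro mult_left_mono) auto
    moreover have "\<epsilon> * (2 * (\<alpha> * real T) - 2 * real k ^ 2) =
        2 * (\<epsilon> * (\<alpha> * real T)) - 2 * (\<epsilon> * real k ^ 2)" by (simp add: algebra_simps)
    moreover have "\<epsilon> * real k ^ 2 \<le> 1 * real k ^ 2" using \<epsilon> by (intro mult_right_mono) auto
    ultimately have "4 * real k ^ 2 \<le> \<epsilon> * (\<sigma> * val A)" using T by linarith
    then show ?thesis using 1 by linarith
  qed
  \<comment> \<open>All optima have the same value, so the bound for this one \<open>A\<close>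
    serves them all.\<close>
  moreover have "val B = val A" if "opt k B" for B
    using that K(3) by (intro order_antisym) (simp_all add: opt_def)
  ultimately show ?thesis using K(1,2) by (intro bexI[of _ K]) simp_all
qed

end

section \<open>Running programs\<close>

definition wp :: "com \<Rightarrow> state \<Rightarrow> (nat \<Rightarrow> state \<Rightarrow> bool) \<Rightarrow> bool" where
  "wp c s R \<longleftrightarrow> (\<exists>t s'. exec c s t s' \<and> R t s')"

text \<open>Determinism makes the run behind the existential unique, so the rules for atomic
  commands are equivalences and can be used for rewriting.\<close>

lemma wp_eqI: "exec c s t s' \<Longrightarrow> wp c s R \<longleftrightarrow> R t s'"
  unfolding wp_def using exec_deterministic by blast

lemma wp_Skip [simp]: "wp Skip s R \<longleftrightarrow> R 1 s"
  by (rule wp_eqI[OF exec.Skip])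

lemma wp_Assign [simp]:
  "wp (Assign x a) s R \<longleftrightarrow> R (1 + ncost a) (s\<lparr>nvar := (nvar s)(x := nval a s)\<rparr>)"
  by (rule wp_eqI[OF exec.Assign])

lemma wp_ArrAssign [simp]:
  "wp (ArrAssign x i a) s R \<longleftrightarrow> R (1 + ncost i + ncost a)
    (s\<lparr>narr := (narr s)(x := (narr s x)(nval i s := nval a s))\<rparr>)"
  by (rule wp_eqI[OF exec.ArrAssign])

lemma wp_RAssign [simp]:
  "wp (RAssign x r) s R \<longleftrightarrow> R (1 + rcost r) (s\<lparr>rvar := (rvar s)(x := rval r s)\<rparr>)"
  by (rule wp_eqI[OF exec.RAssign])

lemma wp_Seq [simp]: "wp (Seq c d) s R \<longleftrightarrow> wp c s (\<lambda>t s'. wp d s' (\<lambda>u. R (t + u)))"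
  unfolding wp_def by (blast intro: exec.Seq elim: exec_SeqE)

lemma wp_If [simp]:
  "wp (If b c d) s R \<longleftrightarrow>
    (if bval b s then wp c s (\<lambda>t. R (1 + bcost b + t)) else wp d s (\<lambda>t. R (1 + bcost b + t)))"
proof (cases "bval b s")
  case True
  have "exec (If b c d) s t s' \<longleftrightarrow> (\<exists>u. t = 1 + bcost b + u \<and> exec c s u s')" for t s'
  proof
    assume "exec (If b c d) s t s'"
    then show "\<exists>u. t = 1 + bcost b + u \<and> exec c s u s'" by (rule exec_IfE) (use True in auto)
  qed (use exec.IfTrue[OF True] in blast)
  then show ?thesis using True unfolding wp_def by auto
next
  case False
  have "exec (If b c d) s t s' \<longleftrightarrow> (\<exists>u. t = 1 + bcost b + u \<and> exec d s u s')" for t s'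
  proof
    assume "exec (If b c d) s t s'"
    then show "\<exists>u. t = 1 + bcost b + u \<and> exec d s u s'" by (rule exec_IfE) (use False in auto)
  qed (use exec.IfFalse[OF False] in blast)
  then show ?thesis using False unfolding wp_def by auto
qed

lemma wp_mono: "wp c s R \<Longrightarrow> (\<And>t s'. R t s' \<Longrightarrow> R' t s') \<Longrightarrow> wp c s R'"
  unfolding wp_def by blast

text \<open>The first argument of the invariant is the termination measure.\<close>

lemma wp_While:
  fixes m :: nat
  assumes "I m s"
    and "\<And>m s. I m s \<Longrightarrow> bval b s \<Longrightarrow> wp c s (\<lambda>t s'. t \<le> K \<and> (\<exists>m'<m. I m' s'))"
  shows "wp (While b c) s (\<lambda>t s'. t \<le> m * (K + 1 + bcost b) + 1 + bcost b \<and>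
    (\<exists>m'. I m' s') \<and> \<not> bval b s')"
  using assms(1)
proof (induction m arbitrary: s rule: less_induct)
  case (less m)
  show ?case
  proof (cases "bval b s")
    case False
    then have "exec (While b c) s (1 + bcost b) s" by (rule exec.WhileFalse)
    moreover have "1 + bcost b \<le> m * (K + 1 + bcost b) + 1 + bcost b" by simp
    ultimately show ?thesis unfolding wp_def using False less.prems by blast
  next
    case True
    then obtain t s1 m1 where 1: "exec c s t s1" "t \<le> K" "m1 < m" "I m1 s1"
      using assms(2)[OF less.prems] unfolding wp_def by blast
    obtain t' s' m' where 2: "exec (While b c) s1 t' s'" "t' \<le> m1 * (K + 1 + bcost b) + 1 + bcost b"
        "I m' s'" "\<not> bval b s'"
      using less.IH[OF 1(3,4)] unfolding wp_def by blast
    have "exec (While b c) s (1 + bcost b + t + t') s'"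
      using True 1(1) 2(1) by (rule exec.WhileTrue)
    moreover have "1 + bcost b + t + t' \<le> m * (K + 1 + bcost b) + 1 + bcost b"
    proof -
      \<comment> \<open>Each iteration is charged to a decrease of the measure by at least
        one.\<close>
      have "(m1 + 1) * (K + 1 + bcost b) \<le> m * (K + 1 + bcost b)"
        using 1(3) by (intro mult_right_mono) auto
      then show ?thesis using 1(2) 2(2) by simp
    qed
    ultimately show ?thesis unfolding wp_def using 2(3,4) by blast
  qed
qed

section \<open>Frames: what a program may write\<close>

fun nmod :: "com \<Rightarrow> vname set" where
  "nmod (Assign x a) = {x}"
| "nmod (Seq c d) = nmod c \<union> nmod d"
| "nmod (If b c d) = nmod c \<union> nmod d"
| "nmod (While b c) = nmod c"
| "nmod _ = {}"

fun amod :: "com \<Rightarrow> vname set" where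
  "amod (ArrAssign x i a) = {x}"
| "amod (Seq c d) = amod c \<union> amod d"
| "amod (If b c d) = amod c \<union> amod d"
| "amod (While b c) = amod c"
| "amod _ = {}"

fun rmod :: "com \<Rightarrow> vname set" where
  "rmod (RAssign x r) = {x}"
| "rmod (Seq c d) = rmod c \<union> rmod d"
| "rmod (If b c d) = rmod c \<union> rmod d"
| "rmod (While b c) = rmod c"
| "rmod _ = {}"

definition frame :: "com \<Rightarrow> state \<Rightarrow> state \<Rightarrow> bool" where
  "frame c s s' \<longleftrightarrow> (\<forall>x. x \<notin> nmod c \<longrightarrow> nvar s' x = nvar s x) \<and>
     (\<forall>x. x \<notin> amod c \<longrightarrow> narr s' x = narr s x) \<and> (\<forall>x. x \<notin> rmod c \<longrightarrow> rvar s' x = rvar s x)"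

lemma exec_frame: "exec c s t s' \<Longrightarrow> frame c s s'"
  by (induction rule: exec.induct) (simp_all add: frame_def)

lemma wp_frame: "wp c s R \<Longrightarrow> wp c s (\<lambda>t s'. R t s' \<and> frame c s s')"
  unfolding wp_def using exec_frame by blast

text \<open>Correctness lemmas need only state what a program computes; that everything else is
  preserved follows from its syntactic write sets.\<close>

lemma wp_post: "wp c s R \<Longrightarrow> (\<And>t s'. R t s' \<Longrightarrow> frame c s s' \<Longrightarrow> R' t s') \<Longrightarrow> wp c s R'"
  using wp_frame wp_mono by (metis (mono_tags, lifting))

abbreviation nset :: "vname \<Rightarrow> nat \<Rightarrow> state \<Rightarrow> state" where
  "nset x a s \<equiv> s\<lparr>nvar := (nvar s)(x := a)\<rparr>"

definition For :: "vname \<Rightarrow> vname \<Rightarrow> com \<Rightarrow> com" where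
  "For x m c = Seq (Assign x (Const 0))
     (While (NLess (Var x) (Var m)) (Seq c (Assign x (Add (Var x) (Const 1)))))"

lemma mod_For [simp]:
  "nmod (For x m c) = insert x (nmod c)" "amod (For x m c) = amod c" "rmod (For x m c) = rmod c"
  by (auto simp: For_def)

text \<open>Per iteration, guard and increment cost 4 each; outside, the initial assignment costs 2
  and the failing guard 4. The bound \<open>m\<close> is reread in every iteration, so the body must
  not write it. The step establishes the invariant with \<open>x\<close> already
  incremented.\<close>

lemma wp_For:
  assumes 0: "I 0 (nset x 0 s)" and x: "x \<notin> nmod c" "m \<notin> nmod c" "x \<noteq> m"
    and step: "\<And>j s'. j < nvar s m \<Longrightarrow> nvar s' x = j \<Longrightarrow> nvar s' m = nvar s m \<Longrightarrow>
      frame (For x m c) s s' \<Longrightarrow> I j s' \<Longrightarrow> wp c s' (\<lambda>t s''. t \<le> K \<and> I (Suc j) (nset x (Suc j) s''))"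
  shows "wp (For x m c) s (\<lambda>t s'. t \<le> nvar s m * (K + 8) + 6 \<and> I (nvar s m) s' \<and> nvar s' x = nvar s m)"
proof -
  let ?M = "nvar s m"
  let ?b = "NLess (Var x) (Var m)"
  let ?c = "Seq c (Assign x (Add (Var x) (Const 1)))"
  define J where "J d s' \<longleftrightarrow> (\<exists>j. j + d = ?M \<and> nvar s' x = j \<and> nvar s' m = ?M \<and>
    frame (For x m c) s s' \<and> I j s')" for d s'
  have J0: "J ?M (nset x 0 s)" using x 0 by (auto simp: J_def frame_def)
  have "wp (While ?b ?c) (nset x 0 s) (\<lambda>t s'. t \<le> ?M * ((K + 4) + 1 + bcost ?b) + 1 + bcost ?b \<and>
    (\<exists>m'. J m' s') \<and> \<not> bval ?b s')"
  proof (rule wp_While[of J, OF J0])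
    fix d s1 assume J: "J d s1" and b: "bval ?b s1"
    then obtain j where j: "j + d = ?M" "nvar s1 x = j" "nvar s1 m = ?M" "frame (For x m c) s s1"
      "I j s1" by (auto simp: J_def)
    have jM: "j < ?M" using b j by simp
    have "wp c s1 (\<lambda>t s''. t \<le> K \<and> I (Suc j) (nset x (Suc j) s''))"
      by (rule step) (use j jM in auto)
    then show "wp ?c s1 (\<lambda>t s'. t \<le> K + 4 \<and> (\<exists>m'<d. J m' s'))"
      unfolding wp_Seq
    proof (rule wp_post)
      fix t s2 assume t: "t \<le> K \<and> I (Suc j) (nset x (Suc j) s2)" and fr: "frame c s1 s2"
      have "nvar s2 x = j" "nvar s2 m = ?M" using fr x j by (auto simp: frame_def)
      moreover have "frame (For x m c) s (nset x (Suc j) s2)" using fr j(4) by (auto simp: frame_def)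
      ultimately have "J (d - 1) (nset x (Suc j) s2)" using t j(1) jM x by (auto simp: J_def)
      moreover have "d - 1 < d" using j(1) jM by simp
      ultimately show "wp (Assign x (Add (Var x) (Const 1))) s2
          (\<lambda>u s'. t + u \<le> K + 4 \<and> (\<exists>m'<d. J m' s'))"
        using t \<open>nvar s2 x = j\<close> by auto
    qed
  qed
  then have "wp (While ?b ?c) (nset x 0 s) (\<lambda>t s'. 2 + t \<le> ?M * (K + 8) + 6 \<and> I ?M s' \<and> nvar s' x = ?M)"
  proof (rule wp_mono, elim conjE exE)
    fix t s' d
    assume t: "t \<le> ?M * (K + 4 + 1 + bcost ?b) + 1 + bcost ?b" and "J d s'" "\<not> bval ?b s'"
    then have "nvar s' x = ?M \<and> I (nvar s' x) s'" by (auto simp: J_def)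
    then show "2 + t \<le> ?M * (K + 8) + 6 \<and> I ?M s' \<and> nvar s' x = ?M"
      using t by (auto simp: algebra_simps)
  qed
  then show ?thesis by (simp add: For_def)
qed

section \<open>Exhaustive search\<close>

abbreviation seq (infixr ";;" 60) where "c ;; d \<equiv> Seq c d"
abbreviation "pos a \<equiv> NLess (Const 0) a"
abbreviation "row x \<equiv> Arr ''Q'' (Add (Var ''h'') (Var x))"

text \<open>Program variables: \<open>Q\<close> is the queue of generated sets, stored as characteristic
  vectors of length \<open>n\<close>; \<open>h\<close> and \<open>q\<close> are the offsets of its current row and of its end. For
  the current row, \<open>c\<close> is its cardinality, \<open>z\<close> its signed value and \<open>B\<close> the vertices it
  touches. \<open>L\<close> marks the low-degree vertices, \<open>U\<close> the vertices picked so far, and \<open>S\<close>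
  the best set found so far, with value \<open>b\<close> (meaningful only if the flag \<open>f\<close> is set).\<close>

definition scan_cell :: "bool \<Rightarrow> com" where
  "scan_cell mx = (let acc = (if mx then RAdd else RSub) in
    If (Conj (pos (row ''u'')) (pos (Arr ''adj'' (Var ''p''))))
      (If (pos (Arr ''L'' (Var ''u''))) (ArrAssign ''B'' (Var ''v'') (Const 1)) Skip ;;
       If (pos (row ''v''))
         (RAssign ''z'' (acc (RVar ''z'') (RSub (RNat (Const 1)) (RVar ''alpha''))))
         (RAssign ''z'' (acc (acc (RVar ''z'') (RVar ''alpha'')) (RVar ''alpha''))))
      Skip ;;
    Assign ''p'' (Add (Var ''p'') (Const 1)))"

text \<open>The pointer \<open>p\<close> advances with every cell in row-major order, since the
  machine has no product to form \<open>u * n + v\<close>. For the same reason the weight 2\<alpha>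
  of a boundary edge is obtained by applying \<open>acc\<close> twice.\<close>

definition scan :: "bool \<Rightarrow> com" where
  "scan mx = Assign ''c'' (Const 0) ;; Assign ''p'' (Const 0) ;; RAssign ''z'' (RNat (Const 0)) ;;
    For ''v'' ''n'' (ArrAssign ''B'' (Var ''v'') (Const 0)) ;;
    For ''u'' ''n'' (
      If (pos (row ''u'')) (Assign ''c'' (Add (Var ''c'') (Const 1))) Skip ;;
      For ''v'' ''n'' (scan_cell mx))"

lemma mod_scan_cell [simp]:
  "nmod (scan_cell mx) = {''p''}" "amod (scan_cell mx) = {''B''}" "rmod (scan_cell mx) = {''z''}"
  by (auto simp: scan_cell_def Let_def)

lemma mod_scan [simp]:
  "nmod (scan mx) = {''c'', ''p'', ''u'', ''v''}" "amod (scan mx) = {''B''}" "rmod (scan mx) = {''z''}"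
  by (auto simp: scan_def)

context fcgp
begin

definition input_state :: "state \<Rightarrow> bool" where
  "input_state s \<longleftrightarrow> nvar s ''n'' = n \<and> rvar s ''alpha'' = \<alpha> \<and>
    (\<forall>u<n. \<forall>v<n. 0 < narr s ''adj'' (u * n + v) \<longleftrightarrow> {u, v} \<in> E)"

definition low_state :: "state \<Rightarrow> bool" where
  "low_state s \<longleftrightarrow> (\<forall>u<n. 0 < narr s ''L'' u \<longleftrightarrow> card (nbrs u) \<le> T)"

lemma scan_row_correct:
  assumes s: "input_state s" "low_state s" "nvar s ''p'' = u * n" "nvar s ''u'' = u"
    and Q: "\<forall>v<n. 0 < narr s ''Q'' (nvar s ''h'' + v) \<longleftrightarrow> v \<in> A"
    and u: "u < n" and \<sigma>: "\<sigma> = (if mx then 1 else -1)"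
  shows "wp (For ''v'' ''n'' (scan_cell mx)) s
    (\<lambda>t s'. t \<le> n * (50 + 8) + 6 \<and> nvar s' ''p'' = Suc u * n \<and>
      rvar s' ''z'' = rvar s ''z'' + \<sigma> * (\<Sum>v<n. wt A u v) \<and>
      (\<forall>v<n. 0 < narr s' ''B'' v \<longleftrightarrow> 0 < narr s ''B'' v \<or> u \<in> A \<and> card (nbrs u) \<le> T \<and> {u, v} \<in> E))"
proof -
  define I where "I j s' \<longleftrightarrow> nvar s' ''p'' = u * n + j \<and>
      rvar s' ''z'' = rvar s ''z'' + \<sigma> * (\<Sum>v<j. wt A u v) \<and>
      (\<forall>v<n. 0 < narr s' ''B'' v \<longleftrightarrow> 0 < narr s ''B'' v \<or>
        v < j \<and> u \<in> A \<and> card (nbrs u) \<le> T \<and> {u, v} \<in> E)" for j :: nat and s' :: state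
  have n: "nvar s ''n'' = n" using s(1) by (simp add: input_state_def)
  show ?thesis
  proof (rule wp_mono, rule wp_For[where I = I and K = 50])
    fix j s' assume j: "j < nvar s ''n''" "nvar s' ''v'' = j" "nvar s' ''n'' = nvar s ''n''"
      and fr: "frame (For ''v'' ''n'' (scan_cell mx)) s s'" and I: "I j s'"
    have jn: "j < n" using j n by simp
    have e: "nvar s' ''h'' = nvar s ''h''" "nvar s' ''u'' = u" "narr s' ''Q'' = narr s ''Q''"
      "narr s' ''L'' = narr s ''L''" "narr s' ''adj'' = narr s ''adj''" "rvar s' ''alpha'' = \<alpha>"
      using fr s by (simp_all add: frame_def input_state_def)
    have p: "nvar s' ''p'' = u * n + j" and z: "rvar s' ''z'' = rvar s ''z'' + \<sigma> * (\<Sum>v<j. wt A u v)"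
      and B: "\<forall>v<n. 0 < narr s' ''B'' v \<longleftrightarrow> 0 < narr s ''B'' v \<or>
        v < j \<and> u \<in> A \<and> card (nbrs u) \<le> T \<and> {u, v} \<in> E"
      using I by (simp_all add: I_def)
    have c: "0 < narr s ''Q'' (nvar s ''h'' + u) \<longleftrightarrow> u \<in> A"
      "0 < narr s ''Q'' (nvar s ''h'' + j) \<longleftrightarrow> j \<in> A"
      "0 < narr s ''L'' u \<longleftrightarrow> card (nbrs u) \<le> T" 
      "0 < narr s ''adj'' (u * n + j) \<longleftrightarrow> {u, j} \<in> E"
      using Q s u jn by (simp_all add: low_state_def input_state_def)
    show "wp (scan_cell mx) s'
        (\<lambda>t s''. t \<le> 50 \<and> I (Suc j) (nset ''v'' (Suc j) s''))"
    proof (cases "u \<in> A \<and> {u, j} \<in> E")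
      case False
      then have "\<forall>v<n. 0 < narr s' ''B'' v \<longleftrightarrow> 0 < narr s ''B'' v \<or>
        v < Suc j \<and> u \<in> A \<and> card (nbrs u) \<le> T \<and> {u, v} \<in> E"
        using B by (auto simp: less_Suc_eq)
      then show ?thesis using False by (auto simp: scan_cell_def e p j(2) c I_def z wt_def)
    next
      case True
      show ?thesis
        by (cases "card (nbrs u) \<le> T"; cases "j \<in> A"; cases mx)
          (use True B in \<open>simp_all add: e p j(2) c I_def z wt_def scan_cell_def \<sigma>\<close>,
           auto simp: less_Suc_eq)
    qed
  qed (use n in \<open>auto simp: I_def s\<close>)
qed

lemma scan_correct:
  assumes s: "input_state s" "low_state s"
    and Q: "\<forall>v<n. 0 < narr s ''Q'' (nvar s ''h'' + v) \<longleftrightarrow> v \<in> A"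
    and A: "A \<subseteq> {..<n}" and \<sigma>: "\<sigma> = (if mx then 1 else -1)"
  shows "wp (scan mx) s (\<lambda>t s'. t \<le> 100 * (n + 1) ^ 2 \<and> nvar s' ''c'' = card A \<and>
    rvar s' ''z'' = val A \<and> (\<forall>v<n. 0 < narr s' ''B'' v \<longleftrightarrow> touch A v))"
proof -
  define inner where "inner = For ''v'' ''n'' (scan_cell mx)"
  define outer where "outer = For ''u'' ''n''
      (If (pos (row ''u'')) (Assign ''c'' (Add (Var ''c'') (Const 1))) Skip ;; inner)"
  have mods: "nmod inner = {''p'', ''v''}" "amod inner = {''B''}" "rmod inner = {''z''}"
    by (auto simp: inner_def)
  have n: "nvar s ''n'' = n" using s(1) by (simp add: input_state_def)
  have finA: "finite A" using A finite_subset by blast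
  define I where "I j s' \<longleftrightarrow> nvar s' ''p'' = j * n \<and> nvar s' ''c'' = card (A \<inter> {..<j}) \<and>
      rvar s' ''z'' = \<sigma> * (\<Sum>u<j. \<Sum>v<n. wt A u v) \<and>
      (\<forall>v<n. 0 < narr s' ''B'' v \<longleftrightarrow> (\<exists>u\<in>A. u < j \<and> card (nbrs u) \<le> T \<and> {u, v} \<in> E))" 
    for j :: nat and s' :: state
  have outer: "wp outer s1 (\<lambda>t s'. t \<le> n * ((n * 58 + 20) + 8) + 6 \<and> I n s')"
    if fr: "frame (scan mx) s s1" and s1: "nvar s1 ''c'' = 0" "nvar s1 ''p'' = 0" "rvar s1 ''z'' = 0"
      "\<forall>v<n. narr s1 ''B'' v = 0" for s1
    unfolding outer_def
  proof (rule wp_mono, rule wp_For[where I = I and K = "n * 58 + 20"])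
    show "I 0 (nset ''u'' 0 s1)" using s1 by (simp add: I_def)
    fix j s' assume j: "j < nvar s1 ''n''" "nvar s' ''u'' = j" "nvar s' ''n'' = nvar s1 ''n''"
      and fr2: "frame (For ''u'' ''n''
      (If (pos (row ''u'')) (Assign ''c'' (Add (Var ''c'') (Const 1))) Skip ;; inner)) s1 s'"
      and I: "I j s'"
    have jn: "j < n" using fr j(1) n by (simp add: frame_def)
    have e: "nvar s' ''h'' = nvar s ''h''" "nvar s' ''n'' = n" "narr s' ''Q'' = narr s ''Q''"
      "narr s' ''L'' = narr s ''L''" "narr s' ''adj'' = narr s ''adj''" "rvar s' ''alpha'' = \<alpha>"
      using fr fr2 s by (simp_all add: frame_def mods input_state_def)
    define cnt where "cnt = card (A \<inter> {..<Suc j})"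
    have cnt: "cnt = (if j \<in> A then Suc (card (A \<inter> {..<j})) else card (A \<inter> {..<j}))"
    proof -
      have "A \<inter> {..<Suc j} = (if j \<in> A then insert j (A \<inter> {..<j}) else A \<inter> {..<j})"
        by (auto simp: less_Suc_eq)
      then show ?thesis by (simp add: cnt_def)
    qed
    have inner: "wp inner s2 (\<lambda>t s''. t \<le> n * 58 + 6 \<and> I (Suc j) (nset ''u'' (Suc j) s''))"
      if s2: "s2 = nset ''c'' cnt s' " for s2
    proof (rule wp_post)
      show "wp inner s2 (\<lambda>t s''. t \<le> n * (50 + 8) + 6 \<and> nvar s'' ''p'' = Suc j * n \<and>
        rvar s'' ''z'' = rvar s2 ''z'' + \<sigma> * (\<Sum>v<n. wt A j v) \<and>
        (\<forall>v<n. 0 < narr s'' ''B'' v \<longleftrightarrow>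
           0 < narr s2 ''B'' v \<or> j \<in> A \<and> card (nbrs j) \<le> T \<and> {j, v} \<in> E))"
        unfolding inner_def
        by (rule scan_row_correct)
          (use s I Q jn \<sigma> in \<open>simp_all add: s2 e j(2) I_def input_state_def low_state_def\<close>)
    next
      fix t s''
      assume *: "t \<le> n * (50 + 8) + 6 \<and> nvar s'' ''p'' = Suc j * n \<and>
        rvar s'' ''z'' = rvar s2 ''z'' + \<sigma> * (\<Sum>v<n. wt A j v) \<and>
        (\<forall>v<n. 0 < narr s'' ''B'' v \<longleftrightarrow>
           0 < narr s2 ''B'' v \<or> j \<in> A \<and> card (nbrs j) \<le> T \<and> {j, v} \<in> E)"
        and fr3: "frame inner s2 s''"
      have "nvar s'' ''c'' = cnt" using fr3 by (simp add: s2 frame_def mods)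
      then show "t \<le> n * 58 + 6 \<and> I (Suc j) (nset ''u'' (Suc j) s'')"
        using * I by (auto simp: I_def s2 less_Suc_eq cnt_def distrib_left)
    qed
    \<comment> \<open>Writing the unchanged state as a trivial update makes both branches of the
      conditional instances of \<open>inner\<close>.\<close>
    have same: "s' = nset ''c'' (card (A \<inter> {..<j})) s'"
      using I fun_upd_triv[of "nvar s'" "''c''"] by (simp add: I_def)
    have "0 < narr s ''Q'' (nvar s ''h'' + j) \<longleftrightarrow> j \<in> A" using Q jn by blast
    then show "wp (If (pos (row ''u'')) (Assign ''c'' (Add (Var ''c'') (Const 1))) Skip ;; inner) s'
        (\<lambda>t s''. t \<le> n * 58 + 20 \<and> I (Suc j) (nset ''u'' (Suc j) s''))"
      using I same by (auto simp: e j(2) I_def[of j] cnt intro!: wp_mono[OF inner])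
  qed (use n fr in \<open>auto simp: mods frame_def\<close>)
  let ?s = "s\<lparr>nvar := (nvar s)(''c'' := 0, ''p'' := 0), rvar := (rvar s)(''z'' := 0)\<rparr>"
  have "wp (For ''v'' ''n'' (ArrAssign ''B'' (Var ''v'') (Const 0))) ?s
    (\<lambda>t s'. t \<le> nvar ?s ''n'' * (3 + 8) + 6 \<and> (\<forall>v<nvar ?s ''n''. narr s' ''B'' v = 0) \<and>
      nvar s' ''v'' = nvar ?s ''n'')"
    by (rule wp_For) (auto simp: less_Suc_eq)
  then have clear: "wp (For ''v'' ''n'' (ArrAssign ''B'' (Var ''v'') (Const 0))) ?s
    (\<lambda>t s'. t \<le> n * 11 + 6 \<and> wp outer s' (\<lambda>t s'. t \<le> n * ((n * 58 + 20) + 8) + 6 \<and> I n s'))"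
    by (rule wp_post, intro conjI outer) (auto simp: frame_def n)
  have A': "A \<inter> {..<n} = A" "u \<in> A \<Longrightarrow> u < n" for u using A by auto
  have "wp (scan mx) s (\<lambda>t s'. t \<le> 100 * (n + 1) ^ 2 \<and> I n s')"
    unfolding scan_def inner_def[symmetric] outer_def[symmetric]
    by (auto intro!: wp_mono[OF clear] elim!: wp_mono simp: power2_eq_square algebra_simps)
  then show ?thesis
    by (rule wp_mono) (auto simp: I_def A' val_def touch_def)
qed

end

section \<open>Appending the extensions of the current row\<close>

definition push :: "bexp \<Rightarrow> com" where
  "push b = For ''v'' ''n''
    (If (Conj (Neg (pos (row ''v''))) b)
      (For ''w'' ''n'' (ArrAssign ''Q'' (Add (Var ''q'') (Var ''w'')) (row ''w'')) ;;
       ArrAssign ''Q'' (Add (Var ''q'') (Var ''v'')) (Const 1) ;;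
       Assign ''q'' (Add (Var ''q'') (Var ''n'')))
      Skip)"

lemma mod_push [simp]:
  "nmod (push b) = {''q'', ''v'', ''w''}" "amod (push b) = {''Q''}" "rmod (push b) = {}"
  by (auto simp: push_def)

text \<open>The source row ends before \<open>q\<close>, so the copy never overwrites what it still
  has to read.\<close>

lemma copy_row:
  assumes "nvar s ''n'' = n" "nvar s ''h'' + n \<le> nvar s ''q''"
  shows "wp (For ''w'' ''n'' (ArrAssign ''Q'' (Add (Var ''q'') (Var ''w'')) (row ''w''))) s
    (\<lambda>t s'. t \<le> n * (8 + 8) + 6 \<and>
      (\<forall>p<nvar s ''q''. narr s' ''Q'' p = narr s ''Q'' p) \<and>
      (\<forall>v<n. narr s' ''Q'' (nvar s ''q'' + v) = narr s ''Q'' (nvar s ''h'' + v)))"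
proof -
  define I where "I j s' \<longleftrightarrow> (\<forall>p<nvar s ''q''. narr s' ''Q'' p = narr s ''Q'' p) \<and>
      (\<forall>v<j. narr s' ''Q'' (nvar s ''q'' + v) = narr s ''Q'' (nvar s ''h'' + v))"
    for j :: nat and s' :: state
  show ?thesis
    by (rule wp_mono, rule wp_For[where I = I and K = 8])
      (use assms in \<open>auto simp: I_def frame_def less_Suc_eq\<close>)
qed

text \<open>A list rather than a set, because the queue is not checked for duplicates: a set may be
  reached by several insertion orders.\<close>

definition rows :: "nat \<Rightarrow> (nat \<Rightarrow> nat) \<Rightarrow> nat set list \<Rightarrow> bool" where
  "rows n Q Fs \<longleftrightarrow> (\<forall>i<length Fs. \<forall>v<n. 0 < Q (i * n + v) \<longleftrightarrow> v \<in> Fs ! i)"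

lemma row_index_less:
  fixes i v n l :: nat
  shows "i < l \<Longrightarrow> v < n \<Longrightarrow> i * n + v < l * n"
proof -
  assume "i < l" "v < n"
  then have "i * n + v < (i + 1) * n" by simp
  also have "\<dots> \<le> l * n" using \<open>i < l\<close> by (intro mult_right_mono) auto
  finally show ?thesis .
qed

lemma rows_snoc:
  assumes "rows n Q Fs" "\<forall>p<length Fs * n. Q' p = Q p" "\<forall>v<n. 0 < Q' (length Fs * n + v) \<longleftrightarrow> v \<in> A"
  shows "rows n Q' (Fs @ [A])"
  using assms by (auto simp: rows_def nth_append less_Suc_eq row_index_less)

context fcgp
begin

text \<open>Quantifying over all states with the same \<open>x\<close> and \<open>U\<close> keeps
  the property valid while the search changes its other variables. The test is a parameter so that
  both kinds of search share one program; its cost bound keeps it constant-time.\<close>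

definition test_state :: "bexp \<Rightarrow> nat set \<Rightarrow> nat set \<Rightarrow> state \<Rightarrow> bool" where
  "test_state b X Z s \<longleftrightarrow> bcost b \<le> 30 \<and> (\<forall>s'. nvar s' ''x'' = nvar s ''x'' \<longrightarrow>
    narr s' ''U'' = narr s ''U'' \<longrightarrow> nvar s' ''v'' < n \<longrightarrow>
    (bval b s' \<longleftrightarrow> nvar s' ''v'' \<notin> Z \<and> (nvar s' ''v'' \<in> X \<or> 0 < narr s' ''B'' (nvar s' ''v''))))"

lemma push_correct:
  assumes n: "nvar s ''n'' = n" and b: "test_state b X Z s"
    and Q: "rows n (narr s ''Q'') Fs" "nvar s ''q'' = length Fs * n"
    and i: "nvar s ''h'' = i * n" "i < length Fs"
    and B: "\<forall>v<n. 0 < narr s ''B'' v \<longleftrightarrow> touch (Fs ! i) v"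
  shows "wp (push b) s (\<lambda>t s'. t \<le> 80 * (n + 1) ^ 2 \<and> (\<exists>Gs. rows n (narr s' ''Q'') (Fs @ Gs) \<and>
    nvar s' ''q'' = length (Fs @ Gs) * n \<and> set Gs = (\<lambda>v. insert v (Fs ! i)) ` ext X Z (Fs ! i) \<and>
    length Gs = card (ext X Z (Fs ! i))))"
proof -
  define A where "A = Fs ! i"
  \<comment> \<open>The rows appended so far: the extensions by vertices below \<open>j\<close>, in
    increasing order.\<close>
  define Gs where "Gs j = map (\<lambda>v. insert v A) (filter (\<lambda>v. v \<in> ext X Z A) [0..<j])" for j
  define I where "I j s' \<longleftrightarrow> rows n (narr s' ''Q'') (Fs @ Gs j) \<and>
    nvar s' ''q'' = length (Fs @ Gs j) * n" for j :: nat and s' :: state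
  have "wp (push b) s (\<lambda>t s'. t \<le> n * ((n * 16 + 70) + 8) + 6 \<and> I n s')"
    unfolding push_def
  proof (rule wp_mono, rule wp_For[where I = I and K = "n * 16 + 70"], goal_cases)
    case 1
    show ?case using Q by (simp add: I_def Gs_def)
  next
    case (5 j s')
    have jn: "j < n" using 5(1) n by simp
    have I: "rows n (narr s' ''Q'') (Fs @ Gs j)" "nvar s' ''q'' = length (Fs @ Gs j) * n"
      using 5(5) by (simp_all add: I_def)
    have e: "nvar s' ''h'' = i * n" "nvar s' ''n'' = n" "nvar s' ''v'' = j" "narr s' ''B'' = narr s ''B''"
      "narr s' ''U'' = narr s ''U''" "nvar s' ''x'' = nvar s ''x''"
      using 5 n i by (simp_all add: frame_def)
    have rowi: "0 < narr s' ''Q'' (i * n + v) \<longleftrightarrow> v \<in> A" if "v < n" for v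
      using I(1) that i(2) unfolding rows_def A_def by (simp add: nth_append)
    have bv: "bval b s' \<longleftrightarrow> j \<notin> Z \<and> (j \<in> X \<or> touch A j)" and bc: "bcost b \<le> 30"
      using b B jn by (simp_all add: test_state_def e A_def)
    have "bval (Conj (Neg (pos (row ''v''))) b) s' \<longleftrightarrow> j \<in> ext X Z A"
      using jn bv rowi[OF jn] by (auto simp: e ext_def)
    moreover have "wp (For ''w'' ''n'' (ArrAssign ''Q'' (Add (Var ''q'') (Var ''w'')) (row ''w'')) ;;
       ArrAssign ''Q'' (Add (Var ''q'') (Var ''v'')) (Const 1) ;;
       Assign ''q'' (Add (Var ''q'') (Var ''n''))) s'
       (\<lambda>t s''. t \<le> n * 16 + 20 \<and> I (Suc j) (nset ''v'' (Suc j) s''))" if ext: "j \<in> ext X Z A"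
      unfolding wp_Seq
    proof (rule wp_post, rule copy_row)
      show "nvar s' ''n'' = n" by (rule e)
      \<comment> \<open>The current row lies entirely before the end of the queue, as
        \<open>copy_row\<close> requires.\<close>
      have "(i + 1) * n \<le> length (Fs @ Gs j) * n" using i(2) by (intro mult_right_mono) auto
      then show "nvar s' ''h'' + n \<le> nvar s' ''q''" by (simp add: e I(2))
    next
      fix t s''
      assume *: "t \<le> n * (8 + 8) + 6 \<and> (\<forall>p<nvar s' ''q''. narr s'' ''Q'' p = narr s' ''Q'' p) \<and>
          (\<forall>v<n. narr s'' ''Q'' (nvar s' ''q'' + v) = narr s' ''Q'' (nvar s' ''h'' + v))"
        and fr: "frame (For ''w'' ''n'' (ArrAssign ''Q'' (Add (Var ''q'') (Var ''w'')) (row ''w''))) s' s''"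
      have e2: "nvar s'' ''q'' = nvar s' ''q''" "nvar s'' ''n'' = n" "nvar s'' ''v'' = j"
        using fr by (simp_all add: frame_def e)
      have Gs: "Gs (Suc j) = Gs j @ [insert j A]" using ext by (simp add: Gs_def)
      have "rows n ((narr s'' ''Q'')(nvar s' ''q'' + j := 1)) ((Fs @ Gs j) @ [insert j A])"
        by (rule rows_snoc[OF I(1)]) (use * I(2) rowi in \<open>auto simp: e\<close>)
      then show "wp (ArrAssign ''Q'' (Add (Var ''q'') (Var ''v'')) (Const 1)) s''
        (\<lambda>ta s'. wp (Assign ''q'' (Add (Var ''q'') (Var ''n''))) s'
          (\<lambda>u s''. t + (ta + u) \<le> n * 16 + 20 \<and> I (Suc j) (nset ''v'' (Suc j) s'')))"
        using * by (simp add: e2 I_def Gs I(2) algebra_simps)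
    qed
    moreover have "Gs (Suc j) = Gs j" if "j \<notin> ext X Z A" using that by (simp add: Gs_def)
    ultimately show ?case
      using I bc by (auto simp: I_def[of "Suc j"] simp del: wp_Seq elim!: wp_mono)
  qed (use n in auto)
  then show ?thesis
  proof (rule wp_mono, elim conjE, intro conjI exI[of _ "Gs n"])
    fix t s' assume t: "t \<le> n * (n * 16 + 70 + 8) + 6" and I: "I n s'"
    show "t \<le> 80 * (n + 1) ^ 2" using t by (simp add: power2_eq_square algebra_simps)
    show "rows n (narr s' ''Q'') (Fs @ Gs n)" "nvar s' ''q'' = length (Fs @ Gs n) * n"
      using I by (simp_all add: I_def)
    have sub: "ext X Z A \<subseteq> {..<n}" by (auto simp: ext_def)
    then have "set (filter (\<lambda>v. v \<in> ext X Z A) [0..<n]) = ext X Z A" by auto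
    then show "set (Gs n) = (\<lambda>v. insert v (Fs ! i)) ` ext X Z (Fs ! i)"
      "length (Gs n) = card (ext X Z (Fs ! i))"
      using distinct_card[of "filter (\<lambda>v. v \<in> ext X Z A) [0..<n]"]
      by (simp_all add: Gs_def A_def)
  qed
qed

end

section \<open>The queue loop\<close>

definition visit :: "bool \<Rightarrow> bexp \<Rightarrow> com" where
  "visit mx b = scan mx ;;
    If (NLess (Var ''c'') (Var ''s'')) (push b)
      (If (Conj (pos (Var ''f'')) (Neg (RLess (RVar ''b'') (RVar ''z'')))) Skip
        (RAssign ''b'' (RVar ''z'') ;; Assign ''f'' (Const 1) ;;
         For ''v'' ''n'' (ArrAssign ''S'' (Var ''v'') (row ''v'')))) ;;
    Assign ''h'' (Add (Var ''h'') (Var ''n''))"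

text \<open>The queue starts with one zero row, the empty set. \<open>f\<close>, \<open>b\<close>
  and \<open>S\<close> are deliberately not reset, so consecutive searches compete for a common best
  set.\<close>

definition search :: "bool \<Rightarrow> bexp \<Rightarrow> com" where
  "search mx b = For ''w'' ''n'' (ArrAssign ''Q'' (Var ''w'') (Const 0)) ;;
    Assign ''h'' (Const 0) ;; Assign ''q'' (Var ''n'') ;;
    While (NLess (Var ''h'') (Var ''q'')) (visit mx b)"

lemma mod_visit [simp]:
  "nmod (visit mx b) = {''c'', ''p'', ''u'', ''v'', ''w'', ''q'', ''f'', ''h''}"
  "amod (visit mx b) = {''B'', ''Q'', ''S''}" "rmod (visit mx b) = {''z'', ''b''}"
  by (auto simp: visit_def)

lemma mod_search [simp]:
  "nmod (search mx b) = {''c'', ''p'', ''u'', ''v'', ''w'', ''q'', ''f'', ''h''}"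
  "amod (search mx b) = {''B'', ''Q'', ''S''}" "rmod (search mx b) = {''z'', ''b''}"
  by (auto simp: search_def)

text \<open>Number of nodes of a \<open>d\<close>-ary tree; the queue entries that still have to be processed, each
  counted with the size of the tree below it, give the termination measure of the search.\<close>

fun tree_size :: "nat \<Rightarrow> nat \<Rightarrow> nat" where
  "tree_size d 0 = 1"
| "tree_size d (Suc j) = 1 + d * tree_size d j"

context fcgp
begin

text \<open>The parameter collects all sets offered since the last reset. If there are none,
  \<open>S\<close> is zero, so adding it to \<open>U\<close> has no effect.\<close>

definition best :: "nat set set \<Rightarrow> state \<Rightarrow> bool" where
  "best \<F> s \<longleftrightarrow> (if \<F> = {} then nvar s ''f'' = 0 \<and> (\<forall>v<n. narr s ''S'' v = 0)
    else 0 < nvar s ''f'' \<and> (\<exists>B\<in>\<F>. (\<forall>v<n. 0 < narr s ''S'' v \<longleftrightarrow> v \<in> B) \<and> rvar s ''b'' = val B \<and>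
      (\<forall>A\<in>\<F>. val A \<le> val B)))"

lemma best_cong:
  "best \<F> s \<Longrightarrow> nvar s' ''f'' = nvar s ''f'' \<Longrightarrow> narr s' ''S'' = narr s ''S'' \<Longrightarrow>
    rvar s' ''b'' = rvar s ''b'' \<Longrightarrow> best \<F> s'"
  by (simp add: best_def)

definition ready :: "bexp \<Rightarrow> nat set \<Rightarrow> nat set \<Rightarrow> nat \<Rightarrow> state \<Rightarrow> bool" where
  "ready b X Z k s \<longleftrightarrow> input_state s \<and> low_state s \<and> test_state b X Z s \<and> nvar s ''s'' = k"

lemma ready_cong:
  "ready b X Z k s \<Longrightarrow> nvar s' ''n'' = nvar s ''n'' \<Longrightarrow> nvar s' ''x'' = nvar s ''x'' \<Longrightarrow>
    nvar s' ''s'' = nvar s ''s'' \<Longrightarrow> rvar s' ''alpha'' = rvar s ''alpha'' \<Longrightarrow>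
    narr s' ''adj'' = narr s ''adj'' \<Longrightarrow> narr s' ''L'' = narr s ''L'' \<Longrightarrow>
    narr s' ''U'' = narr s ''U'' \<Longrightarrow> ready b X Z k s'"
  by (simp add: ready_def input_state_def low_state_def test_state_def)

lemma visit_correct:
  assumes r: "ready b X Z k s"
    and Q: "rows n (narr s ''Q'') Fs" "nvar s ''q'' = length Fs * n"
    and i: "nvar s ''h'' = i * n" "i < length Fs"
    and A: "Fs ! i \<subseteq> {..<n}" "card (Fs ! i) \<le> k" and \<sigma>: "\<sigma> = (if mx then 1 else -1)"
    and best: "best \<F> s"
  shows "wp (visit mx b) s (\<lambda>t s'. t \<le> 250 * (n + 1) ^ 2 \<and> ready b X Z k s' \<and>
    nvar s' ''h'' = Suc i * n \<and>
    (\<exists>Gs. rows n (narr s' ''Q'') (Fs @ Gs) \<and> nvar s' ''q'' = length (Fs @ Gs) * n \<and>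
      (if card (Fs ! i) = k then Gs = [] \<and> best (insert (Fs ! i) \<F>) s'
       else best \<F> s' \<and> set Gs = (\<lambda>v. insert v (Fs ! i)) ` ext X Z (Fs ! i) \<and>
         length Gs = card (ext X Z (Fs ! i)))))"
proof -
  let ?A = "Fs ! i"
  let ?rest = "If (NLess (Var ''c'') (Var ''s'')) (push b)
      (If (Conj (pos (Var ''f'')) (Neg (RLess (RVar ''b'') (RVar ''z'')))) Skip
        (RAssign ''b'' (RVar ''z'') ;; Assign ''f'' (Const 1) ;;
         For ''v'' ''n'' (ArrAssign ''S'' (Var ''v'') (row ''v''))))"
  define R where "R t s' \<longleftrightarrow> t \<le> 120 * (n + 1) ^ 2 \<and> ready b X Z k s' \<and> nvar s' ''h'' = i * n \<and>
    (\<exists>Gs. rows n (narr s' ''Q'') (Fs @ Gs) \<and> nvar s' ''q'' = length (Fs @ Gs) * n \<and>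
      (if card ?A = k then Gs = [] \<and> best (insert ?A \<F>) s'
       else best \<F> s' \<and> set Gs = (\<lambda>v. insert v ?A) ` ext X Z ?A \<and>
         length Gs = card (ext X Z ?A)))" for t :: nat and s'
  have rowi: "\<forall>v<n. 0 < narr s ''Q'' (nvar s ''h'' + v) \<longleftrightarrow> v \<in> ?A"
    using Q(1) i by (simp add: rows_def)
  have n2: "n \<le> (n + 1) ^ 2" "1 \<le> (n + 1) ^ 2" "14 \<le> 120 * (n + 1) ^ 2"
    by (simp_all add: power2_eq_square)
  have scan: "wp (scan mx) s (\<lambda>t s'. t \<le> 100 * (n + 1) ^ 2 \<and> nvar s' ''c'' = card ?A \<and>
    rvar s' ''z'' = val ?A \<and> (\<forall>v<n. 0 < narr s' ''B'' v \<longleftrightarrow> touch ?A v))"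
    using r rowi A(1) \<sigma> by (intro scan_correct) (simp_all add: ready_def)
  have rest: "wp ?rest s1 R"
    if 1: "nvar s1 ''c'' = card ?A" "rvar s1 ''z'' = val ?A"
      "\<forall>v<n. 0 < narr s1 ''B'' v \<longleftrightarrow> touch ?A v" and fr: "frame (scan mx) s s1" for s1
  proof -
    have r1: "ready b X Z k s1" by (rule ready_cong[OF r]) (use fr in \<open>simp_all add: frame_def\<close>)
    have best1: "best \<F> s1" by (rule best_cong[OF best]) (use fr in \<open>simp_all add: frame_def\<close>)
    have e: "nvar s1 ''h'' = i * n" "nvar s1 ''q'' = length Fs * n" "narr s1 ''Q'' = narr s ''Q''"
      using fr i Q by (simp_all add: frame_def)
    have e1: "nvar s1 ''s'' = k" "nvar s1 ''n'' = n" using r1 by (simp_all add: ready_def input_state_def)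
    show ?thesis
    proof (cases "card ?A = k")
      case False
      then have lt: "card ?A < k" using A(2) by simp
      have "wp (push b) s1 (\<lambda>t. R (1 + bcost (NLess (Var ''c'') (Var ''s'')) + t))"
      proof (rule wp_post, rule push_correct)
        show "nvar s1 ''n'' = n" "test_state b X Z s1" using r1 by (simp_all add: ready_def input_state_def)
        show "rows n (narr s1 ''Q'') Fs" "nvar s1 ''q'' = length Fs * n" "nvar s1 ''h'' = i * n"
          "i < length Fs" using e Q i by simp_all
        show "\<forall>v<n. (0 < narr s1 ''B'' v) = touch ?A v" by (rule 1(3))
        fix t s'
        assume *: "t \<le> 80 * (n + 1)\<^sup>2 \<and> (\<exists>Gs. rows n (narr s' ''Q'') (Fs @ Gs) \<and>
            nvar s' ''q'' = length (Fs @ Gs) * n \<and>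
            set Gs = (\<lambda>v. insert v ?A) ` ext X Z ?A \<and> length Gs = card (ext X Z ?A))"
          and fr2: "frame (push b) s1 s'"
        have "ready b X Z k s'" by (rule ready_cong[OF r1]) (use fr2 in \<open>simp_all add: frame_def\<close>)
        moreover have "best \<F> s'" by (rule best_cong[OF best1]) (use fr2 in \<open>simp_all add: frame_def\<close>)
        moreover have "nvar s' ''h'' = i * n" using fr2 e by (simp add: frame_def)
        ultimately show "R (1 + bcost (NLess (Var ''c'') (Var ''s'')) + t) s'"
        proof -
          have "1 + bcost (NLess (Var ''c'') (Var ''s'')) + t \<le> 120 * (n + 1) ^ 2"
            using conjunct1[OF *] n2(2) unfolding bcost.simps ncost.simps by linarith
          then show ?thesis unfolding R_def using * False \<open>ready b X Z k s'\<close> \<open>best \<F> s'\<close>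
              \<open>nvar s' ''h'' = i * n\<close> by (simp del: One_nat_def)
        qed
      qed
      then show ?thesis using lt by (simp add: 1 e1)
    next
      case True
      show ?thesis
      proof (cases "0 < nvar s1 ''f'' \<and> \<not> rvar s1 ''b'' < val ?A")
        case better: True
        then have "best (insert ?A \<F>) s1"
          using best1 unfolding best_def by (auto split: if_splits)
        then show ?thesis using better True n2
          by (auto simp: 1 e1 R_def r1 e Q(1))
      next
        case worse: False
        let ?s = "s1\<lparr>rvar := (rvar s1)(''b'' := val ?A), nvar := (nvar s1)(''f'' := Suc 0)\<rparr>"
        define I where "I j s' \<longleftrightarrow> (\<forall>v<j. narr s' ''S'' v = narr s ''Q'' (i * n + v))"
          for j :: nat and s' :: state
        have copy: "wp (For ''v'' ''n'' (ArrAssign ''S'' (Var ''v'') (row ''v''))) ?s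
          (\<lambda>t s'. t \<le> nvar ?s ''n'' * (6 + 8) + 6 \<and> I (nvar ?s ''n'') s' \<and> nvar s' ''v'' = nvar ?s ''n'')"
          by (rule wp_For) (auto simp: I_def less_Suc_eq frame_def e)
        \<comment> \<open>17 = 4 + 9 + 2 + 2: the two conditionals and the two assignments before
          the loop.\<close>
        have "wp (For ''v'' ''n'' (ArrAssign ''S'' (Var ''v'') (row ''v''))) ?s
          (\<lambda>t s'. R (17 + t) s')"
        proof (rule wp_post[OF copy])
          fix t s' assume *: "t \<le> nvar ?s ''n'' * (6 + 8) + 6 \<and> I (nvar ?s ''n'') s' \<and>
              nvar s' ''v'' = nvar ?s ''n''"
            and fr2: "frame (For ''v'' ''n'' (ArrAssign ''S'' (Var ''v'') (row ''v''))) ?s s'"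
          have "ready b X Z k s'" by (rule ready_cong[OF r1]) (use fr2 in \<open>simp_all add: frame_def\<close>)
          moreover have "best (insert ?A \<F>) s'"
          proof -
            have S: "\<forall>v<n. 0 < narr s' ''S'' v \<longleftrightarrow> v \<in> ?A"
              using * rowi by (simp add: I_def e1 i)
            have "0 < nvar s' ''f''" "rvar s' ''b'' = val ?A" using fr2 by (simp_all add: frame_def)
            moreover have "\<forall>B\<in>insert ?A \<F>. val B \<le> val ?A"
              using best1 worse unfolding best_def by (auto split: if_splits)
            ultimately show ?thesis using S unfolding best_def by auto
          qed
          moreover have "nvar s' ''h'' = i * n" "nvar s' ''q'' = length Fs * n" "narr s' ''Q'' = narr s ''Q''"
            using fr2 e by (simp_all add: frame_def)
          moreover have "nvar ?s ''n'' = n" using e1 by simp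
          then have "t \<le> n * 14 + 6" using * by simp
          then have "17 + t \<le> 120 * (n + 1) ^ 2" using n2(1,2) by linarith
          ultimately show "R (17 + t) s'" unfolding R_def using True Q(1) by (simp add: e1)
        qed
        then show ?thesis using worse True by (auto simp: 1 e1 numeral_eq_Suc)
      qed
    qed
  qed
  have "wp (scan mx) s (\<lambda>t s'. t \<le> 100 * (n + 1) ^ 2 \<and> wp ?rest s' R)"
    by (rule wp_post[OF scan]) (use rest in blast)
  then show ?thesis unfolding visit_def wp_Seq
  proof (rule wp_mono, elim conjE)
    fix t s1 assume t: "t \<le> 100 * (n + 1) ^ 2" and "wp ?rest s1 R"
    from this(2) show "wp ?rest s1 (\<lambda>ta s'. wp (Assign ''h'' (Add (Var ''h'') (Var ''n''))) s'
      (\<lambda>u s'. t + (ta + u) \<le> 250 * (n + 1)\<^sup>2 \<and> ready b X Z k s' \<and>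
    nvar s' ''h'' = Suc i * n \<and>
    (\<exists>Gs. rows n (narr s' ''Q'') (Fs @ Gs) \<and> nvar s' ''q'' = length (Fs @ Gs) * n \<and>
      (if card (Fs ! i) = k then Gs = [] \<and> best (insert (Fs ! i) \<F>) s'
       else best \<F> s' \<and> set Gs = (\<lambda>v. insert v (Fs ! i)) ` ext X Z (Fs ! i) \<and>
         length Gs = card (ext X Z (Fs ! i))))))"
    proof (rule wp_mono)
      fix t2 s2 assume R: "R t2 s2"
      let ?s3 = "nset ''h'' (nvar s2 ''h'' + nvar s2 ''n'') s2"
      have "ready b X Z k ?s3" by (rule ready_cong[of _ _ _ _ s2]) (use R in \<open>simp_all add: R_def\<close>)
      moreover have "best \<G> ?s3 \<longleftrightarrow> best \<G> s2" for \<G> by (simp add: best_def)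
      moreover have "nvar s2 ''n'' = n" using R by (simp add: R_def ready_def input_state_def)
      moreover have time: "t + (t2 + 4) \<le> 250 * (n + 1) ^ 2"
        using R t n2(2) unfolding R_def by linarith
      ultimately show "wp (Assign ''h'' (Add (Var ''h'') (Var ''n''))) s2
      (\<lambda>u s'. t + (t2 + u) \<le> 250 * (n + 1)\<^sup>2 \<and> ready b X Z k s' \<and>
    nvar s' ''h'' = Suc i * n \<and>
    (\<exists>Gs. rows n (narr s' ''Q'') (Fs @ Gs) \<and> nvar s' ''q'' = length (Fs @ Gs) * n \<and>
      (if card (Fs ! i) = k then Gs = [] \<and> best (insert (Fs ! i) \<F>) s'
       else best \<F> s' \<and> set Gs = (\<lambda>v. insert v (Fs ! i)) ` ext X Z (Fs ! i) \<and>
         length Gs = card (ext X Z (Fs ! i)))))"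
        using R time by (cases "card ?A = k") (simp_all add: R_def)
    qed
  qed
qed

lemma search_correct:
  assumes r: "ready b X Z k s" and \<sigma>: "\<sigma> = (if mx then 1 else -1)"
    and best: "best \<F> s" and n: "0 < n"
    and d: "\<And>A. A \<in> grow X Z \<Longrightarrow> card A < k \<Longrightarrow> card (ext X Z A) \<le> d"
  shows "wp (search mx b) s (\<lambda>t s'. t \<le> 300 * (n + 1) ^ 2 * (tree_size d k + 1) \<and>
    best (\<F> \<union> {A \<in> grow X Z. card A = k}) s')"
proof -
  let ?W = "\<lambda>Fs. sum_list (map (\<lambda>F. tree_size d (k - card F)) Fs)"
  \<comment> \<open>The first \<open>i\<close> rows are processed: those below size \<open>k\<close>
    have all their extensions in the queue, those of size \<open>k\<close> have been offered to
    \<open>best\<close>. The measure sums the potential search trees of the remaining rows.\<close>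
  define J where "J m s' \<longleftrightarrow> ready b X Z k s' \<and> (\<exists>Fs i. i \<le> length Fs \<and> rows n (narr s' ''Q'') Fs \<and>
    nvar s' ''q'' = length Fs * n \<and> nvar s' ''h'' = i * n \<and> {} \<in> set Fs \<and>
    (\<forall>F\<in>set Fs. F \<in> grow X Z \<and> card F \<le> k) \<and>
    (\<forall>F\<in>set (take i Fs). card F < k \<longrightarrow> (\<forall>v\<in>ext X Z F. insert v F \<in> set Fs)) \<and>
    best (\<F> \<union> {F \<in> set (take i Fs). card F = k}) s' \<and> m = ?W (drop i Fs))" for m s'
  let ?guard = "NLess (Var ''h'') (Var ''q'')"
  have step: "wp (visit mx b) s1 (\<lambda>t s'. t \<le> 250 * (n + 1) ^ 2 \<and> (\<exists>m'<m. J m' s'))"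
    if J: "J m s1" and g: "bval ?guard s1" for m s1
  proof -
    obtain Fs i where r1: "ready b X Z k s1" and i: "i \<le> length Fs" and Q: "rows n (narr s1 ''Q'') Fs"
      "nvar s1 ''q'' = length Fs * n" and h: "nvar s1 ''h'' = i * n" and em: "{} \<in> set Fs"
      and gr: "\<forall>F\<in>set Fs. F \<in> grow X Z \<and> card F \<le> k"
      and cl: "\<forall>F\<in>set (take i Fs). card F < k \<longrightarrow> (\<forall>v\<in>ext X Z F. insert v F \<in> set Fs)"
      and be: "best (\<F> \<union> {F \<in> set (take i Fs). card F = k}) s1" and m: "m = ?W (drop i Fs)"
      using J unfolding J_def by blast
    \<comment> \<open>Offsets are multiples of \<open>n\<close>, so comparing them compares row
      indices only because \<open>0 < n\<close>.\<close>
    have iL: "i < length Fs" using g Q(2) h n by simp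
    let ?A = "Fs ! i"
    have A: "?A \<in> grow X Z" "card ?A \<le> k" using gr iL by auto
    have drop: "drop i Fs = ?A # drop (Suc i) Fs" using iL by (simp add: Cons_nth_drop_Suc)
    have take: "set (take (Suc i) Fs) = insert ?A (set (take i Fs))"
      using iL by (simp add: take_Suc_conv_app_nth)
    show ?thesis
    proof (rule wp_mono[OF visit_correct[OF r1 Q h iL _ A(2) \<sigma> be]], goal_cases)
      case 1
      show ?case using growD[OF A(1)] by blast
    next
      case (2 t s')
      then obtain Gs where t: "t \<le> 250 * (n + 1) ^ 2" and r': "ready b X Z k s'"
        and h': "nvar s' ''h'' = Suc i * n" and Q': "rows n (narr s' ''Q'') (Fs @ Gs)"
          "nvar s' ''q'' = length (Fs @ Gs) * n"
        and G: "if card ?A = k then Gs = [] \<and> best (insert ?A (\<F> \<union> {F \<in> set (take i Fs). card F = k})) s'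
         else best (\<F> \<union> {F \<in> set (take i Fs). card F = k}) s' \<and> set Gs = (\<lambda>v. insert v ?A) ` ext X Z ?A \<and>
         length Gs = card (ext X Z ?A)" by blast
      have take': "take (Suc i) (Fs @ Gs) = take (Suc i) Fs" using iL by simp
      have best': "best (\<F> \<union> {F \<in> set (take (Suc i) (Fs @ Gs)). card F = k}) s'"
      proof (cases "card ?A = k")
        case True
        have "insert ?A (\<F> \<union> {F \<in> set (take i Fs). card F = k}) =
            \<F> \<union> {F \<in> set (take (Suc i) Fs). card F = k}" using True take by auto
        then show ?thesis using G True unfolding take' by simp
      next
        case False
        have "\<F> \<union> {F \<in> set (take i Fs). card F = k} =
            \<F> \<union> {F \<in> set (take (Suc i) Fs). card F = k}" using False take by auto
        then show ?thesis using G False unfolding take' by simp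
      qed
      have fA: "finite ?A" using growD[OF A(1)] by blast
      have cG: "card F = Suc (card ?A)" if "F \<in> set Gs" for F
        using G that fA by (auto simp: ext_def split: if_splits)
      have gr': "\<forall>F\<in>set (Fs @ Gs). F \<in> grow X Z \<and> card F \<le> k"
      proof
        fix F assume F: "F \<in> set (Fs @ Gs)"
        show "F \<in> grow X Z \<and> card F \<le> k"
        proof (cases "F \<in> set Fs")
          case False
          then have FG: "F \<in> set Gs" using F by simp
          then have "card ?A \<noteq> k" using G by auto
          then have "F \<in> (\<lambda>v. insert v ?A) ` ext X Z ?A" "card ?A < k" using G FG A(2) by auto
          then show ?thesis using cG[OF FG] A(1) by (auto intro: grow.insert)
        qed (use gr in blast)
      qed
      have cl': "\<forall>F\<in>set (take (Suc i) (Fs @ Gs)). card F < k \<longrightarrow>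
          (\<forall>v\<in>ext X Z F. insert v F \<in> set (Fs @ Gs))"
        using cl G unfolding take' take by (auto split: if_splits)
      \<comment> \<open>The processed row gives up a tree of height \<open>k - card ?A\<close>; its
        at most \<open>d\<close> children bring trees of height one less, so at least the root is
        lost.\<close>
      have "?W (drop (Suc i) (Fs @ Gs)) < m"
      proof (cases "card ?A = k")
        case True
        then show ?thesis using G m drop iL by simp
      next
        case False
        then have lt: "card ?A < k" using A(2) by simp
        then have "Suc (k - Suc (card ?A)) = k - card ?A" by simp
        then have ts: "tree_size d (k - card ?A) = 1 + d * tree_size d (k - Suc (card ?A))"
          by (metis tree_size.simps(2))
        have "map (\<lambda>F. tree_size d (k - card F)) Gs = map (\<lambda>F. tree_size d (k - Suc (card ?A))) Gs"
          using cG by simp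
        then have "?W Gs = length Gs * tree_size d (k - Suc (card ?A))"
          by (simp only: map_replicate_const sum_list_replicate) simp
        also have "\<dots> \<le> d * tree_size d (k - Suc (card ?A))"
          using G False d[OF A(1) lt] by (intro mult_right_mono) auto
        finally have "?W Gs < tree_size d (k - card ?A)" using ts by simp
        then show ?thesis using m drop iL by simp
      qed
      moreover have "J (?W (drop (Suc i) (Fs @ Gs))) s'"
        unfolding J_def using r' iL Q' h' em gr' cl' best'
        by (intro conjI exI[of _ "Fs @ Gs"] exI[of _ "Suc i"]) auto
      ultimately show ?case using t by blast
    qed
  qed
  have final: "best (\<F> \<union> {A \<in> grow X Z. card A = k}) s'" if J: "J m s'" and g: "\<not> bval ?guard s'" for m s'
  proof -
    obtain Fs i where i: "i \<le> length Fs" and "nvar s' ''q'' = length Fs * n" "nvar s' ''h'' = i * n"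
      and em: "{} \<in> set Fs"
      and gr: "\<forall>F\<in>set Fs. F \<in> grow X Z \<and> card F \<le> k"
      and cl: "\<forall>F\<in>set (take i Fs). card F < k \<longrightarrow> (\<forall>v\<in>ext X Z F. insert v F \<in> set Fs)"
      and be: "best (\<F> \<union> {F \<in> set (take i Fs). card F = k}) s'"
      using J unfolding J_def by blast
    then have "length Fs \<le> i" using g n by auto
    then have iL: "take i Fs = Fs" by simp
    \<comment> \<open>On exit the whole queue is processed, so it contains the empty set and is
      closed under extensions below size \<open>k\<close>: induction along \<open>grow\<close>
      applies.\<close>
    have "A \<in> grow X Z \<Longrightarrow> card A \<le> k \<Longrightarrow> A \<in> set Fs" for A
    proof (induction rule: grow.induct)
      case (insert A v)
      have "finite A" "v \<notin> A" using growD[OF insert.hyps(1)] insert.hyps(2) by (auto simp: ext_def)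
      then have "card A < k" using insert.prems by simp
      then show ?case using cl insert iL by auto
    qed (use em in auto)
    then have "{F \<in> set Fs. card F = k} = {A \<in> grow X Z. card A = k}" using gr by auto
    then show ?thesis using be iL by simp
  qed
  have start: "J (tree_size d k) s1"
    if "ready b X Z k s1" "best \<F> s1" "nvar s1 ''q'' = n" "nvar s1 ''h'' = 0" "\<forall>v<n. narr s1 ''Q'' v = 0" for s1
    unfolding J_def using that
    by (intro conjI exI[of _ "[{}]"] exI[of _ 0]) (simp_all add: rows_def grow.empty)
  have nv: "nvar s ''n'' = n" using r by (simp add: ready_def input_state_def)
  define I where "I j s' \<longleftrightarrow> (\<forall>v<j. narr s' ''Q'' v = 0)" for j :: nat and s' :: state
  have clear: "wp (For ''w'' ''n'' (ArrAssign ''Q'' (Var ''w'') (Const 0))) s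
      (\<lambda>t s'. t \<le> nvar s ''n'' * (3 + 8) + 6 \<and> I (nvar s ''n'') s' \<and> nvar s' ''w'' = nvar s ''n'')"
    by (rule wp_For) (auto simp: I_def less_Suc_eq)
  show ?thesis unfolding search_def wp_Seq wp_Assign
  proof (rule wp_post[OF clear])
    fix t s1
    assume t: "t \<le> nvar s ''n'' * (3 + 8) + 6 \<and> I (nvar s ''n'') s1 \<and> nvar s1 ''w'' = nvar s ''n''"
      and fr: "frame (For ''w'' ''n'' (ArrAssign ''Q'' (Var ''w'') (Const 0))) s s1"
    let ?s2 = "nset ''h'' (nval (Const 0) s1) s1"
    let ?s3 = "nset ''q'' (nval (Var ''n'') ?s2) ?s2"
    have "ready b X Z k ?s3" by (rule ready_cong[OF r]) (use fr in \<open>simp_all add: frame_def\<close>)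
    moreover have "best \<F> ?s3" by (rule best_cong[OF best]) (use fr in \<open>simp_all add: frame_def\<close>)
    moreover have "nvar s1 ''n'' = n" using fr nv by (simp add: frame_def)
    ultimately have "J (tree_size d k) ?s3" using t by (intro start) (simp_all add: I_def nv)
    then have "wp (While ?guard (visit mx b)) ?s3 (\<lambda>t s'.
        t \<le> tree_size d k * (250 * (n + 1) ^ 2 + 1 + bcost ?guard) + 1 + bcost ?guard \<and>
        (\<exists>m'. J m' s') \<and> \<not> bval ?guard s')"
      by (rule wp_While) (rule step)
    then show "wp (While ?guard (visit mx b)) ?s3 (\<lambda>u s'.
        t + (1 + ncost (Const 0) + (1 + ncost (Var ''n'') + u))
          \<le> 300 * (n + 1) ^ 2 * (tree_size d k + 1) \<and> best (\<F> \<union> {A \<in> grow X Z. card A = k}) s')"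
    proof (rule wp_mono, elim conjE exE, intro conjI)
      fix u s' m' assume u: "u \<le> tree_size d k * (250 * (n + 1) ^ 2 + 1 + bcost ?guard) + 1 + bcost ?guard"
      let ?P = "(n + 1) ^ 2 * tree_size d k"
      have "1 \<le> (n + 1) ^ 2" "n \<le> (n + 1) ^ 2" by (simp_all add: power2_eq_square)
      moreover have "1 * tree_size d k \<le> ?P"
        by (rule mult_right_mono) (use \<open>1 \<le> (n + 1) ^ 2\<close> in simp_all)
      moreover have "u \<le> 250 * ?P + 4 * tree_size d k + 4" using u by (simp add: mult_ac distrib_left)
      moreover have "300 * (n + 1) ^ 2 * (tree_size d k + 1) = 300 * ?P + 300 * (n + 1) ^ 2"
        by (simp add: mult_ac distrib_left)
      moreover have "t \<le> n * 11 + 6" using t nv by simp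
      ultimately show "t + (1 + ncost (Const 0) + (1 + ncost (Var ''n'') + u))
          \<le> 300 * (n + 1) ^ 2 * (tree_size d k + 1)"
        unfolding ncost.simps by linarith
    qed (rule final)
  qed
qed

end

section \<open>Greedy picks\<close>

text \<open>With no disjunction or equality in the language, this is De Morgan for \<open>v\<close>
  outside \<open>U\<close> and either touched or equal to \<open>x\<close>, equality being two
  failed strict comparisons.\<close>

definition new_test :: bexp where
  "new_test = Conj (Neg (pos (Arr ''U'' (Var ''v''))))
    (Neg (Conj (Neg (pos (Arr ''B'' (Var ''v''))))
      (Neg (Conj (Neg (NLess (Var ''v'') (Var ''x''))) (Neg (NLess (Var ''x'') (Var ''v'')))))))"

definition final_test :: bexp where
  "final_test = Neg (Conj (Neg (pos (Arr ''B'' (Var ''v'')))) (Neg (pos (Arr ''U'' (Var ''v'')))))"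

definition reset :: com where
  "reset = Assign ''f'' (Const 0) ;; For ''v'' ''n'' (ArrAssign ''S'' (Var ''v'') (Const 0))"

text \<open>Only positivity of array entries matters, so addition acts as union of characteristic
  vectors.\<close>

definition greedy_round :: "bool \<Rightarrow> com" where
  "greedy_round mx = reset ;; For ''x'' ''n'' (search mx new_test) ;;
    For ''v'' ''n'' (ArrAssign ''U'' (Var ''v'') (Add (Arr ''U'' (Var ''v'')) (Arr ''S'' (Var ''v''))))"

definition greedy :: "bool \<Rightarrow> com" where
  "greedy mx = For ''j'' ''k'' (Assign ''s'' (Add (Var ''j'') (Const 1)) ;; For ''i'' ''N'' (greedy_round mx))"

definition last_search :: "bool \<Rightarrow> com" where
  "last_search mx = reset ;; Assign ''s'' (Var ''k'') ;; search mx final_test"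

lemma mod_reset [simp]:
  "nmod reset = {''f'', ''v''}" "amod reset = {''S''}" "rmod reset = {}"
  by (auto simp: reset_def)

lemma mod_greedy_round [simp]:
  "nmod (greedy_round mx) = {''c'', ''p'', ''u'', ''v'', ''w'', ''q'', ''f'', ''h'', ''x''}"
  "amod (greedy_round mx) = {''B'', ''Q'', ''S'', ''U''}" "rmod (greedy_round mx) = {''z'', ''b''}"
  by (auto simp: greedy_round_def)

lemma mod_greedy [simp]:
  "nmod (greedy mx) = {''c'', ''p'', ''u'', ''v'', ''w'', ''q'', ''f'', ''h'', ''x'', ''i'', ''j'', ''s''}"
  "amod (greedy mx) = {''B'', ''Q'', ''S'', ''U''}" "rmod (greedy mx) = {''z'', ''b''}"
  by (auto simp: greedy_def)

text \<open>The slack in the base \<open>d + 2\<close> absorbs the root counted at each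
  level.\<close>

lemma tree_size_le: "j \<le> k \<Longrightarrow> tree_size d j \<le> (d + 2) ^ k"
proof -
  have "tree_size d j \<le> (d + 2) ^ j"
  proof (induction j)
    case (Suc j)
    have "d * tree_size d j \<le> d * (d + 2) ^ j" using Suc by (rule mult_left_mono) simp
    moreover have "1 \<le> (d + 2) ^ j" by simp
    ultimately show ?case unfolding tree_size.simps power_Suc distrib_right by linarith
  qed simp
  also assume "j \<le> k"
  then have "(d + 2) ^ j \<le> (d + 2) ^ k" by (intro power_increasing) auto
  finally show ?thesis .
qed

context fcgp
begin

definition selected :: "state \<Rightarrow> nat set" where
  "selected s = {v. v < n \<and> 0 < narr s ''U'' v}"

lemma test_state_new: "test_state new_test {nvar s ''x''} (selected s) s"
  by (auto simp: test_state_def new_test_def selected_def)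

lemma test_state_final: "test_state final_test (selected s) {} s"
  by (auto simp: test_state_def final_test_def selected_def)

lemma reset_correct:
  assumes "nvar s ''n'' = n"
  shows "wp reset s (\<lambda>t s'. t \<le> n * 11 + 8 \<and> best {} s')"
proof -
  define I where "I j s' \<longleftrightarrow> (\<forall>v<j. narr s' ''S'' v = 0)" for j :: nat and s' :: state
  let ?s = "nset ''f'' 0 s"
  have "wp (For ''v'' ''n'' (ArrAssign ''S'' (Var ''v'') (Const 0))) ?s
    (\<lambda>t s'. t \<le> nvar ?s ''n'' * (3 + 8) + 6 \<and> I (nvar ?s ''n'') s' \<and> nvar s' ''v'' = nvar ?s ''n'')"
    by (rule wp_For) (auto simp: I_def less_Suc_eq)
  then have "wp (For ''v'' ''n'' (ArrAssign ''S'' (Var ''v'') (Const 0))) ?s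
      (\<lambda>t s'. 2 + t \<le> n * 11 + 8 \<and> best {} s')"
    by (rule wp_post) (auto simp: assms I_def best_def frame_def)
  then show ?thesis by (simp add: reset_def)
qed

text \<open>The searches from all starts share one best set, which therefore beats every candidate
  of size \<open>r\<close>. The parameter \<open>M\<close> permits one time bound for all
  sizes.\<close>

lemma greedy_round_correct:
  assumes s: "input_state s" "low_state s" "nvar s ''s'' = r" "0 < r"
    and rich: "rich (selected s) r i" and \<sigma>: "\<sigma> = (if mx then 1 else -1)" and n: "0 < n"
    and d: "1 + r * T \<le> d" "tree_size d r \<le> M"
  shows "wp (greedy_round mx) s (\<lambda>t s'. t \<le> 400 * (n + 1) ^ 3 * (M + 1) \<and>
    rich (selected s') r (Suc i) \<and> card (selected s') \<le> card (selected s) + r \<and> selected s \<subseteq> selected s')"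
proof -
  let ?U = "selected s"
  have nv: "nvar s ''n'' = n" using s by (simp add: input_state_def)
  define \<F> where "\<F> j = (\<Union>x<j. {A \<in> grow {x} ?U. card A = r})" for j
  define K where "K = 300 * (n + 1) ^ 2 * (tree_size d r + 1)"
  have K: "K \<le> 300 * (n + 1) ^ 2 * (M + 1)"
    unfolding K_def using d(2) by (intro mult_left_mono) auto
  define I where "I j s' \<longleftrightarrow> best (\<F> j) s'" for j s'
  have U: "selected s' = ?U" if "narr s' ''U'' = narr s ''U''" for s' using that by (simp add: selected_def)
  have loop: "wp (For ''x'' ''n'' (search mx new_test)) s1 (\<lambda>t s'. t \<le> n * (K + 8) + 6 \<and> I n s')"
    if s1: "best {} s1" "frame reset s s1" for s1
  proof (rule wp_mono, rule wp_For[where I = I and K = K], goal_cases)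
    case 1
    have "best (\<F> 0) s1" using s1(1) by (simp add: \<F>_def)
    then show ?case unfolding I_def by (rule best_cong) simp_all
  next
    case (5 j s')
    have fr: "narr s' ''U'' = narr s ''U''" "narr s' ''L'' = narr s ''L''" "narr s' ''adj'' = narr s ''adj''"
      "rvar s' ''alpha'' = rvar s ''alpha''" "nvar s' ''n'' = n" "nvar s' ''s'' = r"
      using 5(4) s1(2) s nv by (simp_all add: frame_def)
    have "ready new_test {j} ?U r s'"
      using s fr test_state_new[of s'] 5(2) U[OF fr(1)]
      by (simp add: ready_def input_state_def low_state_def)
    moreover have "card (ext {j} ?U A) \<le> d" if "A \<in> grow {j} ?U" "card A < r" for A
    proof -
      have "card (ext {j} ?U A) \<le> 1 + card A * T"
        using card_ext[of A "{j}" ?U] growD[OF that(1)] by simp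
      moreover have "card A * T \<le> r * T" using that(2) by (intro mult_right_mono) auto
      ultimately show ?thesis using d(1) by linarith
    qed
    ultimately have "wp (search mx new_test) s' (\<lambda>t s'. t \<le> 300 * (n + 1) ^ 2 * (tree_size d r + 1) \<and>
        best (\<F> j \<union> {A \<in> grow {j} ?U. card A = r}) s')"
      using \<sigma> 5(5) n by (intro search_correct) (auto simp: I_def)
    then show ?case
    proof (rule wp_mono, elim conjE, intro conjI)
      fix t s2 assume b: "best (\<F> j \<union> {A \<in> grow {j} ?U. card A = r}) s2"
      have "\<F> (Suc j) = \<F> j \<union> {A \<in> grow {j} ?U. card A = r}"
        by (auto simp: \<F>_def less_Suc_eq)
      then show "I (Suc j) (nset ''x'' (Suc j) s2)"
        unfolding I_def using best_cong[OF b] by simp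
    qed (simp add: K_def)
  qed (use s1(2) nv in \<open>auto simp: frame_def I_def\<close>)
  have upd: "wp (For ''v'' ''n'' (ArrAssign ''U'' (Var ''v'') (Add (Arr ''U'' (Var ''v'')) (Arr ''S'' (Var ''v''))))) s2
      (\<lambda>t s'. t \<le> n * 16 + 6 \<and> rich (selected s') r (Suc i) \<and> card (selected s') \<le> card ?U + r \<and> ?U \<subseteq> selected s')"
    if b: "best (\<F> n) s2" and fr: "narr s2 ''U'' = narr s ''U''" "nvar s2 ''n'' = n" for s2
  proof -
    define J where "J j s' \<longleftrightarrow> (\<forall>v. narr s' ''U'' v =
      (if v < j then narr s ''U'' v + narr s2 ''S'' v else narr s ''U'' v))" for j :: nat and s' :: state
    have w: "wp (For ''v'' ''n'' (ArrAssign ''U'' (Var ''v'') (Add (Arr ''U'' (Var ''v'')) (Arr ''S'' (Var ''v''))))) s2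
      (\<lambda>t s'. t \<le> nvar s2 ''n'' * (8 + 8) + 6 \<and> J (nvar s2 ''n'') s' \<and> nvar s' ''v'' = nvar s2 ''n'')"
      by (rule wp_For) (use fr in \<open>auto simp: J_def less_Suc_eq frame_def\<close>)
    have fin: "finite ?U" by (simp add: selected_def)
    show ?thesis
    proof (rule wp_mono[OF w])
      fix t s' assume *: "t \<le> nvar s2 ''n'' * (8 + 8) + 6 \<and> J (nvar s2 ''n'') s' \<and> nvar s' ''v'' = nvar s2 ''n''"
      have sel: "selected s' = ?U \<union> {v. v < n \<and> 0 < narr s2 ''S'' v}"
        using * fr by (auto simp: J_def selected_def)
      \<comment> \<open>A seed outside the graph grows only the empty set, so the starts below
        \<open>n\<close> cover every \<open>x\<close> that \<open>rich\<close> quantifies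
        over.\<close>
      have all: "A \<in> \<F> n" if "A \<in> grow {x} ?U" "card A = r" for x A
      proof -
        have "A \<noteq> {}" using that(2) s(4) by auto
        have "x < n"
        proof (rule ccontr)
          assume "\<not> x < n"
          have "A = {}" using that(1)
            by (induction rule: grow.induct) (use \<open>\<not> x < n\<close> in \<open>auto simp: ext_def touch_def\<close>)
          then show False using \<open>A \<noteq> {}\<close> by simp
        qed
        then show ?thesis using that by (auto simp: \<F>_def)
      qed
      have "rich (selected s') r (Suc i) \<and> card (selected s') \<le> card ?U + r \<and> ?U \<subseteq> selected s'"
      proof (cases "\<F> n = {}")
        case True
        then have "selected s' = ?U" using b sel by (auto simp: best_def)
        \<comment> \<open>Once the candidates are exhausted, richness holds for every count, so an
          idle round still counts.\<close>
        moreover have "rich ?U r (Suc i)" by (rule rich_none) (use all True in auto)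
        ultimately show ?thesis by simp
      next
        case False
        then obtain B where B: "B \<in> \<F> n" "\<forall>v<n. 0 < narr s2 ''S'' v \<longleftrightarrow> v \<in> B" "\<forall>A\<in>\<F> n. val A \<le> val B"
          using b unfolding best_def by auto
        then obtain x where x: "B \<in> grow {x} ?U" "card B = r" by (auto simp: \<F>_def)
        have Bn: "B \<subseteq> {..<n}" "B \<inter> ?U = {}" using growD[OF x(1)] by auto
        then have "selected s' = ?U \<union> B" using sel B(2) by auto
        moreover have "rich (?U \<union> B) r (Suc i)"
          by (rule rich_Suc_best[OF rich s(4) x(2) Bn(2)]) (use B(3) all in blast)
        moreover have "card (?U \<union> B) \<le> card ?U + r" using card_Un_le[of ?U B] x(2) by simp
        ultimately show ?thesis by simp
      qed
      then show "t \<le> n * 16 + 6 \<and> rich (selected s') r (Suc i) \<and> card (selected s') \<le> card ?U + r \<and> ?U \<subseteq> selected s'"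
        using * fr by simp
    qed
  qed
  show ?thesis unfolding greedy_round_def wp_Seq
  proof (rule wp_post[OF reset_correct[OF nv]])
    fix t1 s1 assume 1: "t1 \<le> n * 11 + 8 \<and> best {} s1" and fr1: "frame reset s s1"
    show "wp (For ''x'' ''n'' (search mx new_test)) s1 (\<lambda>t s'. wp
        (For ''v'' ''n'' (ArrAssign ''U'' (Var ''v'') (Add (Arr ''U'' (Var ''v'')) (Arr ''S'' (Var ''v''))))) s'
          (\<lambda>u s'. t1 + (t + u) \<le> 400 * (n + 1) ^ 3 * (M + 1) \<and>
            rich (selected s') r (Suc i) \<and> card (selected s') \<le> card ?U + r \<and> ?U \<subseteq> selected s'))"
    proof (rule wp_post[OF loop])
      fix t2 s2 assume 2: "t2 \<le> n * (K + 8) + 6 \<and> I n s2" and fr2: "frame (For ''x'' ''n'' (search mx new_test)) s1 s2"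
      have "narr s2 ''U'' = narr s ''U''" "nvar s2 ''n'' = n" using fr1 fr2 nv by (simp_all add: frame_def)
      then show "wp (For ''v'' ''n'' (ArrAssign ''U'' (Var ''v'') (Add (Arr ''U'' (Var ''v'')) (Arr ''S'' (Var ''v''))))) s2
          (\<lambda>u s'. t1 + (t2 + u) \<le> 400 * (n + 1) ^ 3 * (M + 1) \<and>
            rich (selected s') r (Suc i) \<and> card (selected s') \<le> card ?U + r \<and> ?U \<subseteq> selected s')"
      proof (intro wp_mono[OF upd])
        show "best (\<F> n) s2" using 2 by (simp add: I_def)
        fix t3 s3 assume 3: "t3 \<le> n * 16 + 6 \<and> rich (selected s3) r (Suc i) \<and> card (selected s3) \<le> card ?U + r \<and> ?U \<subseteq> selected s3"
        have "n * K \<le> n * (300 * (n + 1) ^ 2 * (M + 1))" using K by (rule mult_left_mono) simp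
        also have "\<dots> \<le> 300 * (n + 1) ^ 3 * (M + 1)"
          by (simp add: power2_eq_square power3_eq_cube algebra_simps)
        finally have "n * K \<le> 300 * (n + 1) ^ 3 * (M + 1)" .
        moreover have "n * 35 + 20 \<le> 100 * (n + 1) ^ 3 * (M + 1)"
        proof -
          have "n * 35 + 20 \<le> 100 * (n + 1) ^ 3" by (simp add: power3_eq_cube algebra_simps)
          also have "\<dots> \<le> 100 * (n + 1) ^ 3 * (M + 1)" by simp
          finally show ?thesis .
        qed
        ultimately show "t1 + (t2 + t3) \<le> 400 * (n + 1) ^ 3 * (M + 1) \<and>
            rich (selected s3) r (Suc i) \<and> card (selected s3) \<le> card ?U + r \<and> ?U \<subseteq> selected s3"
          using 1 2 3 by (simp add: algebra_simps)
      qed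
    qed (use 1 fr1 in simp_all)
  qed
qed

text \<open>Later rounds only enlarge \<open>U\<close>, so \<open>rich_mono\<close> preserves what
  was achieved for smaller sizes. Each of the \<open>k * N\<close> rounds adds at most
  \<open>k\<close> vertices.\<close>

lemma greedy_correct:
  assumes s: "input_state s" "low_state s" "nvar s ''k'' = k" "nvar s ''N'' = N"
    and U: "selected s = {}" and \<sigma>: "\<sigma> = (if mx then 1 else -1)" and n: "0 < n"
    and d: "1 + k * T \<le> d"
  shows "wp (greedy mx) s (\<lambda>t s'. t \<le> k * (N * (400 * (n + 1) ^ 3 * ((d + 2) ^ k + 1) + 8) + 20) + 6 \<and>
    (\<forall>r. 1 \<le> r \<longrightarrow> r \<le> k \<longrightarrow> rich (selected s') r N) \<and> card (selected s') \<le> k * N * k)"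
proof -
  define K where "K = 400 * (n + 1) ^ 3 * ((d + 2) ^ k + 1)"
  define I where "I j s' \<longleftrightarrow> (\<forall>r. 1 \<le> r \<longrightarrow> r \<le> j \<longrightarrow> rich (selected s') r N) \<and>
    card (selected s') \<le> j * (N * k)" for j s'
  define J where "J j i s' \<longleftrightarrow> (\<forall>r. 1 \<le> r \<longrightarrow> r \<le> j \<longrightarrow> rich (selected s') r N) \<and>
    rich (selected s') (Suc j) i \<and> card (selected s') \<le> j * (N * k) + i * k" for j i s'
  have sel: "selected (nset x a s') = selected s'" for x a s' by (simp add: selected_def)
  have inner: "wp (For ''i'' ''N'' (greedy_round mx)) s1 (\<lambda>t s'. t \<le> N * (K + 8) + 6 \<and> J j N s')"
    if fr: "frame (greedy mx) s s1" and j: "j < k" and I: "I j s1" and s1: "nvar s1 ''s'' = Suc j" for s1 j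
  proof (rule wp_mono, rule wp_For[where I = "J j" and K = K], goal_cases)
    case 1
    show ?case using I rich_0 by (simp add: I_def J_def sel)
  next
    case (5 i s')
    have J: "J j i s'" by (rule 5(5))
    have eqs: "nvar s' ''n'' = nvar s ''n''" "rvar s' ''alpha'' = rvar s ''alpha''"
      "narr s' ''adj'' = narr s ''adj''" "narr s' ''L'' = narr s ''L''" "nvar s' ''s'' = Suc j"
      using 5(4) fr s1 by (simp_all add: frame_def)
    have "Suc j * T \<le> k * T" using j by (intro mult_right_mono) auto
    then have dj: "1 + Suc j * T \<le> d" using d by linarith
    have "wp (greedy_round mx) s' (\<lambda>t s''. t \<le> K \<and> rich (selected s'') (Suc j) (Suc i) \<and>
        card (selected s'') \<le> card (selected s') + Suc j \<and> selected s' \<subseteq> selected s'')"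
      unfolding K_def
      by (rule greedy_round_correct[where d = d])
        (use s eqs J \<sigma> n dj tree_size_le[of "Suc j" k d] j in
          \<open>simp_all add: input_state_def low_state_def J_def\<close>)
    then show ?case
      by (rule wp_mono) (use J j rich_mono in \<open>auto simp: J_def sel\<close>)
  qed (use s fr in \<open>auto simp: frame_def J_def sel\<close>)
  have "wp (greedy mx) s (\<lambda>t s'. t \<le> k * ((N * (K + 8) + 12) + 8) + 6 \<and> I k s')"
    unfolding greedy_def
  proof (rule wp_mono, rule wp_For[where I = I and K = "N * (K + 8) + 12"], goal_cases)
    case 1
    show ?case by (simp add: I_def sel U)
  next
    case (5 j s')
    have "wp (For ''i'' ''N'' (greedy_round mx)) (nset ''s'' (Suc j) s') (\<lambda>t s'. t \<le> N * (K + 8) + 6 \<and> J j N s')"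
      using 5 s by (intro inner) (auto simp: frame_def I_def sel)
    then show ?case
    proof (simp add: 5(2), elim wp_mono conjE, intro conjI)
      fix t s2 assume "J j N s2"
      then show "I (Suc j) (nset ''j'' (Suc j) s2)"
        by (auto simp: I_def J_def sel le_Suc_eq algebra_simps)
    qed simp
  qed (use s in auto)
  then show ?thesis
    by (rule wp_mono) (auto simp: I_def K_def algebra_simps)
qed

lemma last_search_correct:
  assumes s: "input_state s" "low_state s" "nvar s ''k'' = k" and \<sigma>: "\<sigma> = (if mx then 1 else -1)"
    and n: "0 < n" and d: "card (selected s) + k * T \<le> d"
  shows "wp (last_search mx) s (\<lambda>t s'. t \<le> 400 * (n + 1) ^ 2 * ((d + 2) ^ k + 1) \<and>
    best {A \<in> grow (selected s) {}. card A = k} s')"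
proof -
  have nv: "nvar s ''n'' = n" using s by (simp add: input_state_def)
  show ?thesis unfolding last_search_def wp_Seq wp_Assign
  proof (rule wp_post[OF reset_correct[OF nv]])
    fix t s1 assume 1: "t \<le> n * 11 + 8 \<and> best {} s1" and fr: "frame reset s s1"
    let ?s2 = "nset ''s'' (nval (Var ''k'') s1) s1"
    have U: "selected ?s2 = selected s" using fr by (simp add: selected_def frame_def)
    have "ready final_test (selected s) {} k ?s2"
      using test_state_final[of ?s2] s fr unfolding U
      by (simp add: ready_def input_state_def low_state_def frame_def)
    moreover have "best {} ?s2" using 1 by (simp add: best_def)
    moreover have "card (ext (selected s) {} A) \<le> d" if "A \<in> grow (selected s) {}" "card A < k" for A
    proof -
      have "card (ext (selected s) {} A) \<le> card (selected s) + card A * T"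
        using growD[OF that(1)] by (intro card_ext) (auto simp: selected_def)
      moreover have "card A * T \<le> k * T" using that(2) by (intro mult_right_mono) auto
      ultimately show ?thesis using d by linarith
    qed
    ultimately have "wp (search mx final_test) ?s2 (\<lambda>t s'. t \<le> 300 * (n + 1) ^ 2 * (tree_size d k + 1) \<and>
        best ({} \<union> {A \<in> grow (selected s) {}. card A = k}) s')"
      using \<sigma> n by (intro search_correct) auto
    then show "wp (search mx final_test) ?s2 (\<lambda>u s'. t + (1 + ncost (Var ''k'') + u)
        \<le> 400 * (n + 1) ^ 2 * ((d + 2) ^ k + 1) \<and> best {A \<in> grow (selected s) {}. card A = k} s')"
    proof (rule wp_mono, elim conjE, intro conjI)
      fix u assume u: "u \<le> 300 * (n + 1) ^ 2 * (tree_size d k + 1)"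
      have "300 * (n + 1) ^ 2 * (tree_size d k + 1) \<le> 300 * (n + 1) ^ 2 * ((d + 2) ^ k + 1)"
        using tree_size_le[of k k d] by (intro mult_left_mono) auto
      moreover have "n * 11 + 10 \<le> 100 * (n + 1) ^ 2" by (simp add: power2_eq_square)
      moreover have "100 * (n + 1) ^ 2 \<le> 100 * (n + 1) ^ 2 * ((d + 2) ^ k + 1)" by simp
      moreover have "400 * (n + 1) ^ 2 * ((d + 2) ^ k + 1) =
          300 * (n + 1) ^ 2 * ((d + 2) ^ k + 1) + 100 * (n + 1) ^ 2 * ((d + 2) ^ k + 1)" by simp
      ultimately show "t + (1 + ncost (Var ''k'') + u) \<le> 400 * (n + 1) ^ 2 * ((d + 2) ^ k + 1)"
        using 1 u unfolding ncost.simps by linarith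
    qed simp
  qed
qed

end

section \<open>The algorithm and its running time\<close>

definition recip :: "vname \<Rightarrow> vname \<Rightarrow> com" where
  "recip r x = RAssign ''y'' (RNat (Const 0)) ;; Assign x (Const 0) ;;
    While (RLess (RVar ''y'') (RNat (Const 1)))
      (RAssign ''y'' (RAdd (RVar ''y'') (RVar r)) ;; Assign x (Add (Var x) (Const 1)))"

lemma mod_recip [simp]: "nmod (recip r x) = {x}" "amod (recip r x) = {}" "rmod (recip r x) = {''y''}"
  by (auto simp: recip_def)

text \<open>Division is replaced by adding the real to itself until the sum reaches 1; the number of
  additions is the rounded-up reciprocal.\<close>

lemma recip_correct:
  assumes r: "r \<noteq> ''y''" "0 < rvar s r"
  shows "wp (recip r x) s (\<lambda>t s'. t \<le> nat \<lceil>1 / rvar s r\<rceil> * 13 + 10 \<and> nvar s' x = nat \<lceil>1 / rvar s r\<rceil>)"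
proof -
  define \<rho> where "\<rho> = rvar s r"
  define M where "M = nat \<lceil>1 / \<rho>\<rceil>"
  have \<rho>: "0 < \<rho>" using r by (simp add: \<rho>_def)
  have M: "1 / \<rho> \<le> real M" unfolding M_def by linarith
  have Mle: "M \<le> j" if "1 / \<rho> \<le> real j" for j
    using that unfolding M_def by linarith
  define I where "I m s' \<longleftrightarrow> rvar s' r = \<rho> \<and> rvar s' ''y'' = real (nvar s' x) * \<rho> \<and>
    nvar s' x \<le> M \<and> m = M - nvar s' x" for m :: nat and s' :: state
  let ?s = "s\<lparr>rvar := (rvar s)(''y'' := 0), nvar := (nvar s)(x := 0)\<rparr>"
  let ?b = "RLess (RVar ''y'') (RNat (Const 1))"
  let ?c = "RAssign ''y'' (RAdd (RVar ''y'') (RVar r)) ;; Assign x (Add (Var x) (Const 1))"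
  have "wp (While ?b ?c) ?s (\<lambda>t s'. t \<le> M * (8 + 1 + bcost ?b) + 1 + bcost ?b \<and> (\<exists>m. I m s') \<and> \<not> bval ?b s')"
  proof (rule wp_While[of I])
    show "I M ?s" using r by (simp add: I_def \<rho>_def)
    fix m s' assume I: "I m s'" and b: "bval ?b s'"
    then have "real (nvar s' x) < 1 / \<rho>" using \<rho> by (simp add: I_def pos_less_divide_eq)
    then have "nvar s' x < M" using M by linarith
    then show "wp ?c s' (\<lambda>t s'. t \<le> 8 \<and> (\<exists>m'<m. I m' s'))"
      using I r by (auto simp: I_def algebra_simps)
  qed
  then have "wp (While ?b ?c) ?s (\<lambda>t s'. 5 + t \<le> M * 13 + 10 \<and> nvar s' x = M)"
  proof (rule wp_mono, elim conjE exE, intro conjI)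
    fix t s' m assume I: "I m s'" and b: "\<not> bval ?b s'"
    then have "1 / \<rho> \<le> real (nvar s' x)" using \<rho> by (simp add: I_def pos_divide_le_eq)
    then show "nvar s' x = M" using Mle I by (fastforce simp: I_def)
  qed simp
  then show ?thesis unfolding \<rho>_def[symmetric] M_def[symmetric]
    by (simp add: recip_def numeral_eq_Suc)
qed

definition mult :: "vname \<Rightarrow> vname \<Rightarrow> vname \<Rightarrow> com" where
  "mult z x y = Assign z (Const 0) ;; For ''w'' x (Assign z (Add (Var z) (Var y)))"

lemma mod_mult [simp]: "nmod (mult z x y) = {z, ''w''}" "amod (mult z x y) = {}" "rmod (mult z x y) = {}"
  by (auto simp: mult_def)

lemma mult_correct:
  assumes "z \<noteq> x" "z \<noteq> y" "z \<noteq> ''w''" "x \<noteq> ''w''" "y \<noteq> ''w''"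
  shows "wp (mult z x y) s (\<lambda>t s'. t \<le> nvar s x * 12 + 8 \<and> nvar s' z = nvar s x * nvar s y)"
proof -
  define I where "I j s' \<longleftrightarrow> nvar s' z = j * nvar s y" for j :: nat and s' :: state
  let ?s = "nset z 0 s"
  have "wp (For ''w'' x (Assign z (Add (Var z) (Var y)))) ?s
    (\<lambda>t s'. t \<le> nvar ?s x * (4 + 8) + 6 \<and> I (nvar ?s x) s' \<and> nvar s' ''w'' = nvar ?s x)"
    by (rule wp_For) (use assms in \<open>auto simp: I_def frame_def\<close>)
  then have "wp (For ''w'' x (Assign z (Add (Var z) (Var y)))) ?s
    (\<lambda>t s'. 2 + t \<le> nvar s x * 12 + 8 \<and> nvar s' z = nvar s x * nvar s y)"
    by (rule wp_mono) (use assms in \<open>auto simp: I_def\<close>)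
  then show ?thesis by (simp add: mult_def)
qed

text \<open>\<open>mult\<close> takes time linear in its first factor. The order of the products
  keeps the first factors at \<open>k\<close>, \<open>k * k\<close>, \<open>k * k * a\<close> and
  finally \<open>T + 1\<close>; for positive inputs all are at most \<open>T + 1\<close>.\<close>

definition thresholds :: com where
  "thresholds = mult ''g'' ''k'' ''k'' ;; mult ''r'' ''g'' ''a'' ;; mult ''g'' ''r'' ''e'' ;;
    Assign ''t'' (Add (Var ''g'') (Add (Var ''g'') (Var ''g''))) ;;
    Assign ''r'' (Add (Var ''t'') (Const 1)) ;; mult ''N'' ''r'' ''k''"

lemma mod_thresholds [simp]:
  "nmod thresholds = {''g'', ''r'', ''t'', ''N'', ''w''}" "amod thresholds = {}" "rmod thresholds = {}"
  by (auto simp: thresholds_def)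

lemma thresholds_correct:
  assumes T: "T = 3 * (nvar s ''k'' * nvar s ''k'' * nvar s ''a'' * nvar s ''e'')"
    and pos: "0 < nvar s ''k''" "0 < nvar s ''a''" "0 < nvar s ''e''"
  shows "wp thresholds s (\<lambda>t s'. t \<le> 100 * (T + 1) \<and> nvar s' ''t'' = T \<and> nvar s' ''N'' = (T + 1) * nvar s ''k'')"
proof -
  let ?k = "nvar s ''k''" and ?a = "nvar s ''a''" and ?e = "nvar s ''e''"
  have le: "?k \<le> T" "?k * ?k \<le> T" "?k * ?k * ?a \<le> T"
  proof -
    have "?k * 1 \<le> ?k * ?k" "?k * ?k * 1 \<le> ?k * ?k * ?a" "?k * ?k * ?a * 1 \<le> ?k * ?k * ?a * ?e"
      using pos by (intro mult_left_mono; simp)+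
    then show "?k \<le> T" "?k * ?k \<le> T" "?k * ?k * ?a \<le> T" unfolding T by linarith+
  qed
  show ?thesis unfolding thresholds_def wp_Seq
  proof (rule wp_post[OF mult_correct], goal_cases)
    case (6 t1 s1)
    then have 1: "nvar s1 ''g'' = ?k * ?k" "nvar s1 ''k'' = ?k" "nvar s1 ''a'' = ?a" "nvar s1 ''e'' = ?e"
      "t1 \<le> 12 * T + 8"
      using le by (auto simp: frame_def)
    show ?case
    proof (rule wp_post[OF mult_correct], goal_cases)
      case (6 t2 s2)
      then have 2: "nvar s2 ''r'' = ?k * ?k * ?a" "nvar s2 ''k'' = ?k" "nvar s2 ''e'' = ?e"
        "t2 \<le> 12 * T + 8"
        using le 1 by (auto simp: frame_def)
      show ?case
      proof (rule wp_post[OF mult_correct], goal_cases)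
        case (6 t3 s3)
        then have 3: "nvar s3 ''g'' = ?k * ?k * ?a * ?e" "nvar s3 ''k'' = ?k" 
          "t3 \<le> 12 * T + 8"
          using le 2 by (auto simp: frame_def)
        let ?s4 = "nset ''r'' (T + 1) (nset ''t'' T s3)"
        have "wp (mult ''N'' ''r'' ''k'') ?s4 (\<lambda>t s'. t1 + (t2 + (t3 + (6 + (4 + t)))) \<le> 100 * (T + 1) \<and>
            nvar s' ''t'' = T \<and> nvar s' ''N'' = (T + 1) * ?k)"
          by (rule wp_post[OF mult_correct]) (use 1 2 3 in \<open>auto simp: frame_def\<close>)
        moreover have "nvar s3 ''g'' + (nvar s3 ''g'' + nvar s3 ''g'') = T" using 3 by (simp add: T)
        ultimately show ?case by (simp add: numeral_eq_Suc)
      qed auto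
    qed auto
  qed auto
qed

definition degrees :: com where
  "degrees = Assign ''p'' (Const 0) ;; For ''u'' ''n'' (
    Assign ''d'' (Const 0) ;;
    For ''v'' ''n'' (
      If (pos (Arr ''adj'' (Var ''p''))) (Assign ''d'' (Add (Var ''d'') (Const 1))) Skip ;;
      Assign ''p'' (Add (Var ''p'') (Const 1))) ;;
    If (NLess (Var ''t'') (Var ''d'')) Skip (ArrAssign ''L'' (Var ''u'') (Const 1)))"

lemma mod_degrees [simp]:
  "nmod degrees = {''p'', ''u'', ''d'', ''v''}" "amod degrees = {''L''}" "rmod degrees = {}"
  by (auto simp: degrees_def)

lemma (in fcgp) degrees_correct:
  assumes s: "input_state s" "nvar s ''t'' = T" "\<forall>v<n. narr s ''L'' v = 0"
  shows "wp degrees s (\<lambda>t s'. t \<le> 60 * (n + 1) ^ 2 \<and> low_state s')"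
proof -
  define inner where "inner = For ''v'' ''n'' (
      If (pos (Arr ''adj'' (Var ''p''))) (Assign ''d'' (Add (Var ''d'') (Const 1))) Skip ;;
      Assign ''p'' (Add (Var ''p'') (Const 1)))"
  have mods: "nmod inner = {''p'', ''d'', ''v''}" "amod inner = {}" "rmod inner = {}"
    by (auto simp: inner_def)
  have nv: "nvar s ''n'' = n" using s by (simp add: input_state_def)
  define I where "I j s' \<longleftrightarrow> nvar s' ''p'' = j * n \<and>
    (\<forall>u<n. 0 < narr s' ''L'' u \<longleftrightarrow> u < j \<and> card (nbrs u) \<le> T)" for j :: nat and s' :: state
  have inner: "wp inner s1 (\<lambda>t s'. t \<le> n * (20 + 8) + 6 \<and> nvar s' ''p'' = Suc u * n \<and>
      nvar s' ''d'' = card (nbrs u))"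
    if s1: "nvar s1 ''n'' = n" "nvar s1 ''p'' = u * n" "nvar s1 ''d'' = 0" "narr s1 ''adj'' = narr s ''adj''"
      and u: "u < n" for s1 u
  proof -
    define J where "J j s' \<longleftrightarrow> nvar s' ''p'' = u * n + j \<and> nvar s' ''d'' = card (nbrs u \<inter> {..<j})"
      for j :: nat and s' :: state
    have J: "card (nbrs u \<inter> {..<Suc j}) = (if {u, j} \<in> E then Suc (card (nbrs u \<inter> {..<j}))
        else card (nbrs u \<inter> {..<j}))" for j
    proof -
      have "nbrs u \<inter> {..<Suc j} = (if {u, j} \<in> E then insert j (nbrs u \<inter> {..<j}) else nbrs u \<inter> {..<j})"
        by (auto simp: nbrs_def less_Suc_eq)
      then show ?thesis by simp
    qed
    have "nbrs u \<inter> {..<n} = nbrs u" using nbrs_subset by auto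
    then show ?thesis unfolding inner_def
      by (intro wp_mono[OF wp_For[where I = J and K = 20]])
        (use s1 s(1) u in \<open>auto simp: J_def J input_state_def frame_def\<close>)
  qed
  let ?body = "Assign ''d'' (Const 0) ;; inner ;;
    If (NLess (Var ''t'') (Var ''d'')) Skip (ArrAssign ''L'' (Var ''u'') (Const 1))"
  have "wp (For ''u'' ''n'' ?body) (nset ''p'' 0 s)
    (\<lambda>t s'. t \<le> n * ((n * 28 + 20) + 8) + 6 \<and> I n s')"
  proof (rule wp_mono, rule wp_For[where I = I and K = "n * 28 + 20"], goal_cases)
    case (5 j s')
    have jn: "j < n" and e: "nvar s' ''n'' = n" "narr s' ''adj'' = narr s ''adj''" "nvar s' ''t'' = T"
      using 5 nv s by (simp_all add: frame_def mods)
    have "wp inner (nset ''d'' 0 s') (\<lambda>t s''. wp (If (NLess (Var ''t'') (Var ''d'')) Skip (ArrAssign ''L'' (Var ''u'') (Const 1)))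
      s'' (\<lambda>u s3. 2 + (t + u) \<le> n * 28 + 20 \<and> I (Suc j) (nset ''u'' (Suc j) s3)))"
    proof (rule wp_post[OF inner[of _ j]], goal_cases)
      case (6 t s'')
      have "nvar s'' ''u'' = j" "nvar s'' ''t'' = T" "narr s'' ''L'' = narr s' ''L''"
        using 6(2) 5(2) e by (simp_all add: frame_def mods)
      then show ?case using 6 5(5) jn by (auto simp: I_def less_Suc_eq)
    qed (use 5 e jn in \<open>simp_all add: I_def\<close>)
    then show ?case by (auto elim!: wp_mono split: if_splits)
  qed (use s nv in \<open>auto simp: I_def mods\<close>)
  then have "wp degrees s (\<lambda>t s'. t \<le> 60 * (n + 1) ^ 2 \<and> I n s')"
    unfolding degrees_def inner_def[symmetric]
    by (auto elim!: wp_mono simp: power2_eq_square algebra_simps)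
  then show ?thesis by (rule wp_mono) (auto simp: I_def low_state_def)
qed

text \<open>For \<open>k = 0\<close> the initial zero array \<open>S\<close> is already the answer.
  For \<open>k > 0\<close> any instance has \<open>n > 0\<close>, which the search requires.\<close>

definition main :: "bool \<Rightarrow> com" where
  "main mx = If (pos (Var ''k''))
    (recip ''alpha'' ''a'' ;; recip ''eps'' ''e'' ;; thresholds ;; degrees ;; greedy mx ;; last_search mx) Skip"

text \<open>With \<open>a\<close> and \<open>e\<close> the reciprocals of \<open>\<alpha>\<close> and \<open>\<epsilon>\<close> rounded up (the machine
  cannot multiply reals), this makes \<open>\<epsilon> \<alpha> T \<ge> 3 k\<^sup>2\<close>.\<close>

definition degree_bound :: "nat \<Rightarrow> nat \<Rightarrow> nat \<Rightarrow> nat" where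
  "degree_bound k a e = 3 * (k * k * a * e)"

text \<open>The first summand bounds the size of \<open>U\<close>, namely \<open>k * N\<close> picks
  of at most \<open>k\<close> vertices; the second counts neighbours of low-degree members; the 1 is
  the single seed of a greedy search.\<close>

definition branching :: "nat \<Rightarrow> nat \<Rightarrow> nat \<Rightarrow> nat" where
  "branching k a e = k * ((degree_bound k a e + 1) * k) * k + k * degree_bound k a e + 1"

definition run_time :: "nat \<Rightarrow> nat \<Rightarrow> nat \<Rightarrow> nat \<Rightarrow> nat" where
  "run_time n k a e = 30 + a * 13 + e * 13 + 100 * (degree_bound k a e + 1) + 60 * (n + 1) ^ 2 +
    (k * ((degree_bound k a e + 1) * k * (400 * (n + 1) ^ 3 * ((branching k a e + 2) ^ k + 1) + 8) + 20) + 6) +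
    400 * (n + 1) ^ 2 * ((branching k a e + 2) ^ k + 1)"

lemma main_correct:
  assumes sg: "simple_graph {..<n} E" and \<alpha>: "0 < \<alpha>" "\<alpha> \<le> 1" and \<epsilon>: "0 < \<epsilon>" "\<epsilon> \<le> 1"
    and k: "0 < k" "k \<le> n" and \<sigma>: "\<sigma> = (if mx then 1 else -1)"
    and a: "a = nat \<lceil>1 / \<alpha>\<rceil>" and e: "e = nat \<lceil>1 / \<epsilon>\<rceil>"
  shows "wp (main mx) (fcgp_input n E k \<alpha> \<epsilon>) (\<lambda>t s'. t \<le> run_time n k a e \<and>
    (fcgp_output n s' \<subseteq> {..<n} \<and> card (fcgp_output n s') = k \<and>
     (\<forall>A. A \<subseteq> {..<n} \<and> card A = k \<and>
          (\<forall>B. B \<subseteq> {..<n} \<and> card B = k \<longrightarrow> \<sigma> * cov \<alpha> {..<n} E B \<le> \<sigma> * cov \<alpha> {..<n} E A) \<longrightarrow>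
        \<sigma> * cov \<alpha> {..<n} E A - \<epsilon> * cov \<alpha> {..<n} E A \<le> \<sigma> * cov \<alpha> {..<n} E (fcgp_output n s'))))"
proof -
  define T where "T = degree_bound k a e"
  define d where "d = branching k a e"
  define N where "N = (T + 1) * k"
  interpret fcgp n E \<alpha> \<sigma> T using sg by unfold_locales
  have n: "0 < n" using k by simp
  have a1: "1 \<le> \<alpha> * real a" and e1: "1 \<le> \<epsilon> * real e"
  proof -
    have "1 / \<alpha> \<le> real a" "1 / \<epsilon> \<le> real e" unfolding a e by linarith+
    then show "1 \<le> \<alpha> * real a" "1 \<le> \<epsilon> * real e" using \<alpha> \<epsilon> by (simp_all add: pos_divide_le_eq mult.commute)
  qed
  have apos: "0 < a" "0 < e" using a1 e1 by (auto intro: Nat.gr0I)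
  have T: "3 * real k ^ 2 \<le> \<epsilon> * (\<alpha> * real T)"
  proof -
    \<comment> \<open>Rounding up makes both \<alpha>\<open>a\<close> and \<epsilon>\<open>e\<close>
      at least 1, so \<open>T\<close> may use the integers in place of the reciprocals.\<close>
    have "3 * real k ^ 2 * 1 \<le> 3 * real k ^ 2 * ((\<alpha> * real a) * (\<epsilon> * real e))"
      using mult_mono[OF a1 e1] \<alpha> by (intro mult_left_mono) auto
    then show ?thesis by (simp add: T_def degree_bound_def power2_eq_square mult_ac)
  qed
  let ?s0 = "fcgp_input n E k \<alpha> \<epsilon>"
  define good where "good s' \<longleftrightarrow> (fcgp_output n s' \<subseteq> {..<n} \<and> card (fcgp_output n s') = k \<and>
     (\<forall>A. A \<subseteq> {..<n} \<and> card A = k \<and>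
          (\<forall>B. B \<subseteq> {..<n} \<and> card B = k \<longrightarrow> \<sigma> * cov \<alpha> {..<n} E B \<le> \<sigma> * cov \<alpha> {..<n} E A) \<longrightarrow>
        \<sigma> * cov \<alpha> {..<n} E A - \<epsilon> * cov \<alpha> {..<n} E A \<le> \<sigma> * cov \<alpha> {..<n} E (fcgp_output n s')))" for s'
  have good: "good s'" if b: "best {A \<in> grow U {}. card A = k} s'" and U: "U \<subseteq> {..<n}"
    and rich: "\<And>r. 1 \<le> r \<Longrightarrow> r \<le> k \<Longrightarrow> rich U r N" for s' U
  proof -
    have "N = k * (T + 1)" by (simp add: N_def)
    then obtain K where K: "K \<in> grow U {}" "card K = k" "\<And>A. opt k A \<Longrightarrow> val A - \<epsilon> * (\<sigma> * val A) \<le> val K"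
      using approximation[OF \<alpha> \<epsilon> _ T U] rich k \<sigma> by (auto split: if_splits)
    \<comment> \<open>\<open>K\<close> is only known to exist among the grown \<open>k\<close>-sets;
      the set kept by the search is at least as good.\<close>
    then have ne: "{A \<in> grow U {}. card A = k} \<noteq> {}" by blast
    then obtain B where B: "B \<in> grow U {}" "card B = k" "\<forall>v<n. 0 < narr s' ''S'' v \<longleftrightarrow> v \<in> B" "val K \<le> val B"
      using b K(1,2) unfolding best_def if_not_P[OF ne] by blast
    have Bn: "B \<subseteq> {..<n}" using growD[OF B(1)] by blast
    then have out: "fcgp_output n s' = B" using B(3) by (auto simp: fcgp_output_def)
    show ?thesis unfolding good_def out
    proof (intro conjI allI impI)
      fix A assume A: "A \<subseteq> {..<n} \<and> card A = k \<and>
        (\<forall>B. B \<subseteq> {..<n} \<and> card B = k \<longrightarrow> \<sigma> * cov \<alpha> {..<n} E B \<le> \<sigma> * cov \<alpha> {..<n} E A)"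
      then have "opt k A" by (auto simp: opt_def val_eq_cov)
      then have "val A - \<epsilon> * (\<sigma> * val A) \<le> val B" using K(3) B(4) by force
      then show "\<sigma> * cov \<alpha> {..<n} E A - \<epsilon> * cov \<alpha> {..<n} E A \<le> \<sigma> * cov \<alpha> {..<n} E B"
      proof -
        have v: "val A = 2 * \<sigma> * cov \<alpha> {..<n} E A" "val B = 2 * \<sigma> * cov \<alpha> {..<n} E B"
          using A Bn by (simp_all add: val_eq_cov)
        moreover have "\<sigma> * \<sigma> = 1" using \<sigma> by simp
        then have "\<sigma> * val A = 2 * cov \<alpha> {..<n} E A"
          unfolding v(1) by (simp add: mult.assoc[symmetric] mult.commute[of \<sigma> 2])
        with \<open>val A - \<epsilon> * (\<sigma> * val A) \<le> val B\<close>
        have "val A - \<epsilon> * (2 * cov \<alpha> {..<n} E A) \<le> val B" by simp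
        ultimately show ?thesis by simp
      qed
    qed (use Bn B(2) in auto)
  qed
  have input: "input_state s'" if "nvar s' ''n'' = n" "rvar s' ''alpha'' = \<alpha>" "narr s' ''adj'' = narr ?s0 ''adj''" for s'
    using that by (auto simp: input_state_def fcgp_input_def row_index_less)
  have "wp (recip ''alpha'' ''a'' ;; recip ''eps'' ''e'' ;; thresholds ;; degrees ;; greedy mx ;; last_search mx) ?s0
    (\<lambda>t s'. 5 + t \<le> run_time n k a e \<and> good s')"
    unfolding wp_Seq
  proof (rule wp_post[OF recip_correct], goal_cases)
    case (3 t1 s1)
    then have 1: "nvar s1 ''a'' = a" "t1 \<le> a * 13 + 10" by (simp_all add: a fcgp_input_def)
    note f1 = 3(2)
    show ?case
    proof (rule wp_post[OF recip_correct], goal_cases)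
      case (3 t2 s2)
      have "rvar s1 ''eps'' = \<epsilon>" using f1 by (simp add: frame_def fcgp_input_def)
      then have 2: "nvar s2 ''e'' = e" "nvar s2 ''a'' = a" "t2 \<le> e * 13 + 10" "nvar s2 ''k'' = k"
        using 3 1 f1 by (simp_all add: e frame_def fcgp_input_def)
      note f2 = 3(2)
      show ?case
      proof (rule wp_post[OF thresholds_correct[of T]], goal_cases)
        case (5 t3 s3)
        then have 3: "nvar s3 ''t'' = T" "nvar s3 ''N'' = N" "t3 \<le> 100 * (T + 1)"
          using 2 by (simp_all add: N_def)
        note f3 = 5(2)
        show ?case
        proof (rule wp_post[OF degrees_correct], goal_cases)
          case 1
          show ?case by (rule input) (use f1 f2 f3 in \<open>simp_all add: frame_def fcgp_input_def\<close>)
        next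
          case 3
          show ?case using f1 f2 f3 by (simp_all add: frame_def fcgp_input_def)
        next
          case (4 t4 s4)
          note f4 = 4(2)
          have i4: "input_state s4" "low_state s4" "nvar s4 ''k'' = k" "nvar s4 ''N'' = N" "selected s4 = {}"
            and t4: "t4 \<le> 60 * (n + 1) ^ 2"
            using f1 f2 f3 f4 4(1) 3(2)
            by (auto simp: frame_def fcgp_input_def selected_def intro!: input)
          have d: "1 + k * T \<le> d" by (simp add: d_def branching_def T_def)
          show ?case
          proof (rule wp_post[OF greedy_correct[OF i4 \<sigma> n d]], goal_cases)
            case (1 t5 s5)
            have i5: "input_state s5" "low_state s5" "nvar s5 ''k'' = k"
              using i4 1(2) by (simp_all add: input_state_def low_state_def frame_def)
            have d5: "card (selected s5) + k * T \<le> d"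
              using 1(1) by (simp add: d_def branching_def T_def N_def)
            show ?case
            proof (rule wp_mono[OF last_search_correct[OF i5 \<sigma> n d5]], intro conjI)
              fix t6 s6 assume 6: "t6 \<le> 400 * (n + 1)\<^sup>2 * ((d + 2) ^ k + 1) \<and>
                best {A \<in> grow (selected s5) {}. card A = k} s6"
              show "5 + (t1 + (t2 + (t3 + (t4 + (t5 + t6))))) \<le> run_time n k a e"
                unfolding run_time_def T_def[symmetric] d_def[symmetric] N_def[symmetric]
                using 1(1) 6 t4 \<open>nvar s1 ''a'' = a\<close> \<open>t1 \<le> a * 13 + 10\<close> 2(3) 3(3) by linarith
              show "good s6" by (rule good[of "selected s5"]) (use 6 1(1) in \<open>auto simp: selected_def\<close>)
            qed
          qed
        qed (use 3 in simp)
      qed (use 2 k apos in \<open>simp_all add: T_def degree_bound_def\<close>)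
    qed (use f1 \<epsilon> in \<open>simp_all add: frame_def fcgp_input_def\<close>)
  qed (use \<alpha> in \<open>simp_all add: fcgp_input_def\<close>)
  note body = this
  have guard: "bval (pos (Var ''k'')) ?s0" using k(1) by (simp add: fcgp_input_def)
  show ?thesis
    unfolding main_def good_def[symmetric] wp_If if_P[OF guard] by (rule wp_mono[OF body]) simp
qed

section \<open>Simplifying the running time\<close>

lemma run_time_le:
  fixes X :: real
  assumes k: "0 < k" and pos: "0 < a" "0 < e" and X: "real (k * a * e) \<le> 4 * X" "real k \<le> X" "1 \<le> X"
  shows "real (run_time n k a e) \<le> 10 ^ 12 * X ^ (23 * k) * (real n + 1) ^ 23"
proof -
  \<comment> \<open>All parameters are at most \<open>Y\<close>, so the threshold is
    O(\<open>Y ^ 2\<close>) and the branching O(\<open>Y ^ 5\<close>); only the search tree has an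
    exponent involving \<open>k\<close>.\<close>
  define Y where "Y = k * a * e"
  define T where "T = degree_bound k a e"
  define D where "D = branching k a e"
  define M where "M = (n + 1) ^ 3"
  define P where "P = (10 * Y ^ 5) ^ k"
  have Y: "1 \<le> Y" "k \<le> Y" "a \<le> Y" "e \<le> Y" using k pos by (simp_all add: Y_def)
  have Ypow: "Y ^ i \<le> Y ^ j" if "i \<le> j" for i j using Y(1) that by (intro power_increasing)
  have T: "T \<le> 3 * Y ^ 2"
  proof -
    have "T = 3 * (Y * k)" by (simp add: T_def degree_bound_def Y_def)
    then show ?thesis using Y(2) by (simp add: power2_eq_square)
  qed
  have T1: "T + 1 \<le> 4 * Y ^ 2" using T Ypow[of 0 2] by simp
  have N: "(T + 1) * k \<le> 4 * Y ^ 3"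
    using mult_mono[OF T1 Y(2)] by (simp add: power2_eq_square power3_eq_cube)
  have kN: "k * ((T + 1) * k) \<le> 4 * Y ^ 4"
    using mult_mono[OF Y(2) N] by (simp add: eval_nat_numeral algebra_simps)
  have D: "D + 2 \<le> 10 * Y ^ 5"
  proof -
    have "k * ((T + 1) * k) * k \<le> 4 * Y ^ 5" using mult_mono[OF kN Y(2)] by (simp add: eval_nat_numeral algebra_simps)
    moreover have "k * T \<le> 3 * Y ^ 3" using mult_mono[OF Y(2) T] by (simp add: eval_nat_numeral algebra_simps)
    moreover have "Y ^ 3 \<le> Y ^ 5" "1 \<le> Y ^ 5" using Ypow[of 3 5] Ypow[of 0 5] by simp_all
    ultimately show ?thesis unfolding D_def branching_def T_def[symmetric] by linarith
  qed
  have DP: "(D + 2) ^ k \<le> P" unfolding P_def using D by (rule power_mono) simp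
  have P1: "1 \<le> P" unfolding P_def using D by (intro one_le_power) linarith
  have M1: "1 \<le> M" "(n + 1) ^ 2 \<le> M"
    unfolding M_def by (simp, intro power_increasing) simp_all
  have Y4: "1 \<le> Y ^ 4" "Y \<le> Y ^ 4" "Y ^ 2 \<le> Y ^ 4" using Ypow[of 0 4] Ypow[of 1 4] Ypow[of 2 4] by simp_all
  let ?Z = "Y ^ 4 * (M * P)"
  have MP: "M \<le> M * P" "1 \<le> M * P" using P1 M1 by (simp_all add: Suc_le_eq)
  have Z1: "Y ^ 4 \<le> ?Z" "M * P \<le> ?Z" using MP Y4 by simp_all
  have "(n + 1) ^ 2 * ((D + 2) ^ k + 1) \<le> M * (P + P)"
    using M1 DP P1 by (intro mult_mono add_mono) auto
  also have "\<dots> = 2 * (M * P)" by simp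
  finally have A: "400 * (n + 1) ^ 2 * ((D + 2) ^ k + 1) \<le> 800 * ?Z"
    using Z1(2) unfolding mult.assoc by linarith
  have "M * ((D + 2) ^ k + 1) \<le> M * (P + P)" using DP P1 by (intro mult_left_mono) auto
  also have "\<dots> = 2 * (M * P)" by simp
  finally have "400 * M * ((D + 2) ^ k + 1) + 8 \<le> 808 * (M * P)"
    using MP(2) unfolding mult.assoc by linarith
  from mult_le_mono[OF kN this]
  have "k * ((T + 1) * k) * (400 * M * ((D + 2) ^ k + 1) + 8) \<le> 4 * Y ^ 4 * (808 * (M * P))" .
  also have "\<dots> = 3232 * ?Z" by simp
  finally have B: "k * ((T + 1) * k * (400 * (n + 1) ^ 3 * ((D + 2) ^ k + 1) + 8) + 20) + 6 \<le> 3258 * ?Z"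
    using Y(2) Y4 Z1 unfolding M_def[symmetric] distrib_left[of k] mult.assoc[symmetric] by linarith
  have sum_le: "30 + a * 13 + e * 13 + 100 * (T + 1) + 60 * q + b + c \<le> 5000 * z"
    if "a \<le> z" "e \<le> z" "T + 1 \<le> 4 * z" "q \<le> z" "b \<le> 3258 * z" "c \<le> 800 * z" "1 \<le> z"
    for q b c z :: nat
    using that by simp
  have "real (run_time n k a e) \<le> real (5000 * ?Z)"
    unfolding of_nat_le_iff run_time_def T_def[symmetric] D_def[symmetric]
  proof (rule sum_le[OF _ _ _ _ B A])
    show "a \<le> ?Z" "e \<le> ?Z" "T + 1 \<le> 4 * ?Z" "(n + 1) ^ 2 \<le> ?Z" "1 \<le> ?Z"
      using T1 Y Y4 Z1 MP M1 by linarith+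
  qed
  also have "\<dots> = 5000 * real Y ^ 4 * real M * (10 * real Y ^ 5) ^ k"
    by (simp add: P_def)
  also have "\<dots> \<le> 5000 * (4 * X) ^ 4 * real M * (10 * (4 * X) ^ 5) ^ k"
    using X unfolding Y_def[symmetric] by (intro mult_mono power_mono) auto
  also have "\<dots> = 1280000 * X ^ 4 * (10240 * X ^ 5) ^ k * (real n + 1) ^ 3"
    by (simp add: M_def power_mult_distrib add.commute)
  also have "\<dots> \<le> 1280000 * X ^ (4 * k) * (10240 * X ^ (14 * k) * X ^ (5 * k)) * (real n + 1) ^ 23"
  proof -
    have 1: "X ^ 4 \<le> X ^ (4 * k)" using X(3) k by (intro power_increasing) auto
    \<comment> \<open>10240 = 10 * 4^5. A factor \<open>c ^ k\<close> is not always below a power of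
      \<open>X\<close>, since \<open>X\<close> may be 1; but then \<open>k = 1\<close> and the
      leading constant takes it. For \<open>k\<close> at least 2 also \<open>X\<close> is, and 10240
      \<le> 2^14.\<close>
    have 2: "10240 ^ k \<le> 10240 * X ^ (14 * k)"
    proof (cases "k = 1")
      case True
      then show ?thesis using X(3) by simp
    next
      case False
      then have "2 \<le> X" using X(2) k by linarith
      then have "2 ^ 14 \<le> X ^ 14" by (intro power_mono) auto
      then have "10240 \<le> X ^ 14" by simp
      then have "10240 ^ k \<le> (X ^ 14) ^ k" by (intro power_mono) auto
      also have "\<dots> \<le> 10240 * X ^ (14 * k)" using X(3) by (simp add: power_mult)
      finally show ?thesis .
    qed
    have 3: "(10240 * X ^ 5) ^ k = 10240 ^ k * X ^ (5 * k)" by (simp add: power_mult_distrib power_mult)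
    \<comment> \<open>The exponent 23 = 4 + 14 + 5 comes from \<open>X\<close>; the one of
      \<open>n\<close> is raised to match, as the theorem uses one \<open>c\<close> for
      both.\<close>
    have 4: "(real n + 1) ^ 3 \<le> (real n + 1) ^ 23" by (intro power_increasing) auto
    show ?thesis unfolding 3 using 1 2 4 X(3) by (intro mult_mono) auto
  qed
  also have "\<dots> = 13107200000 * X ^ (23 * k) * (real n + 1) ^ 23"
  proof -
    have "X ^ (4 * k) * (X ^ (14 * k) * X ^ (5 * k)) = X ^ (23 * k)"
      by (simp add: power_add[symmetric])
    then show ?thesis by (simp add: mult_ac)
  qed
  also have "\<dots> \<le> 10 ^ 12 * X ^ (23 * k) * (real n + 1) ^ 23"
    using X(3) by (intro mult_right_mono) auto
  finally show ?thesis .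
qed

text \<open>Rounding up adds less than 1, and 1 \<le> 1 / \<open>x\<close>. Two such roundings
  produce the factor 4 in \<open>run_time_le\<close>.\<close>

lemma ceiling_inverse_le:
  fixes x :: real
  assumes "0 < x" "x \<le> 1"
  shows "real (nat \<lceil>1 / x\<rceil>) \<le> 2 / x" "0 < nat \<lceil>1 / x\<rceil>"
proof -
  have "1 \<le> 1 / x" using assms by simp
  then show "real (nat \<lceil>1 / x\<rceil>) \<le> 2 / x" "0 < nat \<lceil>1 / x\<rceil>" by linarith+
qed

lemma main_solves:
  assumes good: "\<And>\<alpha> \<epsilon> E n k S. \<epsilon> \<le> 1 \<Longrightarrow> S \<subseteq> {..<n} \<Longrightarrow> card S = k \<Longrightarrow>
      (\<And>A. A \<subseteq> {..<n} \<Longrightarrow> card A = k \<Longrightarrow>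
          (\<forall>B. B \<subseteq> {..<n} \<and> card B = k \<longrightarrow>
            (if mx then 1 else -1) * cov \<alpha> {..<n} E B \<le> (if mx then 1 else -1) * cov \<alpha> {..<n} E A) \<Longrightarrow>
        (if mx then 1 else -1) * cov \<alpha> {..<n} E A - \<epsilon> * cov \<alpha> {..<n} E A
          \<le> (if mx then 1 else -1) * cov \<alpha> {..<n} E S) \<Longrightarrow> good \<alpha> \<epsilon> {..<n} E k S"
  shows "solves_within (main mx)
    (\<lambda>n k \<alpha> \<epsilon>. 10 ^ 12 * (real k / (\<epsilon> * \<alpha>)) ^ (23 * k) * (real n + 1) ^ 23) good"
  unfolding solves_within_def
proof (intro allI impI, elim conjE)
  fix \<alpha> \<epsilon> :: real and n k :: nat and E
  assume h: "0 < \<alpha>" "\<alpha> \<le> 1" "0 < \<epsilon>" "\<epsilon> \<le> 1" "simple_graph {..<n} E" "k \<le> n"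
  show "\<exists>t s'. exec (main mx) (fcgp_input n E k \<alpha> \<epsilon>) t s' \<and>
    real t \<le> 10 ^ 12 * (real k / (\<epsilon> * \<alpha>)) ^ (23 * k) * (real n + 1) ^ 23 \<and>
    good \<alpha> \<epsilon> {..<n} E k (fcgp_output n s')"
  proof (cases "k = 0")
    case True
    let ?s = "fcgp_input n E k \<alpha> \<epsilon>"
    have "wp (main mx) ?s (\<lambda>t s'. t \<le> 6 \<and> s' = ?s)"
      using True by (simp add: main_def fcgp_input_def)
    then obtain t where t: "exec (main mx) ?s t ?s" "t \<le> 6" unfolding wp_def by blast
    have 1: "1 \<le> (real n + 1) ^ 23" by (intro one_le_power) simp
    have "real t \<le> 10 ^ 12 * (real n + 1) ^ 23" proof -
      have "real t \<le> 10 ^ 12 * 1" using t(2) by simp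
      also have "\<dots> \<le> 10 ^ 12 * (real n + 1) ^ 23" using 1 by (rule mult_left_mono) simp
      finally show ?thesis .
    qed
    \<comment> \<open>The middle factor is \<open>0 ^ 0 = 1\<close>.\<close>
    then have "real t \<le> 10 ^ 12 * (real k / (\<epsilon> * \<alpha>)) ^ (23 * k) * (real n + 1) ^ 23"
      using True by simp
    moreover have "fcgp_output n ?s = {}" by (simp add: fcgp_output_def fcgp_input_def)
    moreover have "good \<alpha> \<epsilon> {..<n} E k {}"
    proof (rule good[OF h(4)])
      fix A assume "A \<subseteq> {..<n}" "card A = k"
      then have "A = {}" using True finite_subset[of A "{..<n}"] by simp
      moreover have "edges_in E {} = 0" 
        using h(5) by (auto simp: edges_in_def simple_graph_def)
      then have "cov \<alpha> {..<n} E {} = 0" by (simp add: cov_def edges_between_def)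
      ultimately show "(if mx then 1 else -1) * cov \<alpha> {..<n} E A - \<epsilon> * cov \<alpha> {..<n} E A
          \<le> (if mx then 1 else -1) * cov \<alpha> {..<n} E {}" by simp
    qed (use True in simp_all)
    ultimately show ?thesis using t(1) by (intro exI[of _ t] exI[of _ ?s]) simp
  next
    case False
    define a e where "a = nat \<lceil>1 / \<alpha>\<rceil>" and "e = nat \<lceil>1 / \<epsilon>\<rceil>"
    let ?X = "real k / (\<epsilon> * \<alpha>)"
    have "wp (main mx) (fcgp_input n E k \<alpha> \<epsilon>) (\<lambda>t s'. t \<le> run_time n k a e \<and>
        good \<alpha> \<epsilon> {..<n} E k (fcgp_output n s'))"
    proof (rule wp_mono[OF main_correct[OF h(5,1,2,3,4) _ h(6) refl a_def e_def]], goal_cases)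
      case (2 t s')
      then show ?case by (intro conjI good[OF h(4)]) blast+
    qed (use False in simp)
    then obtain t s' where t: "exec (main mx) (fcgp_input n E k \<alpha> \<epsilon>) t s'" "t \<le> run_time n k a e"
      "good \<alpha> \<epsilon> {..<n} E k (fcgp_output n s')" unfolding wp_def by blast
    have ae: "real a \<le> 2 / \<alpha>" "real e \<le> 2 / \<epsilon>" "0 < a" "0 < e"
      using ceiling_inverse_le h(1-4) unfolding a_def e_def by blast+
    have "real (k * a * e) \<le> real k * (2 / \<alpha>) * (2 / \<epsilon>)"
      using ae h by (simp only: of_nat_mult) (intro mult_mono; simp)
    then have 1: "real (k * a * e) \<le> 4 * ?X" by (simp add: mult_ac)
    have "\<epsilon> * \<alpha> \<le> 1 * 1" using h by (intro mult_mono) auto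
    then have 2: "real k \<le> ?X" using h by (simp add: pos_le_divide_eq mult_left_le)
    then have 3: "1 \<le> ?X" using False by linarith
    have "real t \<le> real (run_time n k a e)" using t(2) by simp
    also have "\<dots> \<le> 10 ^ 12 * ?X ^ (23 * k) * (real n + 1) ^ 23"
      using False ae 1 2 3 by (intro run_time_le) auto
    finally show ?thesis using t(1,3) by blast
  qed
qed

section \<open>Computability of the parameter function and conclusion\<close>

lemma computable3_power: "computable3 (\<lambda>x y z. C * (x * y * z) ^ (c * x))"
  unfolding computable3_def
proof (rule exI, intro allI)
  fix x y z
  let ?P = "mult ''g'' ''x'' ''y'' ;; mult ''r'' ''g'' ''z'' ;; Assign ''c'' (Const c) ;; mult ''m'' ''c'' ''x'' ;;
    Assign ''result'' (Const C) ;;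
    For ''i'' ''m'' (mult ''g'' ''r'' ''result'' ;; Assign ''result'' (Var ''g''))"
  let ?s = "\<lparr>nvar = (\<lambda>_. 0)(''x'' := x, ''y'' := y, ''z'' := z), narr = (\<lambda>_ _. 0), rvar = (\<lambda>_. 0)\<rparr>"
  have "wp ?P ?s (\<lambda>t s'. nvar s' ''result'' = C * (x * y * z) ^ (c * x))"
    unfolding wp_Seq
  proof (rule wp_post[OF mult_correct], goal_cases)
    case (6 t1 s1)
    then have 1: "nvar s1 ''g'' = x * y" "nvar s1 ''x'' = x" "nvar s1 ''z'' = z" by (simp_all add: frame_def)
    show ?case
    proof (rule wp_post[OF mult_correct], goal_cases)
      case (6 t2 s2)
      then have 2: "nvar s2 ''r'' = x * y * z" "nvar s2 ''x'' = x" using 1 by (simp_all add: frame_def)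
      show ?case unfolding wp_Assign
      proof (rule wp_post[OF mult_correct], goal_cases)
        case (6 t3 s3)
        then have 3: "nvar s3 ''m'' = c * x" "nvar s3 ''r'' = x * y * z"
          using 2 by (simp_all add: frame_def)
        define I where "I j s' \<longleftrightarrow> nvar s' ''result'' = C * (x * y * z) ^ j" for j :: nat and s' :: state
        let ?loop = "For ''i'' ''m'' (mult ''g'' ''r'' ''result'' ;; Assign ''result'' (Var ''g''))"
        let ?s4 = "nset ''result'' (nval (Const C) s3) s3"
        have "wp ?loop ?s4 (\<lambda>t s'. t \<le> c * x * (x * y * z * 12 + 10 + 8) + 6 \<and> I (c * x) s')"
        proof (rule wp_mono, rule wp_For[where I = I and K = "x * y * z * 12 + 10"], goal_cases)
          case (5 j s')
          then have r: "nvar s' ''r'' = x * y * z" using 3 by (simp add: frame_def)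
          show ?case unfolding wp_Seq
            by (rule wp_post[OF mult_correct]) (use 5(5) r in \<open>auto simp: I_def\<close>)
        qed (use 3 in \<open>auto simp: I_def\<close>)
        then show ?case by (rule wp_mono) (simp add: I_def)
      qed auto
    qed auto
  qed auto
  then show "\<exists>t s'. exec ?P ?s t s' \<and> nvar s' ''result'' = C * (x * y * z) ^ (c * x)"
    unfolding wp_def by blast
qed

lemma solves_within_mono:
  assumes "solves_within P R good"
    and "\<And>n k \<alpha> \<epsilon>. 0 < \<alpha> \<Longrightarrow> \<alpha> \<le> 1 \<Longrightarrow> 0 < \<epsilon> \<Longrightarrow> \<epsilon> \<le> 1 \<Longrightarrow> R n k \<alpha> \<epsilon> \<le> R' n k \<alpha> \<epsilon>"
  shows "solves_within P R' good"
  using assms unfolding solves_within_def by (meson order_trans)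

text \<open>Rounding both reciprocals up only enlarges the base
  \<open>k / (\<epsilon> * \<alpha>)\<close> and makes it a natural number; \<open>C\<close> is
  natural so that the whole bound is a computable function of naturals.\<close>

lemma fpt_approx_schemeI:
  assumes "solves_within P (\<lambda>n k \<alpha> \<epsilon>. real C * (real k / (\<epsilon> * \<alpha>)) ^ (c * k) * (real n + 1) ^ c) good"
  shows "fpt_approx_scheme good"
  unfolding fpt_approx_scheme_def
proof (intro exI conjI)
  show "computable3 (\<lambda>x y z. C * (x * y * z) ^ (c * x))" by (rule computable3_power)
  show "solves_within P (\<lambda>n k \<alpha> \<epsilon>.
      real (C * (k * nat \<lceil>1 / \<epsilon>\<rceil> * nat \<lceil>1 / \<alpha>\<rceil>) ^ (c * k)) * (real n + 1) ^ c) good"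
  proof (rule solves_within_mono[OF assms])
    fix n k :: nat and \<alpha> \<epsilon> :: real
    assume h: "0 < \<alpha>" "0 < \<epsilon>"
    have le: "1 / x \<le> real (nat \<lceil>1 / x\<rceil>)" for x :: real by linarith
    have "real k * (1 / \<epsilon>) * (1 / \<alpha>) \<le> real k * real (nat \<lceil>1 / \<epsilon>\<rceil>) * real (nat \<lceil>1 / \<alpha>\<rceil>)"
      by (intro mult_mono mult_nonneg_nonneg le order_refl of_nat_0_le_iff) (use h in simp_all)
    then have "real k / (\<epsilon> * \<alpha>) \<le> real (k * nat \<lceil>1 / \<epsilon>\<rceil> * nat \<lceil>1 / \<alpha>\<rceil>)" by simp
    then have "(real k / (\<epsilon> * \<alpha>)) ^ (c * k) \<le> real (k * nat \<lceil>1 / \<epsilon>\<rceil> * nat \<lceil>1 / \<alpha>\<rceil>) ^ (c * k)"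
      using h by (intro power_mono) auto
    then show "real C * (real k / (\<epsilon> * \<alpha>)) ^ (c * k) * (real n + 1) ^ c
        \<le> real (C * (k * nat \<lceil>1 / \<epsilon>\<rceil> * nat \<lceil>1 / \<alpha>\<rceil>) ^ (c * k)) * (real n + 1) ^ c"
      unfolding of_nat_mult[of C] of_nat_power by (intro mult_right_mono mult_left_mono) auto
  qed
qed

theorem theorem1:
  shows "(\<exists>P (C::real) (c::nat). solves_within P
            (\<lambda>n k \<alpha> \<epsilon>. C * (real k / (\<epsilon> * \<alpha>)) ^ (c * k) * (real n + 1) ^ c) max_fcgp_approx) \<and>
         (\<exists>P (C::real) (c::nat). solves_within P
            (\<lambda>n k \<alpha> \<epsilon>. C * (real k / (\<epsilon> * \<alpha>)) ^ (c * k) * (real n + 1) ^ c) min_fcgp_approx) \<and>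
         fpt_approx_scheme max_fcgp_approx \<and>
         fpt_approx_scheme min_fcgp_approx"
proof -
  \<comment> \<open>The constant is the image of a natural number, so that this fact fits both the
    explicit bound and \<open>fpt_approx_schemeI\<close>.\<close>
  have max: "solves_within (main True) (\<lambda>n k \<alpha> \<epsilon>.
      real (10 ^ 12) * (real k / (\<epsilon> * \<alpha>)) ^ (23 * k) * (real n + 1) ^ 23) max_fcgp_approx"
    unfolding of_nat_power of_nat_numeral
    by (rule main_solves) (simp add: max_fcgp_approx_def max_fcgp_optimal_def algebra_simps)
  \<comment> \<open>With \<sigma> = -1 the guarantee reads -cov(O) - \<epsilon> cov(O) \<le>
    -cov(S), which is the factor 1 + \<epsilon> after negation.\<close>
  have min: "solves_within (main False) (\<lambda>n k \<alpha> \<epsilon>.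
      real (10 ^ 12) * (real k / (\<epsilon> * \<alpha>)) ^ (23 * k) * (real n + 1) ^ 23) min_fcgp_approx"
    unfolding of_nat_power of_nat_numeral
    by (rule main_solves) (fastforce simp: min_fcgp_approx_def min_fcgp_optimal_def algebra_simps)
  show ?thesis
    using max min fpt_approx_schemeI[OF max] fpt_approx_schemeI[OF min] by blast
qed

end
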